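(* Let $T^n=\mathbb{R}^n/\mathbb{Z}^n$ be a flat torus. Then $$ H^{*,*}(T^n)=\mathbb{R}[a^1,\ldots,a^n,b^1,\ldots,b^n]\big/_{(a^1)^2,\ldots,(b^n)^2}, $$ (the quotient by the squares of all the generators $a^1,\ldots,a^n,b^1,\ldots,b^n$), where $a^i=[dx^i\otimes 1]\in H^{1,0}(T^n)$ and $b^i=[1\otimes dx^i]\in H^{0,1}(T^n)$.
   Context: A flat affine manifold $(M,D)$ is a manifold $M$ with a flat affine connection $D$ (locally there are flat coordinates $x^1,\ldots,x^n$); the torus $T^n=\mathbb{R}^n/\mathbb{Z}^n$ carries the flat affine structure induced from $\mathbb{R}^n$, and $x^1,\ldots,x^n$ are the standard coordinates of $\mathbb{R}^n$. Write $\Lambda^kM$ for the differential $k$-forms on $M$ and $\Lambda^{p,q}M=\Lambda^pM\otimes\Lambda^qM$ (tensor product over $C^\infty(M)$), with the connection $D:\Lambda^{p,q}M\to\Lambda^1M\otimes\Lambda^{p,q}M$ induced by $D$. Let $e:\Lambda^1M\otimes\Lambda^{p,q}M\to\Lambda^{p+1,q}M$ be given by $e(\eta\otimes\alpha\otimes\beta)=(\eta\wedge\alpha)\otimes\beta$, and put $\partial=e\circ D:\Lambda^{p,q}M\to\Lambda^{p+1,q}M$. In flat coordinates, $\partial\left(\sum_{I,J}f_{I,J}\,dx^I\otimes dx^J\right)=\sum_{I,J}(df_{I,J}\wedge dx^I)\otimes dx^J$, and $\partial^2=0$. The Dolbeault–Koszul cohomology of $M$ is $$H^{p,q}(M)=\frac{\ker(\partial:\Lambda^{p,q}M\to\Lambda^{p+1,q}M)}{\operatorname{im}(\partial:\Lambda^{p-1,q}M\to\Lambda^{p,q}M)},$$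 and $H^{*,*}(M)$ denotes the collection of all the groups $H^{p,q}(M)$. The space $\Lambda^{*,*}M$ carries the $C^\infty(M)$-bilinear product defined on decomposable elements by $(\alpha_1\otimes\beta_1)\wedge(\alpha_2\otimes\beta_2)=(\alpha_1\wedge\alpha_2)\otimes(\beta_1\wedge\beta_2)$.
   Formalization: The polynomial ring is read as bigraded-commutative (the a's anticommute, the b's anticommute, a's commute with b's); with the ordinary commutative ring the ring isomorphism fails for n ≥ 2, since a^1a^2 = -a^2a^1 is nonzero. *)

theory Defs
  imports
    "HOL-Analysis.Analysis"
    "HOL-Combinatorics.Permutations"
    "HOL-Algebra.QuotRing"
    "HOL-Algebra.Product_Groups"
begin

section \<open>The flat torus\<close>

definition lattice_rel :: "real ^ 'n \<Rightarrow> real ^ 'n \<Rightarrow> bool" where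
  "lattice_rel x y \<longleftrightarrow> (\<forall>i. x $ i - y $ i \<in> \<int>)"

lemma equivp_lattice_rel: "equivp lattice_rel"
proof (rule equivpI)
  show "reflp lattice_rel"
    by (simp add: reflp_def lattice_rel_def)
  show "symp lattice_rel"
    unfolding symp_def lattice_rel_def by (metis Ints_minus minus_diff_eq)
  show "transp lattice_rel"
  proof (rule transpI)
    fix x y z :: "real ^ 'n"
    assume "lattice_rel x y" "lattice_rel y z"
    then have "\<forall>i. (x $ i - y $ i) + (y $ i - z $ i) \<in> \<int>"
      unfolding lattice_rel_def by (blast intro: Ints_add)
    then show "lattice_rel x z"
      by (simp add: lattice_rel_def)
  qed
qed

quotient_type 'n torus = "real ^ ('n::finite)" / lattice_rel
  by (rule equivp_lattice_rel)

text \<open>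
  The quotient map \<open>abs_torus\<close> is the covering map, and the flat structure of the torus is the one
  for which \<open>abs_torus\<close> is a local isomorphism: the local inverses of \<open>abs_torus\<close> are the flat
  charts.  Thus a function on the torus is smooth iff its lift to \<open>\<real>\<^sup>n\<close> is, and every tangent space
  is identified with \<open>\<real>\<^sup>n\<close> through the coordinate frame, which is global and parallel.
\<close>

primrec Ck :: "nat \<Rightarrow> ('a::real_normed_vector \<Rightarrow> real) \<Rightarrow> bool" where
  "Ck 0 f \<longleftrightarrow> continuous_on UNIV f"
| "Ck (Suc k) f \<longleftrightarrow> (\<forall>x. f differentiable (at x)) \<and> (\<forall>v. Ck k (\<lambda>x. frechet_derivative f (at x) v))"

definition torus_smooth :: "('n::finite torus \<Rightarrow> real) \<Rightarrow> bool" where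
  "torus_smooth f \<longleftrightarrow> (\<forall>k. Ck k (\<lambda>x. f (abs_torus x)))"

definition torus_deriv :: "('n::finite torus \<Rightarrow> real) \<Rightarrow> 'n torus \<Rightarrow> real ^ 'n \<Rightarrow> real" where
  "torus_deriv f P w = frechet_derivative (\<lambda>x. f (abs_torus x)) (at (rep_torus P)) w"

section \<open>Forms of type \<open>(p,q)\<close>\<close>

text \<open>
  A tuple of vectors is a function \<open>nat \<Rightarrow> 'v\<close>; an alternating \<open>p\<close>-linear map reads only the
  entries at positions below \<open>p\<close>, so that each such map has exactly one representation.
\<close>

definition alt_map :: "nat \<Rightarrow> ((nat \<Rightarrow> 'v::real_vector) \<Rightarrow> real) \<Rightarrow> bool" where
  "alt_map p m \<longleftrightarrow>
     (\<forall>u u'. (\<forall>i<p. u i = u' i) \<longrightarrow> m u = m u') \<and>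
     (\<forall>u. \<forall>i<p. linear (\<lambda>w. m (u(i := w)))) \<and>
     (\<forall>u. \<forall>i<p. \<forall>j<p. i \<noteq> j \<and> u i = u j \<longrightarrow> m u = 0)"

type_synonym 'n form = "'n torus \<Rightarrow> (nat \<Rightarrow> real ^ 'n) \<Rightarrow> real"
type_synonym 'n biform = "'n torus \<Rightarrow> (nat \<Rightarrow> real ^ 'n) \<Rightarrow> (nat \<Rightarrow> real ^ 'n) \<Rightarrow> real"

text \<open>
  A section of \<open>\<Lambda>\<^sup>p \<otimes> \<Lambda>\<^sup>q\<close> is a tensor field in \<open>p + q\<close> vector arguments that is alternating in the
  first \<open>p\<close> and in the last \<open>q\<close>; the decomposable \<open>\<alpha> \<otimes> \<beta>\<close> is \<open>(u, v) \<mapsto> \<alpha> u * \<beta> v\<close>.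
\<close>

definition biforms :: "nat \<Rightarrow> nat \<Rightarrow> 'n::finite biform set" where
  "biforms p q = {\<omega>.
     (\<forall>P v. alt_map p (\<lambda>u. \<omega> P u v)) \<and>
     (\<forall>P u. alt_map q (\<lambda>v. \<omega> P u v)) \<and>
     (\<forall>u v. torus_smooth (\<lambda>P. \<omega> P u v))}"

definition tensor :: "'n::finite form \<Rightarrow> 'n form \<Rightarrow> 'n biform" where
  "tensor \<alpha> \<beta> = (\<lambda>P u v. \<alpha> P u * \<beta> P v)"

definition dx :: "'n::finite \<Rightarrow> 'n form" where
  "dx i = (\<lambda>P u. u 0 $ i)"

definition const_form :: "real \<Rightarrow> 'n::finite form" where
  "const_form r = (\<lambda>P u. r)"

definition wedge :: "nat \<Rightarrow> nat \<Rightarrow> 'n::finite form \<Rightarrow> 'n form \<Rightarrow> 'n form" where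
  "wedge p p' \<alpha> \<beta> = (\<lambda>P u.
     (\<Sum>\<sigma> | \<sigma> permutes {..<p + p'}.
        of_int (sign \<sigma>) * (\<alpha> P (\<lambda>i. u (\<sigma> i)) * \<beta> P (\<lambda>i. u (\<sigma> (p + i))))) / (fact p * fact p'))"

definition biwedge ::
  "nat \<Rightarrow> nat \<Rightarrow> nat \<Rightarrow> nat \<Rightarrow> 'n::finite biform \<Rightarrow> 'n biform \<Rightarrow> 'n biform" where
  "biwedge p q p' q' \<omega> \<eta> = (\<lambda>P u v.
     (\<Sum>\<sigma> | \<sigma> permutes {..<p + p'}. \<Sum>\<tau> | \<tau> permutes {..<q + q'}.
        of_int (sign \<sigma>) * of_int (sign \<tau>) *
        (\<omega> P (\<lambda>i. u (\<sigma> i)) (\<lambda>j. v (\<tau> j)) *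
         \<eta> P (\<lambda>i. u (\<sigma> (p + i))) (\<lambda>j. v (\<tau> (q + j)))))
     / (fact p * fact p' * (fact q * fact q')))"

lemma biwedge_tensor:
  "biwedge p q p' q' (tensor \<alpha>1 \<beta>1) (tensor \<alpha>2 \<beta>2)
     = tensor (wedge p p' \<alpha>1 \<alpha>2) (wedge q q' \<beta>1 \<beta>2)"
  unfolding biwedge_def tensor_def wedge_def times_divide_times_eq sum_product
  by (intro ext arg_cong2[where f = "(/)"] sum.cong refl) (simp only: mult_ac)

section \<open>The operator \<open>\<partial> = e \<circ> D\<close>\<close>

text \<open>
  Elements of \<open>\<Lambda>\<^sup>1 \<otimes> \<Lambda>\<^bsup>p,q\<^esup>\<close> take one further vector as an additional first argument.
\<close>

definition nabla ::
  "'n::finite biform \<Rightarrow> 'n torus \<Rightarrow> real ^ 'n \<Rightarrow> (nat \<Rightarrow> real ^ 'n) \<Rightarrow> (nat \<Rightarrow> real ^ 'n) \<Rightarrow> real" where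
  "nabla \<omega> = (\<lambda>P w u v. torus_deriv (\<lambda>Q. \<omega> Q u v) P w)"

definition e_map ::
  "nat \<Rightarrow> ('n::finite torus \<Rightarrow> real ^ 'n \<Rightarrow> (nat \<Rightarrow> real ^ 'n) \<Rightarrow> (nat \<Rightarrow> real ^ 'n) \<Rightarrow> real) \<Rightarrow> 'n biform" where
  "e_map p \<theta> = (\<lambda>P u v.
     (\<Sum>\<sigma> | \<sigma> permutes {..<Suc p}.
        of_int (sign \<sigma>) * \<theta> P (u (\<sigma> 0)) (\<lambda>i. u (\<sigma> (Suc i))) v) / fact p)"

lemma e_map_tensor:
  assumes "\<And>P. alt_map 1 (\<eta> P)"
  shows "e_map p (\<lambda>P w u v. \<eta> P (\<lambda>_. w) * (\<alpha> P u * \<beta> P v)) = tensor (wedge 1 p \<eta> \<alpha>) \<beta>"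
proof -
  have "\<eta> P (\<lambda>_. u (\<sigma> 0)) = \<eta> P (\<lambda>i. u (\<sigma> i))" for P u and \<sigma> :: "nat \<Rightarrow> nat"
  proof -
    have *: "\<forall>u u'. (\<forall>i<1. u i = u' i) \<longrightarrow> \<eta> P u = \<eta> P u'"
      using assms[of P] unfolding alt_map_def by (rule conjunct1)
    show ?thesis
      by (rule *[rule_format]) simp
  qed
  then show ?thesis
    unfolding e_map_def tensor_def wedge_def times_divide_eq_left sum_distrib_right
    by (intro ext arg_cong2[where f = "(/)"] sum.cong) (simp_all add: mult.assoc)
qed

definition pd :: "nat \<Rightarrow> 'n::finite biform \<Rightarrow> 'n biform" where
  "pd p \<omega> = e_map p (nabla \<omega>)"

section \<open>Dolbeault--Koszul cohomology\<close>

definition biform_group :: "nat \<Rightarrow> nat \<Rightarrow> 'n::finite biform monoid" where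
  "biform_group p q = \<lparr>carrier = biforms p q,
     monoid.mult = (\<lambda>\<omega> \<eta> P u v. \<omega> P u v + \<eta> P u v), one = (\<lambda>P u v. 0)\<rparr>"

definition closed_biforms :: "nat \<Rightarrow> nat \<Rightarrow> 'n::finite biform set" where
  "closed_biforms p q = {\<omega> \<in> biforms p q. pd p \<omega> = (\<lambda>P u v. 0)}"

definition exact_biforms :: "nat \<Rightarrow> nat \<Rightarrow> 'n::finite biform set" where
  "exact_biforms p q = (case p of 0 \<Rightarrow> {\<lambda>P u v. 0} | Suc p' \<Rightarrow> pd p' ` biforms p' q)"

definition DK :: "nat \<Rightarrow> nat \<Rightarrow> 'n::finite biform set monoid" where
  "DK p q = (biform_group p q)\<lparr>carrier := closed_biforms p q\<rparr> Mod exact_biforms p q"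

definition dk_class :: "nat \<Rightarrow> nat \<Rightarrow> 'n::finite biform \<Rightarrow> 'n biform set" where
  "dk_class p q \<omega> = exact_biforms p q #>\<^bsub>biform_group p q\<^esub> \<omega>"

definition dk_cup ::
  "nat \<Rightarrow> nat \<Rightarrow> nat \<Rightarrow> nat \<Rightarrow> 'n::finite biform set \<Rightarrow> 'n biform set \<Rightarrow> 'n biform set" where
  "dk_cup p q p' q' A B =
     (\<Union>\<omega>\<in>A. \<Union>\<eta>\<in>B. dk_class (p + p') (q + q') (biwedge p q p' q' \<omega> \<eta>))"

definition dk_sum :: "(nat \<times> nat \<Rightarrow> 'n::finite biform set) monoid" where
  "dk_sum = sum_group UNIV (\<lambda>(p, q). DK p q)"

definition dk_incl :: "nat \<Rightarrow> nat \<Rightarrow> 'n::finite biform set \<Rightarrow> nat \<times> nat \<Rightarrow> 'n biform set" where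
  "dk_incl p q A = (\<one>\<^bsub>dk_sum\<^esub>)((p, q) := A)"

text \<open>
  \<open>H\<^bsup>*,*\<^esup>\<close> as a ring: the direct sum of the groups \<open>H\<^bsup>p,q\<^esup>\<close> with the product induced by the wedge
  product.  The groups \<open>DK p q\<close> are written multiplicatively, so \<open>finprod\<close> is the sum in \<open>H\<^bsup>r,s\<^esup>\<close>.
\<close>

definition DK_ring :: "(nat \<times> nat \<Rightarrow> 'n::finite biform set) ring" where
  "DK_ring = \<lparr>carrier = carrier dk_sum,
     monoid.mult = (\<lambda>c d (r, s).
        finprod (DK r s) (\<lambda>(p, q). dk_cup p q (r - p) (s - q) (c (p, q)) (d (r - p, s - q)))
          ({..r} \<times> {..s})),
     one = dk_incl 0 0 (dk_class 0 0 (tensor (const_form 1) (const_form 1))),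
     zero = \<one>\<^bsub>dk_sum\<^esub>,
     add = monoid.mult dk_sum\<rparr>"

section \<open>The algebra \<open>\<real>[a, b] / (squares)\<close>\<close>

text \<open>The free associative unital real algebra: finitely supported functions on words.\<close>

definition free_alg :: "('g list \<Rightarrow> real) ring" where
  "free_alg = \<lparr>carrier = {f. finite {w. f w \<noteq> 0}},
     monoid.mult = (\<lambda>f g w. \<Sum>k\<le>length w. f (take k w) * g (drop k w)),
     one = (\<lambda>w. if w = [] then 1 else 0),
     zero = (\<lambda>w. 0),
     add = (\<lambda>f g w. f w + g w)\<rparr>"

definition word_mon :: "real \<Rightarrow> 'g list \<Rightarrow> 'g list \<Rightarrow> real" where
  "word_mon c w = (\<lambda>w'. if w' = w then c else 0)"

text \<open>
  The generator \<open>Inl i\<close> stands for \<open>a\<^sup>i\<close> (bidegree \<open>(1,0)\<close>) and \<open>Inr i\<close> for \<open>b\<^sup>i\<close> (bidegree \<open>(0,1)\<close>).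
  As in \<open>\<Lambda>\<^bsup>*,*\<^esup>\<close>, distinct generators of bidegrees \<open>(p,q)\<close> and \<open>(p',q')\<close> commute up to the sign
  \<open>(-1)\<close> to the power \<open>p p' + q q'\<close>: the \<open>a\<^sup>i\<close> anticommute among themselves, so do the \<open>b\<^sup>i\<close>, and
  \<open>a\<^sup>i\<close> commutes with \<open>b\<^sup>j\<close>.
\<close>

fun gen_sign :: "'n + 'n \<Rightarrow> 'n + 'n \<Rightarrow> real" where
  "gen_sign (Inl i) (Inl j) = -1"
| "gen_sign (Inr i) (Inr j) = -1"
| "gen_sign (Inl i) (Inr j) = 1"
| "gen_sign (Inr i) (Inl j) = 1"

definition comm_ideal :: "(('n + 'n) list \<Rightarrow> real) set" where
  "comm_ideal = genideal free_alg
     {word_mon 1 [g, h] \<ominus>\<^bsub>free_alg\<^esub> word_mon (gen_sign g h) [h, g] | g h. g \<noteq> h}"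

definition gcpoly :: "(('n + 'n) list \<Rightarrow> real) set ring" where
  "gcpoly = free_alg Quot comm_ideal"

definition gcpoly_gen :: "'n + 'n \<Rightarrow> (('n + 'n) list \<Rightarrow> real) set" where
  "gcpoly_gen g = comm_ideal +>\<^bsub>free_alg\<^esub> word_mon 1 [g]"

definition gcpoly_const :: "real \<Rightarrow> (('n + 'n) list \<Rightarrow> real) set" where
  "gcpoly_const r = comm_ideal +>\<^bsub>free_alg\<^esub> word_mon r []"

definition squares_ideal :: "(('n + 'n) list \<Rightarrow> real) set set" where
  "squares_ideal = genideal gcpoly {gcpoly_gen g \<otimes>\<^bsub>gcpoly\<^esub> gcpoly_gen g | g. True}"

end

theory Submission
  imports Defs
begin

text \<open>
  In the parallel frame of the torus the factor \<open>\<Lambda>\<^sup>q\<close> is a passenger of \<open>\<partial>\<close>, so \<open>H\<^bsup>p,q\<^esup>\<close> is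
  de Rham cohomology of degree \<open>p\<close> with coefficients in \<open>\<Lambda>\<^sup>q\<close>, and the claim is that every class has
  exactly one representative with constant coefficients.

  This is shown by averaging over one coordinate circle at a time.  For a lattice vector \<open>e\<close> let
  \<open>(A f)(x) = \<integral>\<^sub>0\<^sup>1 f (x + t e) dt\<close> and \<open>(S f)(x) = \<integral>\<^sub>0\<^sup>1 (t - 1/2) f (x + t e) dt\<close>.  Both are
  convolutions, hence commute with all partial derivatives, and integration by parts gives
  \<open>S (D\<^sub>e f) = f - A f\<close> for periodic \<open>f\<close>.  Together with Cartan's formula \<open>\<iota>\<^sub>e \<partial> + \<partial> \<iota>\<^sub>e = D\<^sub>e\<close> this
  makes \<open>\<omega> - A \<omega> = \<partial> (S (\<iota>\<^sub>e \<omega>))\<close> exact whenever \<open>\<omega>\<close> is closed (\<open>minus_mean_exact\<close>).  Since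
  \<open>D\<^sub>e (A \<omega>) = A (D\<^sub>e \<omega>) = 0\<close>, averaging over all coordinate directions in turn yields a constant
  representative (\<open>closed_cohomologous_parallel\<close>).  The same averaging applied to a primitive shows
  that an exact form with constant coefficients is zero (\<open>parallel_exact_zero\<close>).

  The products match because of the Leibniz rule (\<open>leibniz\<close>), which makes the wedge product descend
  to classes.  That rule, and the fact that wedge products of coordinate forms
  correspond to concatenation of index lists, both come from one principle:
  alternating over a block of arguments before alternating over all of them only multiplies
  the result by the order of the subgroup (\<open>alternator_average\<close>).

  On the algebraic side a word in the letters \<open>a\<^sup>i, b\<^sup>i\<close> is sent to the wedge of the corresponding
  coordinate forms.  This extends to a surjective ring homomorphism \<open>realize\<close> from the free algebra
  onto \<open>H\<^bsup>*,*\<^esup>\<close>, whose kernel consists of the combinations of words whose constant forms cancel.  In the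
  quotient by the commutation relations and the squares each word is a multiple of a chosen
  repetition-free word with the same set of letters (\<open>reduces_same_set\<close>), and the constant forms of
  those chosen words are linearly independent (\<open>word_forms_independent\<close>).  Hence the kernel of
  \<open>realize\<close> is the kernel of the projection to the presented algebra (\<open>vanishing_eq_rel_ideal\<close>), and
  the two images of the free algebra are isomorphic (\<open>ring_iso_of_same_fibres\<close>).
\<close>

section \<open>Convolution along a segment\<close>

lemma Ck_imp_continuous: "Ck k f \<Longrightarrow> continuous_on UNIV f"
  by (cases k) (auto simp: continuous_at_imp_continuous_on differentiable_imp_continuous_within)

lemma Ck_SucD: "Ck (Suc k) f \<Longrightarrow> Ck k f"
proof (induction k arbitrary: f)
  case 0
  then show ?case using Ck_imp_continuous[of "Suc 0" f] by simp
next
  case (Suc k)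
  then show ?case by (metis Ck.simps(2))
qed

lemma Ck_const: "Ck k (\<lambda>x. c)"
  by (induction k arbitrary: c) (auto simp: frechet_derivative_const)

lemma frechet_derivative_add:
  fixes f g :: "'a::real_normed_vector \<Rightarrow> real"
  assumes "f differentiable (at x)" "g differentiable (at x)"
  shows "frechet_derivative (\<lambda>x. f x + g x) (at x) = (\<lambda>v. frechet_derivative f (at x) v + frechet_derivative g (at x) v)"
  using assms by (intro frechet_derivative_at[symmetric] has_derivative_add) (auto simp: frechet_derivative_works)

lemma frechet_derivative_mult:
  fixes f g :: "'a::real_normed_vector \<Rightarrow> real"
  assumes "f differentiable (at x)" "g differentiable (at x)"
  shows "frechet_derivative (\<lambda>x. f x * g x) (at x) = (\<lambda>v. f x * frechet_derivative g (at x) v + frechet_derivative f (at x) v * g x)"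
  using assms by (intro frechet_derivative_at[symmetric] has_derivative_mult) (auto simp: frechet_derivative_works)

lemma Ck_add: "Ck k f \<Longrightarrow> Ck k g \<Longrightarrow> Ck k (\<lambda>x. f x + g x)"
  by (induction k arbitrary: f g) (auto intro!: continuous_on_add differentiable_add simp: frechet_derivative_add)

lemma Ck_mult: "Ck k f \<Longrightarrow> Ck k g \<Longrightarrow> Ck k (\<lambda>x. f x * g x)"
proof (induction k arbitrary: f g)
  case (Suc k)
  have "Ck k f" "Ck k g" using Suc.prems Ck_SucD by blast+
  then show ?case using Suc
    by (auto intro!: differentiable_mult Ck_add simp: frechet_derivative_mult)
qed (auto intro!: continuous_on_mult)

definition smooth_fun :: "('a::real_normed_vector \<Rightarrow> real) \<Rightarrow> bool" where
  "smooth_fun F \<longleftrightarrow> (\<forall>k. Ck k F)"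

lemma smooth_fun_differentiable: "smooth_fun F \<Longrightarrow> F differentiable (at x)"
  unfolding smooth_fun_def by (metis Ck.simps(2))

lemma smooth_fun_continuous: "smooth_fun F \<Longrightarrow> continuous_on UNIV F"
  unfolding smooth_fun_def by (metis Ck.simps(1))

lemma smooth_fun_has_derivative:
  "smooth_fun F \<Longrightarrow> (F has_derivative frechet_derivative F (at x)) (at x)"
  using smooth_fun_differentiable frechet_derivative_works by blast

lemma smooth_fun_deriv: "smooth_fun F \<Longrightarrow> smooth_fun (\<lambda>x. frechet_derivative F (at x) v)"
  unfolding smooth_fun_def by (metis Ck.simps(2))

text \<open>
  The instances that matter are the weights \<open>1\<close>, which averages, and \<open>t - 1/2\<close>, which inverts a
  directional derivative up to that average.
\<close>

definition segment_conv :: "(real \<Rightarrow> real) \<Rightarrow> 'a::real_normed_vector \<Rightarrow> ('a \<Rightarrow> real) \<Rightarrow> 'a \<Rightarrow> real" where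
  "segment_conv k e F x = integral {0..1} (\<lambda>t. k t * F (x + t *\<^sub>R e))"

lemma segment_conv_integrable:
  fixes F :: "'a::real_normed_vector \<Rightarrow> real"
  assumes k: "continuous_on {0..1} k" and F: "continuous_on UNIV F"
  shows "(\<lambda>t. k t * F (x + t *\<^sub>R e)) integrable_on {0..1}"
  by (intro integrable_continuous_interval continuous_on_mult k continuous_on_compose2[OF F])
     (auto intro!: continuous_intros)

text \<open>
  Differentiation under the integral sign.  The derivative must be presented as a continuous family of
  bounded linear maps; in finite dimensions this continuity can be tested on each vector separately.
\<close>

lemma segment_conv_has_derivative:
  fixes F :: "'a::euclidean_space \<Rightarrow> real"
  assumes k: "continuous_on {0..1} k" and F: "\<And>x. F differentiable (at x)"
    and D: "\<And>v. continuous_on UNIV (\<lambda>x. frechet_derivative F (at x) v)"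
  shows "(segment_conv k e F has_derivative (\<lambda>v. segment_conv k e (\<lambda>y. frechet_derivative F (at y) v) x)) (at x)"
proof -
  have bl: "bounded_linear (frechet_derivative F (at y))" for y
    using F[of y] frechet_derivative_works has_derivative_bounded_linear by blast
  define B where "B y = Blinfun (frechet_derivative F (at y))" for y
  have B: "blinfun_apply (B y) = frechet_derivative F (at y)" for y
    unfolding B_def by (rule bounded_linear_Blinfun_apply[OF bl])
  have contF: "continuous_on UNIV F"
    by (simp add: continuous_at_imp_continuous_on differentiable_imp_continuous_within F)
  have contB: "continuous_on UNIV B"
    using D by (auto simp: continuous_on_eq_continuous_within B intro!: continuous_blinfun_componentwiseI1)
  define fx where "fx y t = k t *\<^sub>R B (y + t *\<^sub>R e)" for y t
  have cfx: "continuous_on (UNIV \<times> cbox 0 1) (\<lambda>(y, t). fx y t)"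
    unfolding fx_def split_beta
    by (intro continuous_on_scaleR continuous_on_compose2[OF contB] continuous_on_compose2[OF k])
       (auto intro!: continuous_intros)
  have lhs: "((\<lambda>y. integral (cbox 0 1) (\<lambda>t. k t * F (y + t *\<^sub>R e))) has_derivative integral (cbox 0 1) (fx x)) (at x within UNIV)"
  proof (rule leibniz_rule)
    fix y t
    have "((\<lambda>x. F (x + t *\<^sub>R e)) has_derivative frechet_derivative F (at (y + t *\<^sub>R e))) (at y)"
      by (rule has_derivative_eq_rhs, rule has_derivative_compose[where f = "\<lambda>x. x + t *\<^sub>R e" and g = F])
         (auto intro!: derivative_eq_intros F[unfolded frechet_derivative_works])
    then show "((\<lambda>x. k t * F (x + t *\<^sub>R e)) has_derivative blinfun_apply (fx y t)) (at y within UNIV)"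
      by (auto simp: fx_def B scaleR_blinfun.rep_eq intro!: derivative_eq_intros)
  qed (use cfx segment_conv_integrable[OF k contF] in \<open>auto\<close>)
  have "blinfun_apply (integral (cbox 0 1) (fx x)) v = segment_conv k e (\<lambda>y. frechet_derivative F (at y) v) x" for v
  proof -
    have "continuous_on (cbox 0 1) (fx x)"
      using continuous_on_compose2[OF cfx, of "cbox 0 1" "\<lambda>t. (x, t)"]
      by (simp add: continuous_on_Pair image_subset_iff)
    then have "fx x integrable_on cbox 0 1" by (rule integrable_continuous)
    from integral_linear[OF this blinfun.bounded_linear_left[of v]]
    show ?thesis by (simp add: o_def fx_def segment_conv_def B scaleR_blinfun.rep_eq)
  qed
  then have "blinfun_apply (integral (cbox 0 1) (fx x)) = (\<lambda>v. segment_conv k e (\<lambda>y. frechet_derivative F (at y) v) x)"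
    by blast
  with lhs show ?thesis by (simp add: segment_conv_def[abs_def])
qed

lemma segment_conv_Ck:
  fixes F :: "'a::euclidean_space \<Rightarrow> real"
  assumes k: "continuous_on {0..1} k" and "Ck m F"
  shows "Ck m (segment_conv k e F)"
  using assms(2)
proof (induction m arbitrary: F)
  case 0
  then have F: "continuous_on UNIV F" by simp
  have "continuous_on UNIV (\<lambda>x. integral (cbox 0 1) (\<lambda>t. k t * F (x + t *\<^sub>R e)))"
    by (rule integral_continuous_on_param, unfold split_beta,
        intro continuous_on_mult continuous_on_compose2[OF k] continuous_on_compose2[OF F])
       (auto intro!: continuous_intros)
  then show ?case by (simp add: segment_conv_def[abs_def])
next
  case (Suc m)
  then have F: "\<And>x. F differentiable (at x)" and D: "\<And>v. Ck m (\<lambda>x. frechet_derivative F (at x) v)"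
    by auto
  note der = segment_conv_has_derivative[OF k F Ck_imp_continuous[OF D]]
  have "frechet_derivative (segment_conv k e F) (at x) v = segment_conv k e (\<lambda>y. frechet_derivative F (at y) v) x" for x v
    using frechet_derivative_at[OF der] by metis
  moreover have "segment_conv k e F differentiable (at x)" for x
    unfolding differentiable_def by (rule exI) (rule der)
  ultimately show ?case using Suc.IH[OF D] by simp
qed

lemma segment_conv_smooth:
  fixes F :: "'a::euclidean_space \<Rightarrow> real"
  assumes "continuous_on {0..1} k" "smooth_fun F"
  shows "smooth_fun (segment_conv k e F)"
  using assms segment_conv_Ck unfolding smooth_fun_def by blast

lemma segment_conv_deriv:
  fixes F :: "'a::euclidean_space \<Rightarrow> real"
  assumes "continuous_on {0..1} k" "smooth_fun F"
  shows "frechet_derivative (segment_conv k e F) (at x) v = segment_conv k e (\<lambda>y. frechet_derivative F (at y) v) x"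
  using frechet_derivative_at[OF segment_conv_has_derivative[OF assms(1), of F e x]] assms(2)
    smooth_fun_differentiable[of F] smooth_fun_continuous[OF smooth_fun_deriv[of F]] by metis

lemma segment_conv_add:
  fixes F G :: "'a::euclidean_space \<Rightarrow> real"
  assumes "continuous_on {0..1} k" "continuous_on UNIV F" "continuous_on UNIV G"
  shows "segment_conv k e (\<lambda>x. F x + G x) x = segment_conv k e F x + segment_conv k e G x"
  unfolding segment_conv_def distrib_left
  by (intro Henstock_Kurzweil_Integration.integral_add segment_conv_integrable assms)

lemma segment_conv_cmult: "segment_conv k e (\<lambda>x. c * F x) x = c * segment_conv k e F x"
  unfolding segment_conv_def by (simp add: mult.left_commute)

lemma deriv_along_line:
  fixes F :: "'a::euclidean_space \<Rightarrow> real"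
  assumes "smooth_fun F"
  shows "((\<lambda>t. F (x + t *\<^sub>R e)) has_vector_derivative frechet_derivative F (at (x + t *\<^sub>R e)) e) (at t within S)"
proof -
  have "((\<lambda>t. F (x + t *\<^sub>R e)) has_derivative (\<lambda>h. frechet_derivative F (at (x + t *\<^sub>R e)) (h *\<^sub>R e))) (at t)"
    by (rule has_derivative_compose[where g = F, OF _ smooth_fun_has_derivative[OF assms]])
       (auto intro!: derivative_eq_intros)
  moreover have "linear (frechet_derivative F (at (x + t *\<^sub>R e)))"
    using linear_frechet_derivative smooth_fun_differentiable[OF assms] by blast
  ultimately show ?thesis
    unfolding has_vector_derivative_def
    by (simp add: linear_cmul has_derivative_at_withinI)
qed

lemma segment_conv_one_deriv:
  fixes F :: "'a::euclidean_space \<Rightarrow> real"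
  assumes F: "smooth_fun F"
  shows "segment_conv (\<lambda>_. 1) e (\<lambda>y. frechet_derivative F (at y) e) x = F (x + e) - F x"
proof -
  have "((\<lambda>t. frechet_derivative F (at (x + t *\<^sub>R e)) e) has_integral (F (x + 1 *\<^sub>R e) - F (x + 0 *\<^sub>R e))) {0..1}"
    by (intro fundamental_theorem_of_calculus deriv_along_line F) auto
  then show ?thesis by (auto simp: segment_conv_def)
qed

text \<open>
  Integration by parts.  The weight \<open>t - 1/2\<close> has derivative \<open>1\<close> and opposite values at the two end points,
  so that for periodic \<open>F\<close> the boundary term is \<open>F x\<close>.
\<close>

lemma segment_conv_saw_deriv:
  fixes F :: "'a::euclidean_space \<Rightarrow> real"
  assumes F: "smooth_fun F"
  shows "segment_conv (\<lambda>t. t - 1/2) e (\<lambda>y. frechet_derivative F (at y) e) x = (F (x + e) + F x) / 2 - segment_conv (\<lambda>_. 1) e F x"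
proof -
  have "((\<lambda>t. (t - 1/2) * frechet_derivative F (at (x + t *\<^sub>R e)) e + 1 * F (x + t *\<^sub>R e)) has_integral
      ((1 - 1/2) * F (x + 1 *\<^sub>R e) - (0 - 1/2) * F (x + 0 *\<^sub>R e))) {0..1}"
    by (intro fundamental_theorem_of_calculus)
       (auto intro!: derivative_eq_intros has_vector_derivative_mult deriv_along_line[OF F])
  from integral_unique[OF this]
  have "integral {0..1} (\<lambda>t. (t - 1/2) * frechet_derivative F (at (x + t *\<^sub>R e)) e + 1 * F (x + t *\<^sub>R e))
    = (F (x + e) + F x) / 2" by simp
  moreover have "integral {0..1} (\<lambda>t. (t - 1/2) * frechet_derivative F (at (x + t *\<^sub>R e)) e + 1 * F (x + t *\<^sub>R e))
    = segment_conv (\<lambda>t. t - 1/2) e (\<lambda>y. frechet_derivative F (at y) e) x + segment_conv (\<lambda>_. 1) e F x"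
    unfolding segment_conv_def
    by (intro Henstock_Kurzweil_Integration.integral_add segment_conv_integrable smooth_fun_continuous F smooth_fun_deriv)
       (auto intro!: continuous_intros)
  ultimately show ?thesis by linarith
qed

lemma deriv_shift:
  fixes F :: "'a::euclidean_space \<Rightarrow> real"
  assumes "smooth_fun F"
  shows "((\<lambda>y. F (y + a)) has_derivative frechet_derivative F (at (x + a))) (at x)"
  by (rule has_derivative_eq_rhs, rule has_derivative_compose[where f = "\<lambda>x. x + a" and g = F])
     (auto intro!: derivative_eq_intros smooth_fun_has_derivative assms)

text \<open>
  Averaging along \<open>b\<close> integrates \<open>D\<^sub>b\<close> to a difference and commutes with \<open>D\<^sub>a\<close>, so \<open>D\<^sub>a D\<^sub>b F\<close> and
  \<open>D\<^sub>b D\<^sub>a F\<close> have the same average along every segment.  Shrinking the segment to a point gives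
  equality of the values.
\<close>

lemma mixed_partials_commute:
  fixes F :: "'a::euclidean_space \<Rightarrow> real"
  assumes F: "smooth_fun F"
  shows "frechet_derivative (\<lambda>y. frechet_derivative F (at y) a) (at x) b
       = frechet_derivative (\<lambda>y. frechet_derivative F (at y) b) (at x) a"
proof -
  define DD where "DD a b y = frechet_derivative (\<lambda>y. frechet_derivative F (at y) a) (at y) b" for a b y
  have sm: "smooth_fun (\<lambda>y. frechet_derivative F (at y) a)" for a by (rule smooth_fun_deriv[OF F])
  have smDD: "smooth_fun (DD a b)" for a b unfolding DD_def by (rule smooth_fun_deriv[OF sm])
  have c1: "continuous_on {0..1::real} (\<lambda>_. 1::real)" by simp
  have eq: "segment_conv (\<lambda>_. 1) b (DD a b) x = segment_conv (\<lambda>_. 1) b (DD b a) x" for a b x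
  proof -
    have "segment_conv (\<lambda>_. 1) b (DD b a) x = frechet_derivative (segment_conv (\<lambda>_. 1) b (\<lambda>y. frechet_derivative F (at y) b)) (at x) a"
      unfolding DD_def by (simp add: segment_conv_deriv[OF c1 sm])
    also have "segment_conv (\<lambda>_. 1) b (\<lambda>y. frechet_derivative F (at y) b) = (\<lambda>x. F (x + b) - F x)"
      by (rule ext) (rule segment_conv_one_deriv[OF F])
    also have "frechet_derivative (\<lambda>x. F (x + b) - F x) (at x) a
      = frechet_derivative F (at (x + b)) a - frechet_derivative F (at x) a"
      using frechet_derivative_at[OF has_derivative_diff[OF deriv_shift[OF F, of b x] smooth_fun_has_derivative[OF F, of x]]]
      by metis
    also have "\<dots> = segment_conv (\<lambda>_. 1) b (DD a b) x"
      unfolding DD_def by (rule segment_conv_one_deriv[OF sm, symmetric])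
    finally show ?thesis by simp
  qed
  define g where "g y = DD a b y - DD b a y" for y
  have g: "continuous_on UNIV g" unfolding g_def
    by (intro continuous_on_diff smooth_fun_continuous smDD)
  have lin: "DD a (s *\<^sub>R b) = (\<lambda>y. s * DD a b y)" "DD (s *\<^sub>R b) a = (\<lambda>y. s * DD b a y)" for s
  proof (safe intro!: ext)
    fix y
    show "DD a (s *\<^sub>R b) y = s * DD a b y" unfolding DD_def
      using linear_frechet_derivative[OF smooth_fun_differentiable[OF sm]] by (simp add: linear_cmul)
    have "(\<lambda>y. frechet_derivative F (at y) (s *\<^sub>R b)) = (\<lambda>y. s * frechet_derivative F (at y) b)"
      using linear_frechet_derivative[OF smooth_fun_differentiable[OF F]] by (simp add: linear_cmul)
    then have "DD (s *\<^sub>R b) a y = frechet_derivative (\<lambda>y. s * frechet_derivative F (at y) b) (at y) a"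
      by (simp add: DD_def)
    also have "\<dots> = s * DD b a y" unfolding DD_def
      by (subst frechet_derivative_at[symmetric, OF has_derivative_mult_right[OF smooth_fun_has_derivative[OF sm]]]) simp
    finally show "DD (s *\<^sub>R b) a y = s * DD b a y" .
  qed
  \<comment> \<open>Scaling the direction by \<open>s\<close> multiplies both second derivatives by \<open>s\<close>, which can be cancelled unless \<open>s = 0\<close>.\<close>
  define I where "I s = integral (cbox 0 1) (\<lambda>t. g (x + t *\<^sub>R s *\<^sub>R b))" for s
  have "I s = 0" if "s \<noteq> 0" for s
  proof -
    have "0 = segment_conv (\<lambda>_. 1) (s *\<^sub>R b) (DD a (s *\<^sub>R b)) x - segment_conv (\<lambda>_. 1) (s *\<^sub>R b) (DD (s *\<^sub>R b) a) x"
      using eq by simp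
    also have "\<dots> = s * (segment_conv (\<lambda>_. 1) (s *\<^sub>R b) (DD a b) x - segment_conv (\<lambda>_. 1) (s *\<^sub>R b) (DD b a) x)"
      by (simp add: lin segment_conv_cmult algebra_simps)
    also have "segment_conv (\<lambda>_. 1) (s *\<^sub>R b) (DD a b) x - segment_conv (\<lambda>_. 1) (s *\<^sub>R b) (DD b a) x = I s"
      unfolding segment_conv_def I_def g_def
      by (subst Henstock_Kurzweil_Integration.integral_diff[symmetric])
         (use segment_conv_integrable[OF c1 smooth_fun_continuous[OF smDD]] in \<open>auto simp del: scaleR_scaleR\<close>)
    finally show ?thesis using that by simp
  qed
  then have "\<forall>\<^sub>F s in at 0. I s = 0" by (simp add: eventually_at_filter)
  then have 1: "(I \<longlongrightarrow> 0) (at 0)" by (rule tendsto_eventually)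
  have "continuous_on UNIV I" unfolding I_def
    by (rule integral_continuous_on_param, unfold split_beta, intro continuous_on_compose2[OF g])
       (auto intro!: continuous_intros)
  then have "(I \<longlongrightarrow> I 0) (at 0)" by (simp add: continuous_on_def)
  with 1 have "I 0 = 0" using tendsto_unique[OF _ 1] by fastforce
  then have "g x = 0" by (simp add: I_def)
  then show ?thesis by (simp add: g_def DD_def)
qed


section \<open>Calculus on the torus\<close>

lemma abs_torus_eq_iff: "abs_torus x = abs_torus y \<longleftrightarrow> lattice_rel x y"
  by (rule torus.abs_eq_iff)

lemma lattice_rel_add: "lattice_rel x y \<Longrightarrow> lattice_rel (x + z) (y + z)"
  by (simp add: lattice_rel_def)

lemma abs_rep_torus [simp]: "abs_torus (rep_torus P) = P"
  by (meson Quotient_abs_rep Quotient_torus)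

lemma abs_torus_rep_add: "abs_torus (rep_torus (abs_torus x) + z) = abs_torus (x + z)"
  unfolding abs_torus_eq_iff
  by (rule lattice_rel_add) (simp flip: abs_torus_eq_iff)

lemma torus_cases: obtains x where "P = abs_torus x"
  using abs_rep_torus by metis

lemma torus_smooth_iff: "torus_smooth f \<longleftrightarrow> smooth_fun (\<lambda>x. f (abs_torus x))"
  by (simp add: torus_smooth_def smooth_fun_def)

text \<open>
  The definition differentiates at a chosen lift of the point; by periodicity every lift gives the same
  derivative.
\<close>

lemma torus_deriv_abs:
  assumes f: "torus_smooth f"
  shows "torus_deriv f (abs_torus x) w = frechet_derivative (\<lambda>x. f (abs_torus x)) (at x) w"
proof -
  \<comment> \<open>The difference of two lifts is a lattice vector.\<close>
  define a where "a = rep_torus (abs_torus x) - x"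
  have *: "f (abs_torus (y + a)) = f (abs_torus y)" for y
  proof -
    have "lattice_rel (rep_torus (abs_torus x)) x" by (simp flip: abs_torus_eq_iff)
    then have "lattice_rel (y + a) y" by (simp add: lattice_rel_def a_def)
    then show ?thesis by (simp flip: abs_torus_eq_iff)
  qed
  have "((\<lambda>y. f (abs_torus (y + a))) has_derivative frechet_derivative (\<lambda>x. f (abs_torus x)) (at (x + a))) (at x)"
    by (rule deriv_shift) (use f in \<open>simp add: torus_smooth_iff\<close>)
  then have "((\<lambda>y. f (abs_torus y)) has_derivative frechet_derivative (\<lambda>x. f (abs_torus x)) (at (x + a))) (at x)"
    unfolding * .
  from frechet_derivative_at[OF this] show ?thesis
    by (simp add: torus_deriv_def a_def)
qed

lemma torus_smooth_const [simp]: "torus_smooth (\<lambda>P. c)"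
  by (simp add: torus_smooth_def Ck_const)

lemma torus_smooth_add: "torus_smooth f \<Longrightarrow> torus_smooth g \<Longrightarrow> torus_smooth (\<lambda>P. f P + g P)"
  by (simp add: torus_smooth_def Ck_add)

lemma torus_smooth_mult: "torus_smooth f \<Longrightarrow> torus_smooth g \<Longrightarrow> torus_smooth (\<lambda>P. f P * g P)"
  by (simp add: torus_smooth_def Ck_mult)

lemma torus_smooth_cmult: "torus_smooth f \<Longrightarrow> torus_smooth (\<lambda>P. c * f P)"
  by (simp add: torus_smooth_mult)

lemma torus_smooth_sum: "(\<And>i. i \<in> I \<Longrightarrow> torus_smooth (f i)) \<Longrightarrow> torus_smooth (\<lambda>P. \<Sum>i\<in>I. f i P)"
  by (induction I rule: infinite_finite_induct) (auto intro: torus_smooth_add)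

lemma torus_smooth_deriv: "torus_smooth f \<Longrightarrow> torus_smooth (\<lambda>P. torus_deriv f P w)"
  by (simp add: torus_smooth_iff[of "\<lambda>P. torus_deriv f P w"] torus_deriv_abs)
     (simp add: smooth_fun_deriv torus_smooth_iff)

lemma torus_deriv_linear: "torus_smooth f \<Longrightarrow> linear (torus_deriv f P)"
  unfolding torus_deriv_def[abs_def] torus_smooth_iff
  by (intro linear_frechet_derivative smooth_fun_differentiable)

lemma torus_deriv_const [simp]: "torus_deriv (\<lambda>P. c) P w = 0"
  by (simp add: torus_deriv_def)

lemma torus_deriv_add:
  "torus_smooth f \<Longrightarrow> torus_smooth g \<Longrightarrow> torus_deriv (\<lambda>P. f P + g P) P w = torus_deriv f P w + torus_deriv g P w"
  unfolding torus_deriv_def torus_smooth_iff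
  by (subst frechet_derivative_add) (auto intro: smooth_fun_differentiable)

lemma torus_deriv_mult:
  "torus_smooth f \<Longrightarrow> torus_smooth g \<Longrightarrow>
    torus_deriv (\<lambda>P. f P * g P) P w = torus_deriv f P w * g P + f P * torus_deriv g P w"
  unfolding torus_deriv_def torus_smooth_iff
  by (subst frechet_derivative_mult) (auto intro: smooth_fun_differentiable)

lemma torus_deriv_cmult:
  "torus_smooth f \<Longrightarrow> torus_deriv (\<lambda>P. c * f P) P w = c * torus_deriv f P w"
  by (simp add: torus_deriv_mult)

lemma torus_deriv_sum:
  "(\<And>i. i \<in> I \<Longrightarrow> torus_smooth (f i)) \<Longrightarrow> torus_deriv (\<lambda>P. \<Sum>i\<in>I. f i P) P w = (\<Sum>i\<in>I. torus_deriv (f i) P w)"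
  by (induction I rule: infinite_finite_induct) (auto simp: torus_deriv_add torus_smooth_sum)

lemma torus_deriv_commute:
  assumes f: "torus_smooth f"
  shows "torus_deriv (\<lambda>Q. torus_deriv f Q a) P b = torus_deriv (\<lambda>Q. torus_deriv f Q b) P a"
proof (cases P rule: torus_cases)
  case (1 x)
  show ?thesis unfolding 1
    by (simp add: torus_deriv_abs[OF torus_smooth_deriv[OF f]] torus_deriv_abs[OF f])
       (rule mixed_partials_commute, use f in \<open>simp add: torus_smooth_iff\<close>)
qed

lemma torus_deriv_zero_imp_constant:
  fixes f :: "'n::finite torus \<Rightarrow> real"
  assumes f: "torus_smooth f" and 0: "\<And>P i. torus_deriv f P (axis i 1) = 0"
  shows "f P = f Q"
proof -
  have z: "torus_deriv f P w = 0" for P w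
  proof -
    interpret linear "torus_deriv f P" by (rule torus_deriv_linear[OF f])
    have "torus_deriv f P w = torus_deriv f P (\<Sum>i\<in>UNIV. w $ i *\<^sub>R axis i 1)"
      by (simp add: basis_expansion flip: scalar_mult_eq_scaleR)
    then show ?thesis by (simp add: sum scale 0)
  qed
  have "((\<lambda>x. f (abs_torus x)) has_derivative (\<lambda>h. 0)) (at x within UNIV)" for x
  proof -
    have "frechet_derivative (\<lambda>x. f (abs_torus x)) (at x) = (\<lambda>h. 0)"
      using torus_deriv_abs[OF f, of x] z by auto
    then show ?thesis
      using smooth_fun_has_derivative[of "\<lambda>x. f (abs_torus x)" x] f by (simp add: torus_smooth_iff)
  qed
  then have "\<exists>c. \<forall>x\<in>UNIV. f (abs_torus x) = c"
    by (intro has_derivative_zero_constant) auto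
  then show ?thesis by (metis UNIV_I abs_rep_torus)
qed

definition torus_conv :: "(real \<Rightarrow> real) \<Rightarrow> real ^ 'n \<Rightarrow> ('n::finite torus \<Rightarrow> real) \<Rightarrow> 'n torus \<Rightarrow> real" where
  "torus_conv k e f P = segment_conv k e (\<lambda>x. f (abs_torus x)) (rep_torus P)"

lemma torus_conv_abs: "torus_conv k e f (abs_torus x) = segment_conv k e (\<lambda>x. f (abs_torus x)) x"
  by (simp add: torus_conv_def segment_conv_def abs_torus_rep_add)

lemma torus_conv_smooth:
  "continuous_on {0..1} k \<Longrightarrow> torus_smooth f \<Longrightarrow> torus_smooth (torus_conv k e f)"
  by (simp add: torus_smooth_iff torus_conv_abs segment_conv_smooth)

lemma torus_deriv_conv:
  assumes k: "continuous_on {0..1} k" and f: "torus_smooth f"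
  shows "torus_deriv (torus_conv k e f) P w = torus_conv k e (\<lambda>Q. torus_deriv f Q w) P"
proof (cases P rule: torus_cases)
  case (1 x)
  show ?thesis unfolding 1
    by (simp add: torus_deriv_abs[OF torus_conv_smooth[OF k f]] torus_conv_abs torus_deriv_abs[OF f])
       (rule segment_conv_deriv, use k f in \<open>auto simp: torus_smooth_iff\<close>)
qed

lemma torus_conv_add:
  assumes "continuous_on {0..1} k" "torus_smooth f" "torus_smooth g"
  shows "torus_conv k e (\<lambda>P. f P + g P) P = torus_conv k e f P + torus_conv k e g P"
  using assms unfolding torus_conv_def torus_smooth_iff
  by (intro segment_conv_add smooth_fun_continuous)

lemma torus_conv_cmult: "torus_conv k e (\<lambda>P. c * f P) P = c * torus_conv k e f P"
  by (simp add: torus_conv_def segment_conv_cmult)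

lemma torus_conv_zero [simp]: "torus_conv k e (\<lambda>P. 0) P = 0"
  by (simp add: torus_conv_def segment_conv_def)

lemma torus_conv_one_const [simp]: "torus_conv (\<lambda>_. 1) e (\<lambda>P. c) P = c"
  by (simp add: torus_conv_def segment_conv_def)

lemma abs_torus_add_lattice:
  assumes "\<And>i. e $ i \<in> \<int>"
  shows "abs_torus (x + e) = abs_torus x"
  using assms by (simp add: abs_torus_eq_iff lattice_rel_def)

lemma torus_mean_deriv:
  assumes e: "\<And>i. e $ i \<in> \<int>" and f: "torus_smooth f"
  shows "torus_conv (\<lambda>_. 1) e (\<lambda>Q. torus_deriv f Q e) P = 0"
proof (cases P rule: torus_cases)
  case (1 x)
  show ?thesis using f unfolding 1
    by (simp add: torus_conv_abs torus_deriv_abs[OF f] segment_conv_one_deriv torus_smooth_iff abs_torus_add_lattice e)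
qed

text \<open>
  The homotopy formula in the direction of a closed geodesic of period \<open>e\<close>: \<open>D\<^sub>e\<close> is inverted by the
  weight \<open>t - 1/2\<close>, up to the mean over the circle.
\<close>

lemma torus_saw_deriv:
  assumes e: "\<And>i. e $ i \<in> \<int>" and f: "torus_smooth f"
  shows "torus_conv (\<lambda>t. t - 1/2) e (\<lambda>Q. torus_deriv f Q e) P = f P - torus_conv (\<lambda>_. 1) e f P"
proof (cases P rule: torus_cases)
  case (1 x)
  show ?thesis using f unfolding 1
    by (simp add: torus_conv_abs torus_deriv_abs[OF f] segment_conv_saw_deriv torus_smooth_iff abs_torus_add_lattice e)
qed

section \<open>Alternating maps and alternation sums\<close>

definition multilin :: "nat \<Rightarrow> ((nat \<Rightarrow> 'v::real_vector) \<Rightarrow> real) \<Rightarrow> bool" where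
  "multilin p m \<longleftrightarrow> (\<forall>u u'. (\<forall>i<p. u i = u' i) \<longrightarrow> m u = m u') \<and>
     (\<forall>u. \<forall>i<p. linear (\<lambda>w. m (u(i := w))))"

lemma alt_map_iff: "alt_map p m \<longleftrightarrow> multilin p m \<and> (\<forall>u i j. i < p \<longrightarrow> j < p \<longrightarrow> i \<noteq> j \<longrightarrow> u i = u j \<longrightarrow> m u = 0)"
  unfolding alt_map_def multilin_def conj_assoc imp_conjL by simp

lemma multilin_cong: "multilin p m \<Longrightarrow> (\<And>i. i < p \<Longrightarrow> u i = u' i) \<Longrightarrow> m u = m u'"
  unfolding multilin_def by blast

lemma multilin_linear: "multilin p m \<Longrightarrow> i < p \<Longrightarrow> linear (\<lambda>w. m (u(i := w)))"
  unfolding multilin_def by blast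

lemma alt_map_multilin: "alt_map p m \<Longrightarrow> multilin p m"
  by (simp add: alt_map_iff)

lemma alt_map_zero: "alt_map p m \<Longrightarrow> i < p \<Longrightarrow> j < p \<Longrightarrow> i \<noteq> j \<Longrightarrow> u i = u j \<Longrightarrow> m u = 0"
  unfolding alt_map_iff by blast

lemma alt_map_cong: "alt_map p m \<Longrightarrow> (\<And>i. i < p \<Longrightarrow> u i = u' i) \<Longrightarrow> m u = m u'"
  by (rule multilin_cong[OF alt_map_multilin])

lemma linear_zero_fun: "linear (\<lambda>w. 0::real)"
  by (simp add: linear_iff)

lemma multilin_add: "multilin p m \<Longrightarrow> multilin p m' \<Longrightarrow> multilin p (\<lambda>u. m u + m' u)"
  unfolding multilin_def by (intro conjI allI impI arg_cong2[where f = "(+)"] linear_compose_add) blast+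

lemma linear_cmult_real: "linear f \<Longrightarrow> linear (\<lambda>x. c * f x :: real)"
  by (simp add: linear_iff algebra_simps)

lemma multilin_cmult: "multilin p m \<Longrightarrow> multilin p (\<lambda>u. c * m u)"
  unfolding multilin_def
  by (intro conjI allI impI arg_cong2[where f = "(*)"] refl linear_cmult_real) blast+

lemma multilin_zero: "multilin p (\<lambda>u. 0)"
  unfolding multilin_def by (simp add: linear_zero_fun)

lemma alt_map_add: "alt_map p m \<Longrightarrow> alt_map p m' \<Longrightarrow> alt_map p (\<lambda>u. m u + m' u)"
  unfolding alt_map_iff by (auto intro: multilin_add)

lemma alt_map_cmult: "alt_map p m \<Longrightarrow> alt_map p (\<lambda>u. c * m u)"
  unfolding alt_map_iff by (auto intro: multilin_cmult)

lemma alt_map_0: "alt_map p (\<lambda>u. 0)"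
  unfolding alt_map_iff by (auto intro: multilin_zero)

lemma alt_map_sum: "(\<And>i. i \<in> I \<Longrightarrow> alt_map p (m i)) \<Longrightarrow> alt_map p (\<lambda>u. \<Sum>i\<in>I. m i u)"
  by (induction I rule: infinite_finite_induct) (auto intro: alt_map_add alt_map_0)

lemma alt_map_swap:
  assumes m: "alt_map p m" and ij: "i < p" "j < p" "i \<noteq> j"
  shows "m (u(i := b, j := a)) = - m (u(i := a, j := b))"
proof -
  define B where "B x y = m (u(i := x, j := y))" for x y
  have l1: "linear (\<lambda>x. B x y)" for y
  proof -
    have "(\<lambda>x. B x y) = (\<lambda>x. m ((u(j := y))(i := x)))"
      by (simp only: B_def fun_upd_twist[OF ij(3)])
    then show ?thesis using multilin_linear[OF alt_map_multilin[OF m] ij(1), of "u(j := y)"] by simp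
  qed
  have l2: "linear (\<lambda>y. B x y)" for x
    unfolding B_def by (rule multilin_linear[OF alt_map_multilin[OF m] ij(2)])
  have z: "B x x = 0" for x
    unfolding B_def by (rule alt_map_zero[OF m ij]) (use ij in simp)
  have "0 = B (a + b) (a + b)" by (simp add: z)
  also have "\<dots> = B a (a + b) + B b (a + b)" by (rule linear_add[OF l1])
  also have "\<dots> = (B a a + B a b) + (B b a + B b b)" by (simp add: linear_add[OF l2])
  finally have "B b a = - B a b" using z[of a] z[of b] by linarith
  then show ?thesis by (simp only: B_def)
qed

lemma alt_map_transpose:
  assumes m: "alt_map p m" and ij: "i < p" "j < p" "i \<noteq> j"
  shows "m (\<lambda>k. u (Transposition.transpose i j k)) = - m u"
proof -
  have "(\<lambda>k. u (Transposition.transpose i j k)) = u(i := u j, j := u i)"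
    by (auto simp: fun_eq_iff transpose_def)
  then show ?thesis using alt_map_swap[OF m ij, of u "u j" "u i"] by simp
qed

lemma sign_square [simp]: "of_int (sign \<sigma>) * (of_int (sign \<sigma>) :: real) = 1"
  by (auto simp: sign_def)

lemma alt_map_permutes:
  assumes m: "alt_map p m" and "\<sigma> permutes {..<p}"
  shows "m (\<lambda>k. u (\<sigma> k)) = of_int (sign \<sigma>) * m u"
proof -
  have "finite {..<p}" by simp
  from \<open>\<sigma> permutes {..<p}\<close> this have "\<forall>u. m (\<lambda>k. u (\<sigma> k)) = of_int (sign \<sigma>) * m u"
  proof (induction rule: permutes_induct)
    case (swap a b q)
    have "permutation q" using swap permutes_imp_permutation by blast
    then have "sign (Transposition.transpose a b \<circ> q) = - sign q"
      using swap by (simp add: sign_compose sign_swap_id permutation_swap_id)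
    moreover have "m (\<lambda>k. u ((Transposition.transpose a b \<circ> q) k)) = of_int (sign q) * (- m u)" for u
      using swap.IH[rule_format, of "\<lambda>k. u (Transposition.transpose a b k)"] alt_map_transpose[OF m, of a b u] swap
      by simp
    ultimately show ?case by (simp del: o_apply)
  qed (simp add: sign_id)
  then show ?thesis by blast
qed

text \<open>
  Wedge products and \<open>\<partial>\<close> are such sums,
  up to factorials.
\<close>

definition alternator :: "nat \<Rightarrow> ((nat \<Rightarrow> 'v::real_vector) \<Rightarrow> real) \<Rightarrow> (nat \<Rightarrow> 'v) \<Rightarrow> real" where
  "alternator N F u = (\<Sum>\<sigma> | \<sigma> permutes {..<N}. of_int (sign \<sigma>) * F (\<lambda>i. u (\<sigma> i)))"

lemma sign_compose_permutes:
  "\<sigma> permutes {..<N} \<Longrightarrow> \<tau> permutes {..<N::nat} \<Longrightarrow> sign (\<sigma> \<circ> \<tau>) = sign \<sigma> * sign \<tau>"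
  by (meson finite_lessThan permutes_imp_permutation sign_compose)

lemma alternator_permute:
  assumes "\<tau> permutes {..<N}"
  shows "alternator N (\<lambda>u. F (\<lambda>i. u (\<tau> i))) u = of_int (sign \<tau>) * alternator N F u"
proof -
  have "alternator N F u = (\<Sum>\<sigma> | \<sigma> permutes {..<N}. of_int (sign (\<sigma> \<circ> \<tau>)) * F (\<lambda>i. u ((\<sigma> \<circ> \<tau>) i)))"
    unfolding alternator_def by (rule sum_permutations_compose_right[OF assms])
  also have "\<dots> = (\<Sum>\<sigma> | \<sigma> permutes {..<N}. of_int (sign \<tau>) * (of_int (sign \<sigma>) * F (\<lambda>i. u (\<sigma> (\<tau> i)))))"
    by (rule sum.cong) (use assms sign_compose_permutes in auto)
  also have "\<dots> = of_int (sign \<tau>) * alternator N (\<lambda>u. F (\<lambda>i. u (\<tau> i))) u"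
    by (simp add: alternator_def sum_distrib_left)
  finally show ?thesis by (simp add: mult.assoc[symmetric])
qed

lemma alternator_sum: "alternator N (\<lambda>u. \<Sum>i\<in>I. F i u) u = (\<Sum>i\<in>I. alternator N (F i) u)"
  unfolding alternator_def by (subst sum.swap) (simp add: sum_distrib_left)

lemma alternator_add: "alternator N (\<lambda>u. F u + G u) u = alternator N F u + alternator N G u"
  by (simp add: alternator_def sum.distrib distrib_left)

lemma alternator_cmult: "alternator N (\<lambda>u. c * F u) u = c * alternator N F u"
  by (simp add: alternator_def sum_distrib_left mult.left_commute)

text \<open>
  If two arguments agree, reindexing the sum by their transposition changes the sign of every term.
\<close>

lemma alternator_alt_map:
  assumes F: "multilin N F"
  shows "alt_map N (alternator N F)"
  unfolding alt_map_iff multilin_def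
proof (intro conjI allI impI)
  fix u u' :: "nat \<Rightarrow> 'a" assume "\<forall>i<N. u i = u' i"
  then show "alternator N F u = alternator N F u'" unfolding alternator_def
    by (intro sum.cong refl arg_cong2[where f = "(*)"] multilin_cong[OF F])
       (metis lessThan_iff mem_Collect_eq permutes_in_image)
next
  fix u :: "nat \<Rightarrow> 'a" and i assume i: "i < N"
  have "linear (\<lambda>w. F (\<lambda>k. (u(i := w)) (\<sigma> k)))" if \<sigma>: "\<sigma> permutes {..<N}" for \<sigma>
  proof -
    have 1: "(\<lambda>k. (u(i := w)) (\<sigma> k)) = (\<lambda>k. u (\<sigma> k))(inv_into UNIV \<sigma> i := w)" for w
      using permutes_inverses[OF \<sigma>] by (auto simp: fun_eq_iff)
    have "inv_into UNIV \<sigma> i < N" using permutes_in_image[OF permutes_inv[OF \<sigma>]] i by (metis lessThan_iff)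
    then show ?thesis unfolding 1 by (rule multilin_linear[OF F])
  qed
  then show "linear (\<lambda>w. alternator N F (u(i := w)))" unfolding alternator_def
    by (intro linear_compose_sum ballI linear_cmult_real) blast
next
  fix u :: "nat \<Rightarrow> 'a" and i j assume ij: "i < N" "j < N" "i \<noteq> j" "u i = u j"
  have t: "Transposition.transpose i j permutes {..<N}" using ij by (simp add: permutes_swap_id)
  have u: "u (Transposition.transpose i j k) = u k" for k using ij by (cases "k = i"; cases "k = j") auto
  have "alternator N F u = (\<Sum>\<sigma> | \<sigma> permutes {..<N}. of_int (sign (Transposition.transpose i j \<circ> \<sigma>)) * F (\<lambda>k. u ((Transposition.transpose i j \<circ> \<sigma>) k)))"
    unfolding alternator_def by (rule setum_permutations_compose_left[OF t])
  also have "\<dots> = - alternator N F u" unfolding alternator_def sum_negf[symmetric]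
    by (rule sum.cong) (use ij t in \<open>auto simp: u sign_compose_permutes sign_swap_id\<close>)
  finally show "alternator N F u = 0" by simp
qed

text \<open>
  Alternating first over a family of permutations is redundant: each of its members contributes the
  full alternation once more, because its sign occurs twice.
\<close>

lemma alternator_average:
  assumes "\<And>\<rho>. \<rho> \<in> A \<Longrightarrow> l \<rho> permutes {..<N} \<and> sign (l \<rho>) = s \<rho>"
  shows "alternator N (\<lambda>u. \<Sum>\<rho>\<in>A. of_int (s \<rho>) * F (\<lambda>i. u (l \<rho> i))) u = of_nat (card A) * alternator N F u"
proof -
  have "alternator N (\<lambda>u. \<Sum>\<rho>\<in>A. of_int (s \<rho>) * F (\<lambda>i. u (l \<rho> i))) u
    = (\<Sum>\<rho>\<in>A. of_int (s \<rho>) * alternator N (\<lambda>u. F (\<lambda>i. u (l \<rho> i))) u)"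
    by (simp add: alternator_sum alternator_cmult)
  also have "\<dots> = (\<Sum>\<rho>\<in>A. alternator N F u)"
  proof (intro sum.cong refl)
    fix \<rho> assume "\<rho> \<in> A"
    from assms[OF this] show "of_int (s \<rho>) * alternator N (\<lambda>u. F (\<lambda>i. u (l \<rho> i))) u = alternator N F u"
      using alternator_permute[of "l \<rho>" N F u] sign_square[of "l \<rho>"] by (simp add: mult.assoc[symmetric])
  qed
  finally show ?thesis by simp
qed

lemma alternator_alternator_left:
  "alternator (p + r) (\<lambda>u. alternator p A u * B (\<lambda>i. u (p + i))) u
     = fact p * alternator (p + r) (\<lambda>u. A u * B (\<lambda>i. u (p + i))) u"
proof -
  have "alternator (p + r) (\<lambda>u. alternator p A u * B (\<lambda>i. u (p + i))) u
    = alternator (p + r) (\<lambda>u. \<Sum>\<rho> | \<rho> permutes {..<p}. of_int (sign \<rho>) *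
        (\<lambda>u. A u * B (\<lambda>i. u (p + i))) (\<lambda>i. u (\<rho> i))) u"
    unfolding alternator_def[of p] sum_distrib_right
    by (intro arg_cong2[where f = "alternator (p + r)"] ext sum.cong)
       (auto simp: permutes_not_in)
  also have "\<dots> = of_nat (card {\<rho>. \<rho> permutes {..<p}}) * alternator (p + r) (\<lambda>u. A u * B (\<lambda>i. u (p + i))) u"
    by (rule alternator_average) (auto intro: permutes_subset)
  finally show ?thesis by (simp add: card_permutations)
qed

text \<open>
  The family of permutations here is the copy of the symmetric group that acts on the last \<open>r\<close> of \<open>p + r\<close>
  positions.
\<close>

lemma alternator_inner:
  "alternator (p + r) (\<lambda>u. \<Sum>\<rho> | \<rho> permutes {..<r}. of_int (sign \<rho>) *
      F (\<lambda>i. if i < p then u i else u (p + \<rho> (i - p)))) u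
     = fact r * alternator (p + r) F u"
proof -
  define l where "l \<rho> = map_permutation {..<r} (\<lambda>i. p + i) \<rho>" for \<rho> :: "nat \<Rightarrow> nat"
  have inj: "inj_on (\<lambda>i. p + i) {..<r}" by simp
  have l: "l \<rho> permutes {..<p + r} \<and> sign (l \<rho>) = sign \<rho>" if "\<rho> \<in> {\<rho>. \<rho> permutes {..<r}}" for \<rho>
  proof -
    have "l \<rho> permutes (\<lambda>i. p + i) ` {..<r}"
      unfolding l_def using that by (intro map_permutation_permutes) (auto simp: bij_betw_def)
    then have "l \<rho> permutes {..<p + r}" by (rule permutes_subset) auto
    then show ?thesis using that sign_map_permutation[OF inj] by (simp add: l_def)
  qed
  have lu: "(if i < p then u i else u (p + \<rho> (i - p))) = u (l \<rho> i)" if \<rho>: "\<rho> permutes {..<r}" for \<rho> i u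
  proof -
    consider "i < p" | "p \<le> i" "i < p + r" | "p + r \<le> i" by linarith
    then show ?thesis
    proof cases
      case 1
      then show ?thesis by (auto simp: l_def map_permutation_def restrict_id_def)
    next
      case 2
      then have "i - p \<in> {..<r}" by auto
      from map_permutation_apply[OF inj this, of \<rho>] 2 show ?thesis by (simp add: l_def)
    next
      case 3
      then have "\<rho> (i - p) = i - p" by (intro permutes_not_in[OF \<rho>]) auto
      with 3 show ?thesis by (auto simp: l_def map_permutation_def restrict_id_def)
    qed
  qed
  have "alternator (p + r) (\<lambda>u. \<Sum>\<rho> | \<rho> permutes {..<r}. of_int (sign \<rho>) *
      F (\<lambda>i. if i < p then u i else u (p + \<rho> (i - p)))) u
    = alternator (p + r) (\<lambda>u. \<Sum>\<rho> | \<rho> permutes {..<r}. of_int (sign \<rho>) * F (\<lambda>i. u (l \<rho> i))) u"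
    by (intro arg_cong2[where f = "alternator (p + r)"] ext sum.cong refl) (auto simp: lu)
  also have "\<dots> = of_nat (card {\<rho>. \<rho> permutes {..<r}}) * alternator (p + r) F u"
    by (rule alternator_average) (rule l)
  finally show ?thesis by (simp add: card_permutations)
qed

lemma alternator_alternator_right:
  assumes A: "\<And>u u'. (\<And>i. i < p \<Longrightarrow> u i = u' i) \<Longrightarrow> A u = A u'"
  shows "alternator (p + r) (\<lambda>u. A u * alternator r B (\<lambda>i. u (p + i))) u
     = fact r * alternator (p + r) (\<lambda>u. A u * B (\<lambda>i. u (p + i))) u"
proof -
  have "alternator (p + r) (\<lambda>u. A u * alternator r B (\<lambda>i. u (p + i))) u
    = alternator (p + r) (\<lambda>u. \<Sum>\<rho> | \<rho> permutes {..<r}. of_int (sign \<rho>) *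
      (\<lambda>u. A u * B (\<lambda>i. u (p + i))) (\<lambda>i. if i < p then u i else u (p + \<rho> (i - p)))) u"
    unfolding alternator_def[of r] sum_distrib_left
  proof (intro arg_cong2[where f = "alternator (p + r)"] ext sum.cong refl)
    fix u :: "nat \<Rightarrow> 'a" and \<rho>
    have "A u = A (\<lambda>i. if i < p then u i else u (p + \<rho> (i - p)))" by (rule A) simp
    then show "A u * (of_int (sign \<rho>) * B (\<lambda>i. u (p + \<rho> i))) =
      of_int (sign \<rho>) * (A (\<lambda>i. if i < p then u i else u (p + \<rho> (i - p))) *
        B (\<lambda>i. if p + i < p then u (p + i) else u (p + \<rho> (p + i - p))))" by simp
  qed
  then show ?thesis
    by (simp only: alternator_inner[where F = "\<lambda>u. A u * B (\<lambda>i. u (p + i))"])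
qed

section \<open>Cartan's formula\<close>

lemma biforms_alt1: "\<omega> \<in> biforms p q \<Longrightarrow> alt_map p (\<lambda>u. \<omega> P u v)"
  and biforms_alt2: "\<omega> \<in> biforms p q \<Longrightarrow> alt_map q (\<omega> P u)"
  and biforms_smooth: "\<omega> \<in> biforms p q \<Longrightarrow> torus_smooth (\<lambda>P. \<omega> P u v)"
  by (auto simp: biforms_def)

lemma biformsI:
  assumes "\<And>P v. alt_map p (\<lambda>u. \<omega> P u v)" "\<And>P u. alt_map q (\<omega> P u)" "\<And>u v. torus_smooth (\<lambda>P. \<omega> P u v)"
  shows "\<omega> \<in> biforms p q"
  using assms by (auto simp: biforms_def)

text \<open>
  Operators on functions that commute with the flat structure.  Applied to the coefficients in the parallel
  frame they act on forms of every bidegree and commute with \<open>\<partial>\<close>.  The directional derivatives and the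
  convolutions are of this kind.
\<close>

definition parallel_op :: "(('n::finite torus \<Rightarrow> real) \<Rightarrow> 'n torus \<Rightarrow> real) \<Rightarrow> bool" where
  "parallel_op T \<longleftrightarrow> (\<forall>f. torus_smooth f \<longrightarrow> torus_smooth (T f)) \<and>
     (\<forall>f g. torus_smooth f \<longrightarrow> torus_smooth g \<longrightarrow> T (\<lambda>P. f P + g P) = (\<lambda>P. T f P + T g P)) \<and>
     (\<forall>f c. torus_smooth f \<longrightarrow> T (\<lambda>P. c * f P) = (\<lambda>P. c * T f P)) \<and>
     (\<forall>f P w. torus_smooth f \<longrightarrow> torus_deriv (T f) P w = T (\<lambda>Q. torus_deriv f Q w) P)"

lemma parallel_opD:
  assumes "parallel_op T"
  shows parallel_op_smooth: "torus_smooth f \<Longrightarrow> torus_smooth (T f)"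
    and parallel_op_add: "torus_smooth f \<Longrightarrow> torus_smooth g \<Longrightarrow> T (\<lambda>P. f P + g P) P = T f P + T g P"
    and parallel_op_cmult: "torus_smooth f \<Longrightarrow> T (\<lambda>P. c * f P) P = c * T f P"
    and parallel_op_deriv: "torus_smooth f \<Longrightarrow> torus_deriv (T f) P w = T (\<lambda>Q. torus_deriv f Q w) P"
  using assms by (auto simp: parallel_op_def)

lemma parallel_op_zero: "parallel_op T \<Longrightarrow> T (\<lambda>P. 0) P = 0"
proof -
  assume "parallel_op T"
  from parallel_op_cmult[OF this, of "\<lambda>P. 0" 0 P] show "T (\<lambda>P. 0) P = 0" by simp
qed

lemma parallel_op_sum:
  assumes "parallel_op T" "\<And>i. i \<in> I \<Longrightarrow> torus_smooth (f i)"
  shows "T (\<lambda>P. \<Sum>i\<in>I. f i P) P = (\<Sum>i\<in>I. T (f i) P)"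
  using assms(2)
  by (induction I rule: infinite_finite_induct)
     (auto simp: parallel_op_zero[OF assms(1)] parallel_op_add[OF assms(1)] torus_smooth_sum)

lemma parallel_op_torus_deriv: "parallel_op (\<lambda>f P. torus_deriv f P e)"
  unfolding parallel_op_def
  by (auto simp: torus_smooth_deriv torus_deriv_add torus_deriv_cmult torus_deriv_commute)

lemma parallel_op_torus_conv: "continuous_on {0..1} k \<Longrightarrow> parallel_op (torus_conv k e)"
  unfolding parallel_op_def
  by (auto simp: torus_conv_smooth torus_conv_add torus_conv_cmult torus_deriv_conv)

definition coeffwise :: "(('n::finite torus \<Rightarrow> real) \<Rightarrow> 'n torus \<Rightarrow> real) \<Rightarrow> 'n biform \<Rightarrow> 'n biform" where
  "coeffwise T \<omega> = (\<lambda>P u v. T (\<lambda>Q. \<omega> Q u v) P)"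

lemma linear_parallel_op:
  assumes T: "parallel_op T" and l: "\<And>Q. linear (\<lambda>w. g w Q)" and s: "\<And>w. torus_smooth (g w)"
  shows "linear (\<lambda>w. T (g w) P)"
proof -
  have "g (x + y) = (\<lambda>Q. g x Q + g y Q)" for x y
    by (rule ext) (rule linear_add[OF l])
  then have "T (g (x + y)) P = T (g x) P + T (g y) P" for x y
    using parallel_op_add[OF T s s] by simp
  moreover have "g (c *\<^sub>R x) = (\<lambda>Q. c * g x Q)" for c x
    using linear_cmul[OF l] by auto
  then have "T (g (c *\<^sub>R x)) P = c * T (g x) P" for c x
    using parallel_op_cmult[OF T s] by simp
  ultimately show ?thesis by (simp add: linear_iff)
qed

lemma alt_map_parallel_op:
  fixes g :: "(nat \<Rightarrow> 'v::real_vector) \<Rightarrow> 'n::finite torus \<Rightarrow> real"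
  assumes T: "parallel_op T" and l: "\<And>Q. alt_map p (\<lambda>u. g u Q)" and s: "\<And>u. torus_smooth (g u)"
  shows "alt_map p (\<lambda>u. T (g u) P)"
  unfolding alt_map_iff multilin_def
proof (intro conjI allI impI)
  fix u u' :: "nat \<Rightarrow> 'v" assume "\<forall>i<p. u i = u' i"
  then have "g u = g u'" by (intro ext alt_map_cong[OF l]) auto
  then show "T (g u) P = T (g u') P" by simp
next
  fix u :: "nat \<Rightarrow> 'v" and i assume "i < p"
  then show "linear (\<lambda>w. T (g (u(i := w))) P)"
    by (intro linear_parallel_op[OF T, where g = "\<lambda>w. g (u(i := w))"]
        multilin_linear[OF alt_map_multilin[OF l]] s)
next
  fix u :: "nat \<Rightarrow> 'v" and i j assume ij: "i < p" "j < p" "i \<noteq> j" "u i = u j"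
  have "g u = (\<lambda>Q. 0)" by (rule ext) (rule alt_map_zero[OF l ij])
  then show "T (g u) P = 0" by (simp add: parallel_op_zero[OF T])
qed

lemma coeffwise_biforms: "parallel_op T \<Longrightarrow> \<omega> \<in> biforms p q \<Longrightarrow> coeffwise T \<omega> \<in> biforms p q"
  unfolding coeffwise_def
  using alt_map_parallel_op[of T p "\<lambda>u Q. \<omega> Q u v" for v] alt_map_parallel_op[of T q "\<lambda>v Q. \<omega> Q u v" for u]
  by (intro biformsI) (simp_all add: parallel_op_smooth biforms_alt1 biforms_alt2 biforms_smooth)

lemma pd_eq_alternator:
  "pd p \<omega> P u v = alternator (Suc p) (\<lambda>u. torus_deriv (\<lambda>Q. \<omega> Q (\<lambda>i. u (Suc i)) v) P (u 0)) u / fact p"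
  by (simp add: pd_def e_map_def nabla_def alternator_def)

lemma pd_eq_sum:
  "pd p \<omega> P u v = (\<Sum>\<sigma> | \<sigma> permutes {..<Suc p}.
     (of_int (sign \<sigma>) / fact p) * torus_deriv (\<lambda>Q. \<omega> Q (\<lambda>i. u (\<sigma> (Suc i))) v) P (u (\<sigma> 0)))"
  by (simp add: pd_def e_map_def nabla_def sum_divide_distrib)

lemma multilin_deriv:
  assumes \<omega>: "\<omega> \<in> biforms p q"
  shows "multilin (Suc p) (\<lambda>u. torus_deriv (\<lambda>Q. \<omega> Q (\<lambda>i. u (Suc i)) v) P (u 0))"
  unfolding multilin_def
proof (intro conjI allI impI)
  fix u u' :: "nat \<Rightarrow> real ^ 'a" assume u: "\<forall>i<Suc p. u i = u' i"
  then have "\<omega> Q (\<lambda>i. u (Suc i)) v = \<omega> Q (\<lambda>i. u' (Suc i)) v" for Q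
    by (intro alt_map_cong[OF biforms_alt1[OF \<omega>]]) auto
  with u show "torus_deriv (\<lambda>Q. \<omega> Q (\<lambda>i. u (Suc i)) v) P (u 0) = torus_deriv (\<lambda>Q. \<omega> Q (\<lambda>i. u' (Suc i)) v) P (u' 0)"
    by simp
next
  fix u :: "nat \<Rightarrow> real ^ 'a" and i assume i: "i < Suc p"
  show "linear (\<lambda>w. torus_deriv (\<lambda>Q. \<omega> Q (\<lambda>j. (u(i := w)) (Suc j)) v) P ((u(i := w)) 0))"
  proof (cases i)
    case 0
    then show ?thesis by (simp add: torus_deriv_linear[OF biforms_smooth[OF \<omega>]])
  next
    case (Suc j)
    then have "(\<lambda>k. (u(i := w)) (Suc k)) = (\<lambda>k. u (Suc k))(j := w)" for w by auto
    then show ?thesis using Suc i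
      by (simp del: fun_upd_apply add: fun_upd_other)
         (intro linear_parallel_op[OF parallel_op_torus_deriv,
             where g = "\<lambda>w Q. \<omega> Q ((\<lambda>k. u (Suc k))(j := w)) v"] biforms_smooth[OF \<omega>]
           multilin_linear[OF alt_map_multilin[OF biforms_alt1[OF \<omega>]]], simp)
  qed
qed

lemma pd_biforms:
  assumes \<omega>: "\<omega> \<in> biforms p q"
  shows "pd p \<omega> \<in> biforms (Suc p) q"
proof (rule biformsI)
  fix P v
  show "alt_map (Suc p) (\<lambda>u. pd p \<omega> P u v)"
    unfolding pd_eq_alternator
    using alt_map_cmult[OF alternator_alt_map[OF multilin_deriv[OF \<omega>]], of "1 / fact p"] by simp
next
  fix P u
  show "alt_map q (pd p \<omega> P u)"
    unfolding pd_eq_sum[abs_def]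
    by (intro alt_map_sum alt_map_cmult alt_map_parallel_op[OF parallel_op_torus_deriv]
        biforms_alt2[OF \<omega>] biforms_smooth[OF \<omega>])
next
  fix u v
  show "torus_smooth (\<lambda>P. pd p \<omega> P u v)"
    unfolding pd_eq_sum
    by (intro torus_smooth_sum torus_smooth_cmult torus_smooth_deriv biforms_smooth[OF \<omega>])
qed

lemma pd_coeffwise:
  assumes T: "parallel_op T" and \<omega>: "\<omega> \<in> biforms p q"
  shows "pd p (coeffwise T \<omega>) = coeffwise T (pd p \<omega>)"
proof (intro ext)
  fix P u v
  have "coeffwise T (pd p \<omega>) P u v = (\<Sum>\<sigma> | \<sigma> permutes {..<Suc p}.
     T (\<lambda>P. (of_int (sign \<sigma>) / fact p) * torus_deriv (\<lambda>Q. \<omega> Q (\<lambda>i. u (\<sigma> (Suc i))) v) P (u (\<sigma> 0))) P)"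
    unfolding coeffwise_def pd_eq_sum
    by (rule parallel_op_sum[OF T]) (intro torus_smooth_cmult torus_smooth_deriv biforms_smooth[OF \<omega>])
  also have "\<dots> = pd p (coeffwise T \<omega>) P u v"
    unfolding coeffwise_def pd_eq_sum
    by (intro sum.cong refl)
       (simp only: parallel_op_cmult[OF T torus_smooth_deriv[OF biforms_smooth[OF \<omega>]]]
          parallel_op_deriv[OF T biforms_smooth[OF \<omega>]])
  finally show "pd p (coeffwise T \<omega>) P u v = coeffwise T (pd p \<omega>) P u v" by simp
qed

lemma zero_biforms: "(\<lambda>P u v. 0) \<in> biforms p q"
  by (intro biformsI) (auto intro: alt_map_0)

lemma add_biforms: "\<omega> \<in> biforms p q \<Longrightarrow> \<eta> \<in> biforms p q \<Longrightarrow> (\<lambda>P u v. \<omega> P u v + \<eta> P u v) \<in> biforms p q"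
  by (intro biformsI alt_map_add torus_smooth_add) (auto intro: biforms_alt1 biforms_alt2 biforms_smooth)

lemma cmult_biforms: "\<omega> \<in> biforms p q \<Longrightarrow> (\<lambda>P u v. c * \<omega> P u v) \<in> biforms p q"
  by (intro biformsI alt_map_cmult torus_smooth_cmult) (auto intro: biforms_alt1 biforms_alt2 biforms_smooth)

lemma pd_zero: "pd p (\<lambda>P u v. 0) = (\<lambda>P u v. 0)"
  by (simp add: pd_eq_sum fun_eq_iff)

lemma pd_add:
  "\<omega> \<in> biforms p q \<Longrightarrow> \<eta> \<in> biforms p q \<Longrightarrow>
    pd p (\<lambda>P u v. \<omega> P u v + \<eta> P u v) = (\<lambda>P u v. pd p \<omega> P u v + pd p \<eta> P u v)"
  by (simp add: pd_eq_sum fun_eq_iff torus_deriv_add biforms_smooth sum.distrib distrib_left)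

lemma pd_cmult:
  "\<omega> \<in> biforms p q \<Longrightarrow> pd p (\<lambda>P u v. c * \<omega> P u v) = (\<lambda>P u v. c * pd p \<omega> P u v)"
  by (simp add: pd_eq_sum fun_eq_iff torus_deriv_cmult biforms_smooth sum_distrib_left mult.left_commute)

lemma permutes_Suc_image:
  assumes q: "q permutes Suc ` {..<p}"
  obtains \<rho> where "\<rho> permutes {..<p}" "sign \<rho> = sign q" "\<And>i. q (Suc i) = Suc (\<rho> i)"
proof -
  define \<rho> where "\<rho> = map_permutation (Suc ` {..<p}) (\<lambda>i. i - 1) q"
  have inj: "inj_on (\<lambda>i. i - 1) (Suc ` {..<p})" by (auto simp: inj_on_def)
  have "bij_betw (\<lambda>i. i - 1) (Suc ` {..<p}) {..<p}"
    using inj by (auto simp: bij_betw_def image_image)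
  then have \<rho>: "\<rho> permutes {..<p}" unfolding \<rho>_def by (rule map_permutation_permutes) (rule q)
  show ?thesis
  proof (rule that[of \<rho>])
    show "\<rho> permutes {..<p}" by (rule \<rho>)
    show "sign \<rho> = sign q" unfolding \<rho>_def by (rule sign_map_permutation[OF inj q]) simp
    show "q (Suc i) = Suc (\<rho> i)" for i
    proof (cases "i < p")
      case True
      then have "q (Suc i) \<in> Suc ` {..<p}" using permutes_in_image[OF q, of "Suc i"] by auto
      moreover have "\<rho> i = q (Suc i) - 1"
        using map_permutation_apply[OF inj, of "Suc i" q] True by (simp add: \<rho>_def)
      ultimately show ?thesis by auto
    next
      case False
      then show ?thesis using permutes_not_in[OF \<rho>, of i] permutes_not_in[OF q, of "Suc i"] by auto
    qed
  qed
qed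

text \<open>
  The permutations of the first \<open>p + 1\<close> positions are sorted by the position \<open>b\<close> whose vector is used for
  differentiating, each being a transposition of \<open>0\<close> and \<open>b\<close> after a permutation of the
  other positions; the latter contribute \<open>p!\<close> equal terms since \<open>\<omega>\<close> is alternating.
\<close>

lemma pd_formula:
  assumes \<omega>: "\<omega> \<in> biforms p q"
  shows "pd p \<omega> P u v = torus_deriv (\<lambda>Q. \<omega> Q (\<lambda>i. u (Suc i)) v) P (u 0)
    - (\<Sum>b<p. torus_deriv (\<lambda>Q. \<omega> Q ((\<lambda>i. u (Suc i))(b := u 0)) v) P (u (Suc b)))"
proof -
  define G where "G u = torus_deriv (\<lambda>Q. \<omega> Q (\<lambda>i. u (Suc i)) v) P (u 0)" for u
  define t where "t b i = u (Transposition.transpose 0 b i)" for b i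
  have t0: "t 0 = u" by (simp add: t_def fun_eq_iff)
  let ?S = "Suc ` {..<p}"
  have S: "insert 0 ?S = {..<Suc p}" by (auto simp: lessThan_Suc_eq_insert_0)
  have Gq: "G (\<lambda>i. x (q i)) = of_int (sign q) * G x" if q: "q permutes ?S" for q x
  proof -
    obtain \<rho> where \<rho>: "\<rho> permutes {..<p}" "sign \<rho> = sign q" "\<And>i. q (Suc i) = Suc (\<rho> i)"
      using permutes_Suc_image[OF q] by blast
    have "q 0 = 0" by (rule permutes_not_in[OF q]) auto
    then show ?thesis
      using alt_map_permutes[OF biforms_alt1[OF \<omega>] \<rho>(1), of _ "\<lambda>i. x (Suc i)" v] \<rho>
      by (simp add: G_def torus_deriv_cmult biforms_smooth[OF \<omega>])
  qed
  have "alternator (Suc p) G u = (\<Sum>\<sigma> | \<sigma> permutes insert 0 ?S. of_int (sign \<sigma>) * G (\<lambda>i. u (\<sigma> i)))"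
    by (simp add: alternator_def S)
  also have "\<dots> = (\<Sum>b\<in>insert 0 ?S. \<Sum>q | q permutes ?S.
      of_int (sign (Transposition.transpose 0 b \<circ> q)) * G (\<lambda>i. u ((Transposition.transpose 0 b \<circ> q) i)))"
    by (rule sum_over_permutations_insert) auto
  also have "\<dots> = (\<Sum>b\<in>insert 0 ?S. fact p * (of_int (sign (Transposition.transpose 0 b)) * G (t b)))"
  proof (rule sum.cong[OF refl])
    fix b assume b: "b \<in> insert 0 ?S"
    have "(\<Sum>q | q permutes ?S. of_int (sign (Transposition.transpose 0 b \<circ> q)) * G (\<lambda>i. u ((Transposition.transpose 0 b \<circ> q) i)))
       = (\<Sum>q | q permutes ?S. of_int (sign (Transposition.transpose 0 b)) * G (t b))"
    proof (rule sum.cong[OF refl])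
      fix q assume "q \<in> {q. q permutes ?S}"
      then have q: "q permutes ?S" by simp
      have "permutation q" by (rule permutes_imp_permutation[OF _ q]) simp
      then have "sign (Transposition.transpose 0 b \<circ> q) = sign (Transposition.transpose 0 b) * sign q"
        by (simp add: sign_compose permutation_swap_id)
      moreover have "G (\<lambda>i. u ((Transposition.transpose 0 b \<circ> q) i)) = of_int (sign q) * G (t b)"
        using Gq[OF q, of "t b"] by (simp add: t_def)
      moreover have "of_int (x * sign q) * (of_int (sign q) * y) = of_int x * (y::real)" for x y
        by (auto simp: sign_def)
      ultimately show "of_int (sign (Transposition.transpose 0 b \<circ> q)) * G (\<lambda>i. u ((Transposition.transpose 0 b \<circ> q) i))
         = of_int (sign (Transposition.transpose 0 b)) * G (t b)"
        by (simp only:)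
    qed
    also have "\<dots> = fact p * (of_int (sign (Transposition.transpose 0 b)) * G (t b))"
      by (simp add: card_permutations card_image)
    finally show "(\<Sum>q | q permutes ?S. of_int (sign (Transposition.transpose 0 b \<circ> q)) * G (\<lambda>i. u ((Transposition.transpose 0 b \<circ> q) i)))
       = fact p * (of_int (sign (Transposition.transpose 0 b)) * G (t b))" .
  qed
  also have "\<dots> = fact p * (G u - (\<Sum>b<p. G (t (Suc b))))"
    by (simp add: sum.reindex sum_distrib_left[symmetric] sign_swap_id sum_negf t0 sign_id algebra_simps)
  finally have "alternator (Suc p) G u = fact p * (G u - (\<Sum>b<p. G (t (Suc b))))" .
  moreover have "pd p \<omega> P u v = alternator (Suc p) G u / fact p"
    by (simp add: pd_eq_alternator G_def[abs_def])
  ultimately have "pd p \<omega> P u v = G u - (\<Sum>b<p. G (t (Suc b)))" by simp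
  moreover have "(\<lambda>i. t (Suc b) (Suc i)) = (\<lambda>i. u (Suc i))(b := u 0)" for b
    by (auto simp: t_def fun_eq_iff)
  moreover have "t (Suc b) 0 = u (Suc b)" for b by (simp add: t_def)
  ultimately show ?thesis by (simp add: G_def)
qed

definition contract :: "real ^ 'n \<Rightarrow> 'n::finite biform \<Rightarrow> 'n biform" where
  "contract e \<omega> = (\<lambda>P u v. \<omega> P (case_nat e u) v)"

lemma case_nat_upd: "case_nat e (u(i := w)) = (case_nat e u)(Suc i := w)"
  by (auto simp: fun_eq_iff split: nat.split)

lemma case_nat_eta: "case_nat (u 0) (\<lambda>i. u (Suc i)) = u"
  by (auto simp: fun_eq_iff split: nat.split)

lemma alt_map_contract:
  assumes "alt_map (Suc p) m"
  shows "alt_map p (\<lambda>u. m (case_nat e u))"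
  unfolding alt_map_iff multilin_def
proof (intro conjI allI impI)
  fix u u' :: "nat \<Rightarrow> 'a" assume "\<forall>i<p. u i = u' i"
  then show "m (case_nat e u) = m (case_nat e u')"
    by (intro alt_map_cong[OF assms]) (auto split: nat.split)
next
  fix u :: "nat \<Rightarrow> 'a" and i assume "i < p"
  then show "linear (\<lambda>w. m (case_nat e (u(i := w))))" unfolding case_nat_upd
    by (intro multilin_linear[OF alt_map_multilin[OF assms]]) simp
next
  fix u :: "nat \<Rightarrow> 'a" and i j assume "i < p" "j < p" "i \<noteq> j" "u i = u j"
  then show "m (case_nat e u) = 0" by (intro alt_map_zero[OF assms, of "Suc i" "Suc j"]) auto
qed

lemma contract_biforms: "\<omega> \<in> biforms (Suc p) q \<Longrightarrow> contract e \<omega> \<in> biforms p q"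
  unfolding contract_def
  by (intro biformsI alt_map_contract) (auto intro: biforms_alt1 biforms_alt2 biforms_smooth)

definition lie :: "real ^ 'n \<Rightarrow> 'n::finite biform \<Rightarrow> 'n biform" where
  "lie e = coeffwise (\<lambda>f P. torus_deriv f P e)"

lemma lie_eq: "lie e \<omega> P u v = torus_deriv (\<lambda>Q. \<omega> Q u v) P e"
  by (simp add: lie_def coeffwise_def)

lemma lie_biforms: "\<omega> \<in> biforms p q \<Longrightarrow> lie e \<omega> \<in> biforms p q"
  unfolding lie_def by (rule coeffwise_biforms[OF parallel_op_torus_deriv])

lemma pd_lie: "\<omega> \<in> biforms p q \<Longrightarrow> pd p (lie e \<omega>) = lie e (pd p \<omega>)"
  unfolding lie_def by (rule pd_coeffwise[OF parallel_op_torus_deriv])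

lemma torus_deriv_minus: "torus_smooth f \<Longrightarrow> torus_deriv (\<lambda>P. - f P) P w = - torus_deriv f P w"
  using torus_deriv_cmult[of f "-1"] by simp

lemma contract_pd_0: "\<omega> \<in> biforms 0 q \<Longrightarrow> contract e (pd 0 \<omega>) = lie e \<omega>"
  by (simp add: contract_def pd_formula lie_eq fun_eq_iff)

text \<open>
  Expand both sides by \<open>pd_formula\<close>.  The terms that differentiate along an old argument cancel, because
  \<open>e\<close> and that argument have exchanged places; what remains is the derivative along \<open>e\<close>.
\<close>

lemma cartan:
  assumes \<omega>: "\<omega> \<in> biforms (Suc p) q"
  shows "contract e (pd (Suc p) \<omega>) = (\<lambda>P u v. lie e \<omega> P u v + -1 * pd p (contract e \<omega>) P u v)"
proof (intro ext)
  fix P u v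
  have "\<omega> Q (u(Suc b := e)) v = -1 * \<omega> Q (case_nat e ((\<lambda>i. u (Suc i))(b := u 0))) v" if "b < p" for b Q
  proof -
    have "u(0 := e, Suc b := u 0) = case_nat e ((\<lambda>i. u (Suc i))(b := u 0))"
      by (auto simp: fun_eq_iff split: nat.split)
    moreover have "u(0 := u 0, Suc b := e) = u(Suc b := e)" by simp
    ultimately show ?thesis
      using alt_map_swap[OF biforms_alt1[OF \<omega>], of 0 "Suc b" Q u "u 0" e] that by simp
  qed
  then have "torus_deriv (\<lambda>Q. \<omega> Q (u(Suc b := e)) v) P w
    = - torus_deriv (\<lambda>Q. \<omega> Q (case_nat e ((\<lambda>i. u (Suc i))(b := u 0))) v) P w" if "b < p" for b w
    using that by (simp add: torus_deriv_minus biforms_smooth[OF \<omega>])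
  moreover have "u(0 := e) = case_nat e (\<lambda>i. u (Suc i))"
    by (auto simp: fun_eq_iff split: nat.split)
  ultimately show "contract e (pd (Suc p) \<omega>) P u v = lie e \<omega> P u v + -1 * pd p (contract e \<omega>) P u v"
    unfolding pd_formula[OF contract_biforms[OF \<omega>]]
    by (simp add: contract_def pd_formula[OF \<omega>] lie_eq sum.lessThan_Suc_shift sum_negf del: sum.lessThan_Suc)
qed

lemma biform_eq_contract:
  assumes "\<And>e. contract e \<omega> = contract e \<eta>"
  shows "\<omega> = \<eta>"
proof (intro ext)
  fix P u v
  show "\<omega> P u v = \<eta> P u v"
    using fun_cong[OF fun_cong[OF fun_cong[OF assms[of "u 0"]]], of P "\<lambda>i. u (Suc i)" v]
    by (simp add: contract_def case_nat_eta)
qed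

text \<open>
  By Cartan's formula \<open>\<iota>\<^sub>e \<partial>\<^sup>2 = \<partial>\<^sup>2 \<iota>\<^sub>e\<close>, which reduces the degree.  In degree \<open>0\<close> the claim is that \<open>\<partial>\<close>
  commutes with \<open>D\<^sub>e\<close>, that is, the symmetry of second derivatives.
\<close>

lemma pd_pd:
  "\<omega> \<in> biforms p q \<Longrightarrow> pd (Suc p) (pd p \<omega>) = (\<lambda>P u v. 0)"
proof (induction p arbitrary: \<omega>)
  case 0
  have "contract e (pd (Suc 0) (pd 0 \<omega>)) = contract e (\<lambda>P u v. 0)" for e
    unfolding cartan[OF pd_biforms[OF 0]] contract_pd_0[OF 0] pd_lie[OF 0] by (simp add: contract_def)
  then show ?case by (rule biform_eq_contract)
next
  case (Suc p)
  have "contract e (pd (Suc (Suc p)) (pd (Suc p) \<omega>)) = contract e (\<lambda>P u v. 0)" for e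
  proof -
    have c: "contract e \<omega> \<in> biforms p q" by (rule contract_biforms[OF Suc.prems])
    have "pd (Suc p) (\<lambda>P u v. lie e \<omega> P u v + -1 * pd p (contract e \<omega>) P u v)
      = (\<lambda>P u v. lie e (pd (Suc p) \<omega>) P u v)"
      unfolding pd_add[OF lie_biforms[OF Suc.prems] cmult_biforms[OF pd_biforms[OF c]]]
        pd_cmult[OF pd_biforms[OF c]] pd_lie[OF Suc.prems] Suc.IH[OF c] by simp
    then show ?thesis
      unfolding cartan[OF pd_biforms[OF Suc.prems]] cartan[OF Suc.prems] by (simp add: contract_def)
  qed
  then show ?case by (rule biform_eq_contract)
qed

section \<open>Every closed form is cohomologous to a unique parallel form\<close>

lemma closed_biformsD: "\<omega> \<in> closed_biforms p q \<Longrightarrow> \<omega> \<in> biforms p q" "\<omega> \<in> closed_biforms p q \<Longrightarrow> pd p \<omega> = (\<lambda>P u v. 0)"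
  by (auto simp: closed_biforms_def)

lemma closed_biformsI: "\<omega> \<in> biforms p q \<Longrightarrow> pd p \<omega> = (\<lambda>P u v. 0) \<Longrightarrow> \<omega> \<in> closed_biforms p q"
  by (auto simp: closed_biforms_def)

lemma exact_biforms_Suc: "exact_biforms (Suc p) q = pd p ` biforms p q"
  by (simp add: exact_biforms_def)

lemma exact_biforms_0: "exact_biforms 0 q = {\<lambda>P u v. 0}"
  by (simp add: exact_biforms_def)

lemma closed_zero: "(\<lambda>P u v. 0) \<in> closed_biforms p q"
  by (intro closed_biformsI zero_biforms pd_zero)

lemma closed_add:
  assumes "\<omega> \<in> closed_biforms p q" "\<eta> \<in> closed_biforms p q"
  shows "(\<lambda>P u v. \<omega> P u v + \<eta> P u v) \<in> closed_biforms p q"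
  using assms by (intro closed_biformsI add_biforms) (auto simp: closed_biforms_def pd_add)

lemma closed_cmult:
  assumes "\<omega> \<in> closed_biforms p q"
  shows "(\<lambda>P u v. c * \<omega> P u v) \<in> closed_biforms p q"
  using assms by (intro closed_biformsI cmult_biforms) (auto simp: closed_biforms_def pd_cmult)

lemma exact_subset_closed: "exact_biforms p q \<subseteq> closed_biforms p q"
  by (cases p) (auto simp: exact_biforms_0 exact_biforms_Suc closed_zero intro!: closed_biformsI pd_biforms pd_pd)

lemma exact_zero: "(\<lambda>P u v. 0) \<in> exact_biforms p q"
  by (cases p) (auto simp: exact_biforms_0 exact_biforms_Suc intro!: image_eqI[where x = "\<lambda>P u v. 0"] zero_biforms pd_zero[symmetric])

lemma exact_add:
  assumes "\<omega> \<in> exact_biforms p q" "\<eta> \<in> exact_biforms p q"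
  shows "(\<lambda>P u v. \<omega> P u v + \<eta> P u v) \<in> exact_biforms p q"
proof (cases p)
  case 0
  then show ?thesis using assms by (simp add: exact_biforms_0)
next
  case (Suc p')
  then obtain \<alpha> \<beta> where "\<alpha> \<in> biforms p' q" "\<omega> = pd p' \<alpha>" "\<beta> \<in> biforms p' q" "\<eta> = pd p' \<beta>"
    using assms by (auto simp: exact_biforms_Suc)
  then show ?thesis unfolding Suc exact_biforms_Suc
    by (intro image_eqI[where x = "\<lambda>P u v. \<alpha> P u v + \<beta> P u v"]) (simp_all add: pd_add add_biforms)
qed

lemma exact_cmult:
  assumes "\<omega> \<in> exact_biforms p q"
  shows "(\<lambda>P u v. c * \<omega> P u v) \<in> exact_biforms p q"
proof (cases p)
  case 0
  then show ?thesis using assms by (simp add: exact_biforms_0)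
next
  case (Suc p')
  then obtain \<alpha> where "\<alpha> \<in> biforms p' q" "\<omega> = pd p' \<alpha>"
    using assms by (auto simp: exact_biforms_Suc)
  then show ?thesis unfolding Suc exact_biforms_Suc
    by (intro image_eqI[where x = "\<lambda>P u v. c * \<alpha> P u v"]) (simp_all add: pd_cmult cmult_biforms)
qed

definition mean :: "real ^ 'n \<Rightarrow> 'n::finite biform \<Rightarrow> 'n biform" where
  "mean e = coeffwise (torus_conv (\<lambda>_. 1) e)"

lemma parallel_op_mean: "parallel_op (torus_conv (\<lambda>_. 1) e)"
  by (rule parallel_op_torus_conv) simp

lemma parallel_op_saw: "parallel_op (torus_conv (\<lambda>t. t - 1/2) e)"
  by (rule parallel_op_torus_conv) (intro continuous_intros)

lemma mean_biforms: "\<omega> \<in> biforms p q \<Longrightarrow> mean e \<omega> \<in> biforms p q"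
  unfolding mean_def by (rule coeffwise_biforms[OF parallel_op_mean])

lemma pd_mean: "\<omega> \<in> biforms p q \<Longrightarrow> pd p (mean e \<omega>) = mean e (pd p \<omega>)"
  unfolding mean_def by (rule pd_coeffwise[OF parallel_op_mean])

lemma mean_closed: "\<omega> \<in> closed_biforms p q \<Longrightarrow> mean e \<omega> \<in> closed_biforms p q"
  by (intro closed_biformsI mean_biforms)
     (auto simp: closed_biforms_def pd_mean, simp add: mean_def coeffwise_def)

lemma lie_mean: "\<omega> \<in> biforms p q \<Longrightarrow> lie w (mean e \<omega>) = mean e (lie w \<omega>)"
  by (auto simp: lie_def mean_def coeffwise_def fun_eq_iff parallel_op_deriv[OF parallel_op_mean] biforms_smooth)

lemma lie_mean_self:
  assumes "\<And>i. e $ i \<in> \<int>" "\<omega> \<in> biforms p q"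
  shows "lie e (mean e \<omega>) = (\<lambda>P u v. 0)"
  unfolding lie_mean[OF assms(2)]
  by (simp add: lie_def mean_def coeffwise_def torus_mean_deriv[OF assms(1) biforms_smooth[OF assms(2)]])

lemma saw_lie:
  assumes "\<And>i. e $ i \<in> \<int>" "\<omega> \<in> biforms p q"
  shows "coeffwise (torus_conv (\<lambda>t. t - 1/2) e) (lie e \<omega>) = (\<lambda>P u v. \<omega> P u v + -1 * mean e \<omega> P u v)"
  by (simp add: lie_def mean_def coeffwise_def torus_saw_deriv[OF assms(1) biforms_smooth[OF assms(2)]])

text \<open>
  For closed \<open>\<omega>\<close> Cartan's formula reads \<open>D\<^sub>e \<omega> = \<partial> (\<iota>\<^sub>e \<omega>)\<close>.  Applying the operator \<open>S\<close> with weight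
  \<open>t - 1/2\<close> turns the left side into \<open>\<omega> - A \<omega>\<close> and the right side into \<open>\<partial> (S (\<iota>\<^sub>e \<omega>))\<close>.
\<close>

lemma minus_mean_exact:
  assumes e: "\<And>i. e $ i \<in> \<int>" and \<omega>: "\<omega> \<in> closed_biforms p q"
  shows "(\<lambda>P u v. \<omega> P u v + -1 * mean e \<omega> P u v) \<in> exact_biforms p q"
proof (cases p)
  case 0
  have "lie e \<omega> = (\<lambda>P u v. 0)"
    using contract_pd_0[of \<omega> q e] closed_biformsD[OF \<omega>] 0 by (simp add: contract_def)
  then show ?thesis
    unfolding saw_lie[OF e closed_biformsD(1)[OF \<omega>], symmetric] 0 exact_biforms_0
    by (simp add: coeffwise_def parallel_op_zero[OF parallel_op_saw])
next
  case (Suc p')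
  note \<omega>' = closed_biformsD(1)[OF \<omega>, unfolded Suc]
  have "lie e \<omega> = pd p' (contract e \<omega>)"
    using cartan[OF \<omega>', of e] closed_biformsD(2)[OF \<omega>, unfolded Suc] by (simp add: contract_def fun_eq_iff)
  then show ?thesis
    unfolding saw_lie[OF e closed_biformsD(1)[OF \<omega>], symmetric] Suc exact_biforms_Suc
    by (simp add: pd_coeffwise[OF parallel_op_saw contract_biforms[OF \<omega>'], symmetric]
      coeffwise_biforms[OF parallel_op_saw contract_biforms[OF \<omega>']])
qed

lemma axis_integral: "axis i (1::real) $ j \<in> \<int>"
  by (simp add: axis_def)

definition parallel_biform :: "'n::finite biform \<Rightarrow> bool" where
  "parallel_biform \<omega> \<longleftrightarrow> (\<forall>P Q. \<omega> P = \<omega> Q)"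

lemma parallelI:
  assumes "\<omega> \<in> biforms p q" "\<And>i. lie (axis i 1) \<omega> = (\<lambda>P u v. 0)"
  shows "parallel_biform \<omega>"
  unfolding parallel_biform_def
proof (intro allI ext)
  fix P Q u v
  show "\<omega> P u v = \<omega> Q u v"
    using torus_deriv_zero_imp_constant[OF biforms_smooth[OF assms(1)], of u v P Q]
      assms(2) by (metis lie_eq)
qed

lemma pd_parallel:
  assumes "parallel_biform \<omega>"
  shows "pd p \<omega> = (\<lambda>P u v. 0)"
proof -
  have "torus_deriv (\<lambda>Q. \<omega> Q u v) P w = 0" for u v P w
  proof -
    have "(\<lambda>Q. \<omega> Q u v) = (\<lambda>Q. \<omega> (abs_torus 0) u v)"
      using assms unfolding parallel_biform_def by metis
    then show ?thesis by (simp only: torus_deriv_const)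
  qed
  then show ?thesis by (simp add: pd_eq_sum fun_eq_iff)
qed

text \<open>
  Averaging over the coordinate \<open>x\<^sup>j\<close> kills the derivative in that direction and keeps the derivatives that
  vanish already, so an induction over the set of coordinates makes all coefficients constant.
\<close>

theorem closed_cohomologous_parallel:
  fixes \<omega> :: "'n::finite biform"
  assumes \<omega>: "\<omega> \<in> closed_biforms p q"
  obtains \<eta> where "\<eta> \<in> biforms p q" "parallel_biform \<eta>"
    "(\<lambda>P u v. \<omega> P u v + -1 * \<eta> P u v) \<in> exact_biforms p q"
proof -
  have "finite (UNIV :: 'n set)" by simp
  then have "\<exists>\<eta>\<in>closed_biforms p q. (\<forall>i\<in>UNIV. lie (axis i 1) \<eta> = (\<lambda>P u v. 0)) \<and>
    (\<lambda>P u v. \<omega> P u v + -1 * \<eta> P u v) \<in> exact_biforms p q"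
  proof (induction rule: finite_induct)
    case empty
    then show ?case using \<omega> exact_zero by (intro bexI[of _ \<omega>]) auto
  next
    case (insert j S)
    then obtain \<eta> where \<eta>: "\<eta> \<in> closed_biforms p q" "\<And>i. i \<in> S \<Longrightarrow> lie (axis i 1) \<eta> = (\<lambda>P u v. 0)"
      "(\<lambda>P u v. \<omega> P u v + -1 * \<eta> P u v) \<in> exact_biforms p q" by blast
    let ?e = "axis j 1 :: real ^ 'n"
    have "lie (axis i 1) (mean ?e \<eta>) = (\<lambda>P u v. 0)" if "i \<in> insert j S" for i
      using that lie_mean_self[of ?e, OF axis_integral closed_biformsD(1)[OF \<eta>(1)]] \<eta>(2)[of i]
        lie_mean[OF closed_biformsD(1)[OF \<eta>(1)], of "axis i 1" ?e]
      by (auto simp: mean_def coeffwise_def)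
    moreover have "(\<lambda>P u v. \<omega> P u v + -1 * mean ?e \<eta> P u v) \<in> exact_biforms p q"
      using exact_add[OF \<eta>(3) minus_mean_exact[of ?e, OF axis_integral \<eta>(1)]] by simp
    ultimately show ?case using mean_closed[OF \<eta>(1)] by blast
  qed
  then show ?thesis using that parallelI closed_biformsD(1) by blast
qed

text \<open>
  A primitive of a constant form stays a primitive under averaging.  After averaging over all coordinates it
  is constant itself, hence closed.
\<close>

theorem parallel_exact_zero:
  fixes \<omega> :: "'n::finite biform"
  assumes \<omega>: "parallel_biform \<omega>" "\<omega> \<in> exact_biforms p q"
  shows "\<omega> = (\<lambda>P u v. 0)"
proof (cases p)
  case 0
  then show ?thesis using \<omega> by (simp add: exact_biforms_0)
next
  case (Suc p')
  have "finite (UNIV :: 'n set)" by simp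
  then have "\<exists>\<eta>\<in>biforms p' q. (\<forall>i\<in>UNIV. lie (axis i 1) \<eta> = (\<lambda>P u v. 0)) \<and> pd p' \<eta> = \<omega>"
  proof (induction rule: finite_induct)
    case empty
    then show ?case using \<omega>(2) Suc by (auto simp: exact_biforms_Suc)
  next
    case (insert j S)
    then obtain \<eta> where \<eta>: "\<eta> \<in> biforms p' q" "\<And>i. i \<in> S \<Longrightarrow> lie (axis i 1) \<eta> = (\<lambda>P u v. 0)" "pd p' \<eta> = \<omega>"
      by blast
    let ?e = "axis j 1 :: real ^ 'n"
    have "lie (axis i 1) (mean ?e \<eta>) = (\<lambda>P u v. 0)" if "i \<in> insert j S" for i
      using that lie_mean_self[of ?e, OF axis_integral \<eta>(1)] \<eta>(2)[of i] lie_mean[OF \<eta>(1), of "axis i 1" ?e]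
      by (auto simp: mean_def coeffwise_def)
    moreover have "mean ?e \<omega> = \<omega>"
    proof (intro ext)
      fix P u v
      have c: "(\<lambda>Q. \<omega> Q u v) = (\<lambda>Q. \<omega> P u v)"
        using \<omega>(1) unfolding parallel_biform_def by metis
      show "mean ?e \<omega> P u v = \<omega> P u v"
        unfolding mean_def coeffwise_def by (subst c) (rule torus_conv_one_const)
    qed
    ultimately show ?case using mean_biforms[OF \<eta>(1), of ?e] pd_mean[OF \<eta>(1), of ?e] \<eta>(3)
      by (intro bexI[of _ "mean ?e \<eta>"]) simp_all
  qed
  then obtain \<eta> where \<eta>: "\<eta> \<in> biforms p' q" "\<And>i. lie (axis i 1) \<eta> = (\<lambda>P u v. 0)" "pd p' \<eta> = \<omega>"
    by blast
  show ?thesis using pd_parallel[OF parallelI[OF \<eta>(1,2)], of p'] \<eta>(3) by simp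
qed

section \<open>The Leibniz rule\<close>

lemma alternator_cong_fun: "(\<And>u. F u = G u) \<Longrightarrow> alternator N F u = alternator N G u"
  by (simp add: alternator_def)

lemma alternator_divide: "alternator N (\<lambda>u. F u / c) u = alternator N F u / c"
  by (simp add: alternator_def sum_divide_distrib)

lemma alternator_swap:
  "alternator N (\<lambda>u. alternator M (\<lambda>v. F u v) v) u = alternator M (\<lambda>v. alternator N (\<lambda>u. F u v) u) v"
  unfolding alternator_def sum_distrib_left by (subst sum.swap) (simp add: mult.left_commute)

lemma torus_smooth_alternator:
  "(\<And>u. torus_smooth (\<lambda>Q. f Q u)) \<Longrightarrow> torus_smooth (\<lambda>Q. alternator N (f Q) x)"
  unfolding alternator_def by (intro torus_smooth_sum torus_smooth_cmult)

lemma torus_deriv_alternator: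
  "(\<And>u. torus_smooth (\<lambda>Q. f Q u)) \<Longrightarrow>
    torus_deriv (\<lambda>Q. alternator N (f Q) x) P w = alternator N (\<lambda>u. torus_deriv (\<lambda>Q. f Q u) P w) x"
  unfolding alternator_def
  by (subst torus_deriv_sum) (auto simp: torus_smooth_cmult torus_deriv_cmult)

lemma multilin_product:
  assumes A: "multilin p A" and B: "multilin r B"
  shows "multilin (p + r) (\<lambda>u. A u * B (\<lambda>i. u (p + i)))"
  unfolding multilin_def
proof (intro conjI allI impI)
  fix u u' :: "nat \<Rightarrow> 'a" assume u: "\<forall>i<p + r. u i = u' i"
  have "A u = A u'" by (rule multilin_cong[OF A]) (use u in auto)
  moreover have "B (\<lambda>i. u (p + i)) = B (\<lambda>i. u' (p + i))" by (rule multilin_cong[OF B]) (use u in auto)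
  ultimately show "A u * B (\<lambda>i. u (p + i)) = A u' * B (\<lambda>i. u' (p + i))" by simp
next
  fix u :: "nat \<Rightarrow> 'a" and i assume i: "i < p + r"
  show "linear (\<lambda>w. A (u(i := w)) * B (\<lambda>k. (u(i := w)) (p + k)))"
  proof (cases "i < p")
    case True
    then have "(\<lambda>k. (u(i := w)) (p + k)) = (\<lambda>k. u (p + k))" for w by auto
    then show ?thesis
      using linear_cmult_real[OF multilin_linear[OF A True, of u], of "B (\<lambda>k. u (p + k))"]
      by (simp add: mult.commute)
  next
    case False
    have "A (u(i := w)) = A u" for w by (rule multilin_cong[OF A]) (use False in auto)
    moreover have "(\<lambda>k. (u(i := w)) (p + k)) = (\<lambda>k. u (p + k))(i - p := w)" for w
      using False by (auto simp: fun_eq_iff)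
    moreover have "i - p < r" using False i by auto
    ultimately show ?thesis using linear_cmult_real[OF multilin_linear[OF B, of "i - p"]] by simp
  qed
qed

lemma multilin_sum: "(\<And>i. i \<in> I \<Longrightarrow> multilin p (m i)) \<Longrightarrow> multilin p (\<lambda>u. \<Sum>i\<in>I. m i u)"
  by (induction I rule: infinite_finite_induct) (auto intro: multilin_add multilin_zero)

text \<open>
  The two kinds of arguments are alternated independently, so each of the two alternations can be treated with
  the other one as a parameter.
\<close>

lemma biwedge_eq_alternator:
  "biwedge p q p' q' \<omega> \<eta> P u v =
     alternator (q + q') (\<lambda>v. alternator (p + p') (\<lambda>u. \<omega> P u v * \<eta> P (\<lambda>i. u (p + i)) (\<lambda>j. v (q + j))) u) v
       / (fact p * fact p' * (fact q * fact q'))"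
  unfolding biwedge_def alternator_def sum_distrib_left
  by (subst sum.swap) (simp add: mult_ac)

lemma biwedge_biforms:
  assumes \<omega>: "\<omega> \<in> biforms p q" and \<eta>: "\<eta> \<in> biforms p' q'"
  shows "biwedge p q p' q' \<omega> \<eta> \<in> biforms (p + p') (q + q')"
proof (rule biformsI)
  have div: "x / y = (1 / y) * x" for x y :: real by simp
  fix P u
  have "multilin (q + q') (\<lambda>v. alternator (p + p') (\<lambda>u. \<omega> P u v * \<eta> P (\<lambda>i. u (p + i)) (\<lambda>j. v (q + j))) u)"
    unfolding alternator_def
    by (intro multilin_sum multilin_cmult multilin_product[where A = "\<omega> P u" and B = "\<eta> P w" for u w]
        alt_map_multilin biforms_alt2[OF \<omega>] biforms_alt2[OF \<eta>])
  then show "alt_map (q + q') (biwedge p q p' q' \<omega> \<eta> P u)"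
    unfolding biwedge_eq_alternator[abs_def] by (subst div) (intro alt_map_cmult alternator_alt_map)
next
  have div: "x / y = (1 / y) * x" for x y :: real by simp
  fix P v
  have "alt_map (p + p') (\<lambda>u. alternator (p + p') (\<lambda>u. \<omega> P u v * \<eta> P (\<lambda>i. u (p + i)) (\<lambda>j. v (q + j))) u)" for v
    by (intro alternator_alt_map multilin_product[where A = "\<lambda>u. \<omega> P u w" and B = "\<lambda>u. \<eta> P u w'" for w w']
        alt_map_multilin biforms_alt1[OF \<omega>] biforms_alt1[OF \<eta>])
  then show "alt_map (p + p') (\<lambda>u. biwedge p q p' q' \<omega> \<eta> P u v)"
    unfolding biwedge_eq_alternator alternator_def[of "q + q'"]
    by (subst div) (intro alt_map_cmult alt_map_sum)
next
  have div: "x / y = (1 / y) * x" for x y :: real by simp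
  fix u v
  show "torus_smooth (\<lambda>P. biwedge p q p' q' \<omega> \<eta> P u v)"
    unfolding biwedge_eq_alternator
    by (subst div) (intro torus_smooth_cmult torus_smooth_alternator torus_smooth_mult
        biforms_smooth[OF \<omega>] biforms_smooth[OF \<eta>])
qed

text \<open>
  The cycle that makes position \<open>p\<close> read the first argument and shifts the earlier positions up.  Its sign is the
  \<open>(-1)\<^sup>p\<close> of the Leibniz rule.
\<close>

definition front_cycle :: "nat \<Rightarrow> nat \<Rightarrow> nat" where
  "front_cycle p i = (if i < p then Suc i else if i = p then 0 else i)"

lemma front_cycle_permutes: "p < N \<Longrightarrow> front_cycle p permutes {..<N}"
proof -
  assume "p < N"
  have "\<exists>!x. front_cycle p x = y" for y
  proof -
    consider "y = 0" | "0 < y" "y \<le> p" | "p < y" by linarith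
    then show ?thesis
    proof cases
      case 1
      then show ?thesis by (intro ex1I[of _ p]) (auto simp: front_cycle_def split: if_splits)
    next
      case 2
      then show ?thesis by (intro ex1I[of _ "y - 1"]) (auto simp: front_cycle_def split: if_splits)
    next
      case 3
      then show ?thesis by (intro ex1I[of _ y]) (auto simp: front_cycle_def split: if_splits)
    qed
  qed
  with \<open>p < N\<close> show ?thesis by (auto simp: permutes_def front_cycle_def)
qed

text \<open>
  Both sides are alternations over \<open>p + p' + 1\<close> arguments of products of coefficients.  On the left the
  alternation hidden in the wedge product is absorbed into the outer one, and the product rule gives two summands.
  On the right the alternation hidden in \<open>\<partial>\<omega>\<close>, respectively \<open>\<partial>\<eta>\<close>, is absorbed.  The first summands then
  coincide, and the second ones differ by moving the differentiating vector past the \<open>p\<close> arguments of \<open>\<omega>\<close>.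
\<close>

theorem leibniz:
  assumes \<omega>: "\<omega> \<in> biforms p q" and \<eta>: "\<eta> \<in> biforms p' q'"
  shows "pd (p + p') (biwedge p q p' q' \<omega> \<eta>) = (\<lambda>P u v.
     biwedge (Suc p) q p' q' (pd p \<omega>) \<eta> P u v + of_int (sign (front_cycle p)) * biwedge p q (Suc p') q' \<omega> (pd p' \<eta>) P u v)"
proof (intro ext)
  fix P u v
  define N where "N = p + p'"
  define C :: real where "C = fact p * fact p' * (fact q * fact q')"
  define G where "G v x = torus_deriv (\<lambda>Q. \<omega> Q (\<lambda>i. x (Suc i)) v) P (x 0)" for v and x :: "nat \<Rightarrow> real ^ 'a"
  define H where "H v x = torus_deriv (\<lambda>Q. \<eta> Q (\<lambda>i. x (Suc i)) v) P (x 0)" for v and x :: "nat \<Rightarrow> real ^ 'a"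
  define sh where "sh v = (\<lambda>j. v (q + j))" for v :: "nat \<Rightarrow> real ^ 'a"
  define F1 where "F1 v x = G v x * \<eta> P (\<lambda>i. x (Suc p + i)) (sh v)" for v x
  \<comment> \<open>\<open>F\<close> is the derivative of the product, \<open>F1\<close> its first summand; the second one becomes \<open>W\<close> after the cycle.\<close>
  define W where "W v x = \<omega> P x v * H (sh v) (\<lambda>i. x (p + i))" for v x
  define F where "F v x = torus_deriv (\<lambda>Q. \<omega> Q (\<lambda>i. x (Suc i)) v * \<eta> Q (\<lambda>i. x (Suc (p + i))) (sh v)) P (x 0)"
    for v and x :: "nat \<Rightarrow> real ^ 'a"
  note sm = biforms_smooth[OF \<omega>] biforms_smooth[OF \<eta>]
  have pdG: "pd p \<omega> P x w = alternator (Suc p) (G w) x / fact p" for x w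
    by (simp add: pd_eq_alternator G_def[abs_def])
  have pdH: "pd p' \<eta> P x w = alternator (Suc p') (H w) x / fact p'" for x w
    by (simp add: pd_eq_alternator H_def[abs_def])
  have F: "F v x = F1 v x + W v (\<lambda>i. x (front_cycle p i))" for v x
  proof -
    have "\<omega> P (\<lambda>i. x (Suc i)) v = \<omega> P (\<lambda>i. x (front_cycle p i)) v"
      by (rule alt_map_cong[OF biforms_alt1[OF \<omega>]]) (simp add: front_cycle_def)
    then show ?thesis
      by (simp add: F_def torus_deriv_mult sm F1_def G_def W_def H_def front_cycle_def)
  qed
  have alt_F: "alternator (Suc N) (F v) x = alternator (Suc N) (F1 v) x + of_int (sign (front_cycle p)) * alternator (Suc N) (W v) x" for v x
    unfolding F alternator_add[of "Suc N" "F1 v", symmetric]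
    by (subst alternator_permute[OF front_cycle_permutes, symmetric]) (simp_all add: N_def alternator_add F)
  have deriv: "torus_deriv (\<lambda>Q. biwedge p q p' q' \<omega> \<eta> Q (\<lambda>i. x (Suc i)) v) P (x 0)
     = (1 / C) * alternator (q + q') (\<lambda>v. alternator N (\<lambda>y. F v (case_nat (x 0) y)) (\<lambda>i. x (Suc i))) v" for x v
  proof -
    have div: "a / b = (1 / b) * a" for a b :: real by simp
    show ?thesis
      unfolding biwedge_eq_alternator C_def[symmetric] N_def[symmetric] F_def sh_def
      by (subst div, subst torus_deriv_cmult, intro torus_smooth_alternator torus_smooth_mult sm,
          (subst torus_deriv_alternator, intro torus_smooth_alternator torus_smooth_mult sm)+)
         (simp add: N_def)
  qed
  have inner: "alternator (Suc N) (\<lambda>x. alternator N (\<lambda>y. F v (case_nat (x 0) y)) (\<lambda>i. x (Suc i))) u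
     = fact N * alternator (Suc N) (F v) u" for v
  proof -
    have "case_nat (x 0) (\<lambda>i. x (Suc (\<rho> i))) = (\<lambda>i. if i < 1 then x i else x (1 + \<rho> (i - 1)))"
      for x :: "nat \<Rightarrow> real ^ 'a" and \<rho>
      by (auto simp: fun_eq_iff split: nat.split)
    then show ?thesis
      using alternator_inner[of 1 N "F v" u] by (simp add: alternator_def[of N])
  qed
  have "pd (p + p') (biwedge p q p' q' \<omega> \<eta>) P u v =
    alternator (Suc N) (\<lambda>x. (1 / C) * alternator (q + q') (\<lambda>v. alternator N (\<lambda>y. F v (case_nat (x 0) y)) (\<lambda>i. x (Suc i))) v) u / fact N"
    by (simp only: pd_eq_alternator deriv N_def)
  also have "\<dots> = (1 / C) * alternator (q + q') (\<lambda>v. fact N * alternator (Suc N) (F v) u) v / fact N"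
    by (simp only: alternator_cmult alternator_swap[of "Suc N"] inner)
  also have "\<dots> = alternator (q + q') (\<lambda>v. alternator (Suc N) (F v) u) v / C"
    by (simp add: alternator_cmult)
  also have "\<dots> = alternator (q + q') (\<lambda>v. alternator (Suc N) (F1 v) u) v / C
      + of_int (sign (front_cycle p)) * (alternator (q + q') (\<lambda>v. alternator (Suc N) (W v) u) v / C)"
    by (simp add: alt_F alternator_add alternator_cmult add_divide_distrib)
  also have "alternator (q + q') (\<lambda>v. alternator (Suc N) (F1 v) u) v / C
      = biwedge (Suc p) q p' q' (pd p \<omega>) \<eta> P u v"
  proof -
    have "alternator (Suc p + p') (\<lambda>u. pd p \<omega> P u v * \<eta> P (\<lambda>i. u (Suc p + i)) (\<lambda>j. v (q + j))) u
      = (fact (Suc p) / fact p) * alternator (Suc N) (F1 v) u" for v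
      using alternator_alternator_left[of "Suc p" p' "G v" "\<lambda>x. \<eta> P x (sh v)" u]
      by (simp add: pdG alternator_divide F1_def[abs_def] sh_def N_def)
    then show ?thesis
      by (simp only: biwedge_eq_alternator alternator_cmult) (simp add: C_def field_simps del: fact_Suc)
  qed
  also have "alternator (q + q') (\<lambda>v. alternator (Suc N) (W v) u) v / C
      = biwedge p q (Suc p') q' \<omega> (pd p' \<eta>) P u v"
  proof -
    have "alternator (p + Suc p') (\<lambda>u. \<omega> P u v * pd p' \<eta> P (\<lambda>i. u (p + i)) (\<lambda>j. v (q + j))) u
      = (fact (Suc p') / fact p') * alternator (Suc N) (W v) u" for v
    proof -
      have "alternator (p + Suc p') (\<lambda>u. \<omega> P u v * alternator (Suc p') (H (sh v)) (\<lambda>i. u (p + i))) u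
        = fact (Suc p') * alternator (p + Suc p') (W v) u"
        unfolding W_def[abs_def]
        by (rule alternator_alternator_right) (rule alt_map_cong[OF biforms_alt1[OF \<omega>]])
      then show ?thesis
        by (simp add: pdH alternator_divide sh_def N_def)
    qed
    then show ?thesis
      by (simp only: biwedge_eq_alternator alternator_cmult) (simp add: C_def field_simps del: fact_Suc)
  qed
  finally show "pd (p + p') (biwedge p q p' q' \<omega> \<eta>) P u v =
     biwedge (Suc p) q p' q' (pd p \<omega>) \<eta> P u v + of_int (sign (front_cycle p)) * biwedge p q (Suc p') q' \<omega> (pd p' \<eta>) P u v" .
qed


lemma biwedge_add_left:
  "biwedge p q p' q' (\<lambda>P u v. \<omega> P u v + \<omega>' P u v) \<eta> =
    (\<lambda>P u v. biwedge p q p' q' \<omega> \<eta> P u v + biwedge p q p' q' \<omega>' \<eta> P u v)"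
  by (simp add: biwedge_def fun_eq_iff sum.distrib distrib_left distrib_right add_divide_distrib)

lemma biwedge_add_right:
  "biwedge p q p' q' \<omega> (\<lambda>P u v. \<eta> P u v + \<eta>' P u v) =
    (\<lambda>P u v. biwedge p q p' q' \<omega> \<eta> P u v + biwedge p q p' q' \<omega> \<eta>' P u v)"
  by (simp add: biwedge_def fun_eq_iff sum.distrib distrib_left add_divide_distrib)

lemma biwedge_cmult_left:
  "biwedge p q p' q' (\<lambda>P u v. c * \<omega> P u v) \<eta> = (\<lambda>P u v. c * biwedge p q p' q' \<omega> \<eta> P u v)"
  by (simp add: biwedge_eq_alternator fun_eq_iff alternator_cmult mult.assoc)

lemma biwedge_cmult_right:
  "biwedge p q p' q' \<omega> (\<lambda>P u v. c * \<eta> P u v) = (\<lambda>P u v. c * biwedge p q p' q' \<omega> \<eta> P u v)"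
  by (simp add: biwedge_eq_alternator fun_eq_iff alternator_cmult mult.left_commute)

lemma biwedge_zero_left: "biwedge p q p' q' (\<lambda>P u v. 0) \<eta> = (\<lambda>P u v. 0)"
  and biwedge_zero_right: "biwedge p q p' q' \<omega> (\<lambda>P u v. 0) = (\<lambda>P u v. 0)"
  by (simp_all add: biwedge_def fun_eq_iff)

lemma biwedge_sum_left:
  "biwedge p q p' q' (\<lambda>P u v. \<Sum>i\<in>I. \<omega> i P u v) \<eta> = (\<lambda>P u v. \<Sum>i\<in>I. biwedge p q p' q' (\<omega> i) \<eta> P u v)"
  by (induction I rule: infinite_finite_induct) (simp_all add: biwedge_zero_left biwedge_add_left)

lemma biwedge_sum_right:
  "biwedge p q p' q' \<omega> (\<lambda>P u v. \<Sum>i\<in>I. \<eta> i P u v) = (\<lambda>P u v. \<Sum>i\<in>I. biwedge p q p' q' \<omega> (\<eta> i) P u v)"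
  by (induction I rule: infinite_finite_induct) (simp_all add: biwedge_zero_right biwedge_add_right)

section \<open>Cohomology groups and cup products\<close>

lemma biwedge_closed:
  assumes "\<omega> \<in> closed_biforms p q" "\<eta> \<in> closed_biforms p' q'"
  shows "biwedge p q p' q' \<omega> \<eta> \<in> closed_biforms (p + p') (q + q')"
  using assms leibniz[OF assms[THEN closed_biformsD(1)]]
  by (intro closed_biformsI biwedge_biforms) (auto simp: closed_biforms_def biwedge_zero_left biwedge_zero_right)

lemma biwedge_exact_left:
  assumes "\<omega> \<in> exact_biforms p q" "\<eta> \<in> closed_biforms p' q'"
  shows "biwedge p q p' q' \<omega> \<eta> \<in> exact_biforms (p + p') (q + q')"
proof (cases p)
  case 0
  then show ?thesis using assms exact_zero by (simp add: exact_biforms_0 biwedge_zero_left)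
next
  case (Suc k)
  then obtain \<alpha> where \<alpha>: "\<alpha> \<in> biforms k q" "\<omega> = pd k \<alpha>"
    using assms by (auto simp: exact_biforms_Suc)
  have "biwedge p q p' q' \<omega> \<eta> = pd (k + p') (biwedge k q p' q' \<alpha> \<eta>)"
    using leibniz[OF \<alpha>(1) closed_biformsD(1)[OF assms(2)]] closed_biformsD(2)[OF assms(2)]
    by (simp add: \<alpha>(2) Suc biwedge_zero_right)
  then show ?thesis
    using biwedge_biforms[OF \<alpha>(1) closed_biformsD(1)[OF assms(2)]] by (simp add: Suc exact_biforms_Suc)
qed

lemma biwedge_exact_right:
  assumes "\<omega> \<in> closed_biforms p q" "\<eta> \<in> exact_biforms p' q'"
  shows "biwedge p q p' q' \<omega> \<eta> \<in> exact_biforms (p + p') (q + q')"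
proof (cases p')
  case 0
  then show ?thesis using assms exact_zero by (simp add: exact_biforms_0 biwedge_zero_right)
next
  case (Suc k)
  then obtain \<alpha> where \<alpha>: "\<alpha> \<in> biforms k q'" "\<eta> = pd k \<alpha>"
    using assms by (auto simp: exact_biforms_Suc)
  define s :: real where "s = of_int (sign (front_cycle p))"
  have "pd (p + k) (biwedge p q k q' \<omega> \<alpha>) = (\<lambda>P u v. s * biwedge p q p' q' \<omega> \<eta> P u v)"
    using leibniz[OF closed_biformsD(1)[OF assms(1)] \<alpha>(1)] closed_biformsD(2)[OF assms(1)]
    by (simp add: \<alpha>(2) Suc biwedge_zero_left s_def)
  then have "(\<lambda>P u v. s * biwedge p q p' q' \<omega> \<eta> P u v) \<in> exact_biforms (p + p') (q + q')"
    using biwedge_biforms[OF closed_biformsD(1)[OF assms(1)] \<alpha>(1)] by (simp add: Suc exact_biforms_Suc image_iff) metis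
  \<comment> \<open>The Leibniz rule gives the product only up to the sign \<open>s\<close>, which is its own inverse.\<close>
  from exact_cmult[OF this, of s] show ?thesis
    by (simp add: s_def mult.assoc[symmetric])
qed

abbreviation closed_group :: "nat \<Rightarrow> nat \<Rightarrow> 'n::finite biform monoid" where
  "closed_group p q \<equiv> (biform_group p q)\<lparr>carrier := closed_biforms p q\<rparr>"

lemma closed_group_comm: "comm_group (closed_group p q)"
proof (rule comm_groupI)
  fix \<omega> :: "'a biform" assume "\<omega> \<in> carrier (closed_group p q)"
  then show "\<exists>\<eta>\<in>carrier (closed_group p q). \<eta> \<otimes>\<^bsub>closed_group p q\<^esub> \<omega> = \<one>\<^bsub>closed_group p q\<^esub>"
    by (intro bexI[of _ "\<lambda>P u v. -1 * \<omega> P u v"])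
       (use closed_cmult[of \<omega> p q "-1"] in \<open>auto simp: biform_group_def\<close>)
qed (auto simp: biform_group_def closed_add closed_zero add_ac)

lemma exact_subgroup: "subgroup (exact_biforms p q) (closed_group p q)"
proof -
  interpret comm_group "closed_group p q" by (rule closed_group_comm)
  show ?thesis
  proof (rule subgroupI)
    show "exact_biforms p q \<subseteq> carrier (closed_group p q)"
      using exact_subset_closed by simp
    show "exact_biforms p q \<noteq> {}" using exact_zero by blast
    fix \<omega> :: "'a biform" assume \<omega>: "\<omega> \<in> exact_biforms p q"
    have "inv\<^bsub>closed_group p q\<^esub> \<omega> = (\<lambda>P u v. -1 * \<omega> P u v)"
      by (rule inv_equality) (use \<omega> exact_subset_closed exact_cmult[OF \<omega>, of "-1"] in \<open>auto simp: biform_group_def\<close>)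
    then show "inv\<^bsub>closed_group p q\<^esub> \<omega> \<in> exact_biforms p q"
      using exact_cmult[OF \<omega>, of "-1"] by simp
    fix \<eta> :: "'a biform" assume "\<eta> \<in> exact_biforms p q"
    then show "\<omega> \<otimes>\<^bsub>closed_group p q\<^esub> \<eta> \<in> exact_biforms p q"
      using exact_add[OF \<omega>] by (simp add: biform_group_def)
  qed
qed

lemma DK_comm_group: "comm_group (DK p q)"
  unfolding DK_def by (intro comm_group.abelian_FactGroup closed_group_comm exact_subgroup)

lemma dk_class_eq_coset: "dk_class p q \<omega> = exact_biforms p q #>\<^bsub>closed_group p q\<^esub> \<omega>"
  by (simp add: dk_class_def r_coset_def)

lemma carrier_DK: "carrier (DK p q) = dk_class p q ` closed_biforms p q"
  by (simp add: DK_def carrier_FactGroup dk_class_eq_coset)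

lemma dk_class_in_carrier: "\<omega> \<in> closed_biforms p q \<Longrightarrow> dk_class p q \<omega> \<in> carrier (DK p q)"
  by (simp add: carrier_DK)

lemma dk_class_eq: "dk_class p q \<omega> = (\<lambda>\<beta> P u v. \<beta> P u v + \<omega> P u v) ` exact_biforms p q"
  by (auto simp: dk_class_def r_coset_def biform_group_def)

lemma dk_class_eq_iff:
  fixes \<omega> \<eta> :: "'n::finite biform"
  shows "dk_class p q \<omega> = dk_class p q \<eta> \<longleftrightarrow> (\<lambda>P u v. \<omega> P u v + -1 * \<eta> P u v) \<in> exact_biforms p q"
proof
  assume "dk_class p q \<omega> = dk_class p q \<eta>"
  moreover have "\<omega> \<in> dk_class p q \<omega>"
    unfolding dk_class_eq by (rule image_eqI[OF _ exact_zero]) simp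
  ultimately obtain \<beta> where "\<beta> \<in> exact_biforms p q" "\<omega> = (\<lambda>P u v. \<beta> P u v + \<eta> P u v)"
    unfolding dk_class_eq by auto
  then show "(\<lambda>P u v. \<omega> P u v + -1 * \<eta> P u v) \<in> exact_biforms p q" by simp
next
  have sub: "dk_class p q \<omega> \<subseteq> dk_class p q \<eta>"
    if d: "(\<lambda>P u v. \<omega> P u v + -1 * \<eta> P u v) \<in> exact_biforms p q" for \<omega> \<eta> :: "'n biform"
    unfolding dk_class_eq
  proof safe
    fix \<beta> :: "'n biform" assume "\<beta> \<in> exact_biforms p q"
    from exact_add[OF this d]
    show "(\<lambda>P u v. \<beta> P u v + \<omega> P u v) \<in> (\<lambda>\<beta> P u v. \<beta> P u v + \<eta> P u v) ` exact_biforms p q"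
      by (rule image_eqI[rotated]) simp
  qed
  assume d: "(\<lambda>P u v. \<omega> P u v + -1 * \<eta> P u v) \<in> exact_biforms p q"
  from exact_cmult[OF this, of "-1"] have "(\<lambda>P u v. \<eta> P u v + -1 * \<omega> P u v) \<in> exact_biforms p q"
    by simp
  with d show "dk_class p q \<omega> = dk_class p q \<eta>" using sub by blast
qed

lemma DK_mult_class:
  assumes "\<omega> \<in> closed_biforms p q" "\<eta> \<in> closed_biforms p q"
  shows "dk_class p q \<omega> \<otimes>\<^bsub>DK p q\<^esub> dk_class p q \<eta> = dk_class p q (\<lambda>P u v. \<omega> P u v + \<eta> P u v)"
proof -
  have "exact_biforms p q \<lhd> closed_group p q"
    by (rule comm_group.subgroup_imp_normal[OF closed_group_comm exact_subgroup])
  from normal.rcos_sum[OF this, of \<omega> \<eta>] assms show ?thesis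
    by (simp add: DK_def dk_class_eq_coset) (simp add: biform_group_def)
qed

lemma DK_one_class: "\<one>\<^bsub>DK p q\<^esub> = dk_class p q (\<lambda>P u v. 0)"
  by (simp add: DK_def dk_class_eq)

lemma closed_sum: "(\<And>i. i \<in> I \<Longrightarrow> \<omega> i \<in> closed_biforms p q) \<Longrightarrow> (\<lambda>P u v. \<Sum>i\<in>I. \<omega> i P u v) \<in> closed_biforms p q"
  by (induction I rule: infinite_finite_induct) (auto simp: closed_zero intro: closed_add)

lemma DK_finprod_class:
  assumes "finite I" "\<And>i. i \<in> I \<Longrightarrow> \<omega> i \<in> closed_biforms p q"
  shows "finprod (DK p q) (\<lambda>i. dk_class p q (\<omega> i)) I = dk_class p q (\<lambda>P u v. \<Sum>i\<in>I. \<omega> i P u v)"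
proof -
  interpret comm_group "DK p q" by (rule DK_comm_group)
  show ?thesis using assms
    by (induction I rule: finite_induct) (auto simp: DK_one_class dk_class_in_carrier DK_mult_class closed_sum Pi_def)
qed

text \<open>
  The union over all representatives in the definition of the cup product is a single class because, by the
  Leibniz rule, exact forms are an ideal in the closed ones.
\<close>

lemma dk_cup_class:
  assumes \<omega>: "\<omega> \<in> closed_biforms p q" and \<eta>: "\<eta> \<in> closed_biforms p' q'"
  shows "dk_cup p q p' q' (dk_class p q \<omega>) (dk_class p' q' \<eta>) =
    dk_class (p + p') (q + q') (biwedge p q p' q' \<omega> \<eta>)"
proof -
  have *: "dk_class (p + p') (q + q') (biwedge p q p' q' \<omega>' \<eta>') = dk_class (p + p') (q + q') (biwedge p q p' q' \<omega> \<eta>)"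
    if d: "\<omega>' \<in> dk_class p q \<omega>" "\<eta>' \<in> dk_class p' q' \<eta>" for \<omega>' \<eta>'
  proof -
    obtain \<alpha> \<beta> where \<alpha>: "\<alpha> \<in> exact_biforms p q" "\<omega>' = (\<lambda>P u v. \<alpha> P u v + \<omega> P u v)"
      and \<beta>: "\<beta> \<in> exact_biforms p' q'" "\<eta>' = (\<lambda>P u v. \<beta> P u v + \<eta> P u v)"
      using d unfolding dk_class_eq by blast
    have "\<alpha> \<in> closed_biforms p q" using \<alpha>(1) exact_subset_closed by blast
    then have \<omega>': "\<omega>' \<in> closed_biforms p q" unfolding \<alpha>(2) by (rule closed_add) (rule \<omega>)
    have "(\<lambda>P u v. biwedge p q p' q' \<omega>' \<beta> P u v + biwedge p q p' q' \<alpha> \<eta> P u v) \<in> exact_biforms (p + p') (q + q')"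
      by (intro exact_add biwedge_exact_left[OF \<alpha>(1) \<eta>] biwedge_exact_right[OF \<omega>' \<beta>(1)])
    then show ?thesis
      unfolding dk_class_eq_iff \<beta>(2) biwedge_add_right \<alpha>(2) biwedge_add_left by (simp add: algebra_simps)
  qed
  have "\<omega> \<in> dk_class p q \<omega>" for \<omega> :: "'a biform" and p q
    unfolding dk_class_eq by (rule image_eqI[OF _ exact_zero]) simp
  then have "dk_class p q \<omega> \<noteq> {}" "dk_class p' q' \<eta> \<noteq> {}" by blast+
  then show ?thesis unfolding dk_cup_def using * by auto
qed

lemma dk_sum_group: "Group.group (case pq of (p, q) \<Rightarrow> DK p q)"
  by (cases pq) (simp add: comm_group.axioms(2)[OF DK_comm_group])

lemma carrier_dk_sum:
  "carrier dk_sum = {c. (\<forall>p q. c (p, q) \<in> carrier (DK p q)) \<and> finite {(p, q). c (p, q) \<noteq> \<one>\<^bsub>DK p q\<^esub>}}"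
proof -
  have eq: "{i \<in> UNIV. c i \<noteq> \<one>\<^bsub>case i of (p, q) \<Rightarrow> DK p q\<^esub>} = {(p, q). c (p, q) \<noteq> \<one>\<^bsub>DK p q\<^esub>}" for c
    by auto
  show ?thesis
    unfolding dk_sum_def carrier_sum_group[OF dk_sum_group] eq PiE_UNIV_domain by (auto simp: Pi_def)
qed

lemma one_dk_sum: "\<one>\<^bsub>dk_sum\<^esub> = (\<lambda>(p, q). dk_class p q (\<lambda>P u v. 0))"
  by (auto simp: dk_sum_def DK_one_class fun_eq_iff)

lemma mult_dk_sum: "c \<otimes>\<^bsub>dk_sum\<^esub> d = (\<lambda>(p, q). c (p, q) \<otimes>\<^bsub>DK p q\<^esub> d (p, q))"
  by (auto simp: dk_sum_def fun_eq_iff)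

section \<open>Parallel forms are spanned by words in the generators\<close>

text \<open>
  The letters \<open>a\<^sup>i\<close> of a word, in their order; \<open>rights\<close> collects the letters \<open>b\<^sup>i\<close>.  As the two kinds commute,
  these two lists determine the class of the word.
\<close>

fun lefts :: "('a + 'b) list \<Rightarrow> 'a list" where
  "lefts [] = []" | "lefts (Inl i # w) = i # lefts w" | "lefts (Inr i # w) = lefts w"

fun rights :: "('a + 'b) list \<Rightarrow> 'b list" where
  "rights [] = []" | "rights (Inl i # w) = rights w" | "rights (Inr i # w) = i # rights w"

lemma lefts_append: "lefts (w @ w') = lefts w @ lefts w'"
  by (induction w rule: lefts.induct) auto

lemma rights_append: "rights (w @ w') = rights w @ rights w'"
  by (induction w rule: rights.induct) auto

lemma lefts_rights_map [simp]:
  "lefts (map Inl I) = I" "rights (map Inl I) = []" "lefts (map Inr I) = []" "rights (map Inr I) = I"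
  by (induction I) auto

lemma length_lefts_rights: "length (lefts w) + length (rights w) = length w"
  by (induction w rule: lefts.induct) auto

lemma set_lefts: "set (lefts w) = {i. Inl i \<in> set w}"
  by (induction w rule: lefts.induct) auto

lemma set_rights: "set (rights w) = {i. Inr i \<in> set w}"
  by (induction w rule: rights.induct) auto

lemma distinct_lefts: "distinct w \<Longrightarrow> distinct (lefts w)"
  by (induction w rule: lefts.induct) (auto simp: set_lefts)

lemma distinct_rights: "distinct w \<Longrightarrow> distinct (rights w)"
  by (induction w rule: rights.induct) (auto simp: set_rights)

lemma set_eq_lefts_rights:
  "set (lefts w) = set (lefts w') \<Longrightarrow> set (rights w) = set (rights w') \<Longrightarrow> set w = set w'"
  by (auto simp: set_lefts set_rights set_eq_iff) (metis sum.exhaust)+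

definition coords :: "'n list \<Rightarrow> (nat \<Rightarrow> real ^ 'n) \<Rightarrow> real" where
  "coords I u = (\<Prod>k<length I. u k $ (I ! k))"

definition frame :: "'n list \<Rightarrow> nat \<Rightarrow> real ^ 'n" where
  "frame I k = axis (I ! k) 1"

text \<open>
  The wedge product of the coordinate forms with the listed indices, expanded as a determinant.
\<close>

definition dxs :: "'n::finite list \<Rightarrow> 'n form" where
  "dxs I = (\<lambda>P. alternator (length I) (coords I))"

lemma prod_lessThan_add: "(\<Prod>k<p + r. f k) = (\<Prod>k<p. f k) * (\<Prod>k<r. f (p + k :: nat) :: real)"
  by (induction r) (auto simp: mult.assoc)

lemma coords_append: "coords (I @ J) u = coords I u * coords J (\<lambda>i. u (length I + i))"
  by (simp add: coords_def prod_lessThan_add nth_append)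

lemma coords_cong: "(\<And>i. i < length I \<Longrightarrow> u i = u' i) \<Longrightarrow> coords I u = coords I u'"
  by (simp add: coords_def)

lemma linear_vec_nth: "linear (\<lambda>w. w $ i)"
  by (simp add: linear_iff)

lemma multilin_coords: "multilin (length I) (coords I :: (nat \<Rightarrow> real ^ 'n) \<Rightarrow> real)"
  unfolding multilin_def
proof (intro conjI allI impI)
  fix u u' :: "nat \<Rightarrow> real ^ 'n" assume "\<forall>i<length I. u i = u' i"
  then show "coords I u = coords I u'" by (intro coords_cong) blast
next
  fix u :: "nat \<Rightarrow> real ^ 'n" and i assume i: "i < length I"
  have "coords I (u(i := w)) = (\<Prod>k\<in>{..<length I} - {i}. u k $ (I ! k)) * w $ (I ! i)" for w
    unfolding coords_def using i by (subst prod.remove[of _ i]) (auto intro: prod.cong)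
  then show "linear (\<lambda>w. coords I (u(i := w)))"
    by (simp add: linear_cmult_real linear_vec_nth)
qed

lemma alt_map_dxs: "alt_map (length I) (dxs I P)"
  unfolding dxs_def by (rule alternator_alt_map[OF multilin_coords])

text \<open>
  Both factors are alternations over blocks of arguments, which the alternation in the wedge product absorbs.
  Since concatenation of lists is associative, this takes the place of associativity of the wedge product.
\<close>

lemma wedge_dxs: "wedge (length I) (length J) (dxs I) (dxs J) = dxs (I @ J)"
proof (intro ext)
  fix P :: "'a torus" and u :: "nat \<Rightarrow> real ^ 'a"
  let ?p = "length I" and ?r = "length J"
  have "alternator (?p + ?r) (\<lambda>u. dxs I P u * dxs J P (\<lambda>i. u (?p + i))) u
    = fact ?p * (fact ?r * alternator (?p + ?r) (\<lambda>u. coords I u * coords J (\<lambda>i. u (?p + i))) u)"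
    unfolding dxs_def by (subst alternator_alternator_left, subst alternator_alternator_right) (auto intro: coords_cong)
  then show "wedge ?p ?r (dxs I) (dxs J) P u = dxs (I @ J) P u"
    by (simp add: wedge_def alternator_def[symmetric] dxs_def coords_append[abs_def])
       (simp add: alternator_def)
qed

text \<open>
  The value of a word: the product of its letters read as coordinate forms.
\<close>

definition word_form :: "('n::finite + 'n) list \<Rightarrow> 'n biform" where
  "word_form w = tensor (dxs (lefts w)) (dxs (rights w))"

lemma word_form_append:
  "biwedge (length (lefts w)) (length (rights w)) (length (lefts w')) (length (rights w')) (word_form w) (word_form w') = word_form (w @ w')"
  by (simp add: word_form_def biwedge_tensor wedge_dxs lefts_append rights_append)

lemma word_form_biforms: "word_form w \<in> biforms (length (lefts w)) (length (rights w))"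
proof (rule biformsI)
  fix P :: "'a torus" and v
  show "alt_map (length (lefts w)) (\<lambda>u. word_form w P u v)"
    using alt_map_cmult[OF alt_map_dxs, where c = "dxs (rights w) P v"] by (simp add: word_form_def tensor_def mult.commute)
next
  fix P :: "'a torus" and u
  show "alt_map (length (rights w)) (word_form w P u)"
    using alt_map_cmult[OF alt_map_dxs, where c = "dxs (lefts w) P u"] by (simp add: word_form_def tensor_def[abs_def])
next
  fix u v
  show "torus_smooth (\<lambda>P. word_form w P u v)" by (simp add: word_form_def tensor_def dxs_def)
qed

lemma word_form_parallel: "parallel_biform (word_form w)"
  by (simp add: parallel_biform_def word_form_def tensor_def dxs_def)

lemma word_form_closed: "word_form w \<in> closed_biforms (length (lefts w)) (length (rights w))"
  by (intro closed_biformsI word_form_biforms pd_parallel word_form_parallel)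

lemma dxs_Nil: "dxs [] P u = 1"
  by (simp add: dxs_def alternator_def coords_def sign_id)

lemma dxs_single: "dxs [i] P u = u 0 $ i"
proof -
  have "{\<sigma>. \<sigma> permutes {..<Suc 0}} = {id}" by (auto simp: lessThan_Suc)
  then show ?thesis by (simp add: dxs_def alternator_def coords_def sign_id)
qed

lemma dxs_swap: "dxs [j, i] P u = - dxs [i, j] P u"
proof -
  have t: "Transposition.transpose 0 1 permutes {..<2::nat}" by (rule permutes_swap_id) auto
  have "coords [j, i] = (\<lambda>u. coords [i, j] (\<lambda>k. u (Transposition.transpose 0 1 k)))"
    by (rule ext) (simp add: coords_def numeral_2_eq_2 lessThan_Suc)
  then have "alternator 2 (coords [j, i]) u = of_int (sign (Transposition.transpose 0 (1::nat))) * alternator 2 (coords [i, j]) u"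
    by (simp only: alternator_permute[OF t])
  then show ?thesis by (simp add: dxs_def sign_swap_id numeral_2_eq_2)
qed

lemma dxs_repeat: "dxs [i, i] P u = 0"
  using dxs_swap[of i i P u] by simp

lemma word_form_Nil: "(\<lambda>P u v. r * word_form [] P u v) = tensor (const_form r) (const_form 1)"
  by (simp add: word_form_def tensor_def dxs_Nil const_form_def)

lemma word_form_Inl: "word_form [Inl i] = tensor (dx i) (const_form 1)"
  by (simp add: word_form_def tensor_def dxs_Nil dxs_single const_form_def dx_def)

lemma word_form_Inr: "word_form [Inr i] = tensor (const_form 1) (dx i)"
  by (simp add: word_form_def tensor_def dxs_Nil dxs_single const_form_def dx_def)

lemma word_form_commute: "word_form [g, h] = (\<lambda>P u v. gen_sign g h * word_form [h, g] P u v)"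
proof (intro ext)
  fix P u v
  show "word_form [g, h] P u v = gen_sign g h * word_form [h, g] P u v"
  proof (cases g)
    case (Inl a)
    then show ?thesis using dxs_swap[of a _ P u]
      by (cases h) (simp_all add: word_form_def tensor_def dxs_Nil dxs_single)
  next
    case (Inr b)
    then show ?thesis using dxs_swap[of b _ P v]
      by (cases h) (simp_all add: word_form_def tensor_def dxs_Nil dxs_single)
  qed
qed

lemma word_form_square: "word_form [g, g] = (\<lambda>P u v. 0)"
  by (cases g) (simp_all add: word_form_def tensor_def dxs_repeat)

text \<open>
  Together with \<open>dxs_frame_self\<close> this is the duality between coordinate forms and coordinate frames from which
  linear independence follows.
\<close>

lemma dxs_frame_other:
  assumes "length I' = length I" "set I' \<noteq> set I"
  shows "dxs I P (frame I') = 0"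
proof -
  have "coords I (\<lambda>k. frame I' (\<sigma> k)) = 0" if \<sigma>: "\<sigma> permutes {..<length I}" for \<sigma>
  proof (rule ccontr)
    assume "coords I (\<lambda>k. frame I' (\<sigma> k)) \<noteq> 0"
    then have *: "I' ! \<sigma> k = I ! k" if "k < length I" for k
      using that by (auto simp: coords_def frame_def axis_def split: if_splits)
    have "set I = (\<lambda>k. I ! k) ` {..<length I}" by (auto simp: set_conv_nth)
    also have "\<dots> = (\<lambda>k. I' ! \<sigma> k) ` {..<length I}" using * by (intro image_cong) auto
    also have "\<dots> = (\<lambda>k. I' ! k) ` {..<length I}"
      using permutes_image[OF \<sigma>] by (metis image_image)
    also have "\<dots> = set I'" using assms(1) by (auto simp: set_conv_nth)
    finally show False using assms(2) by simp
  qed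
  then show ?thesis by (simp add: dxs_def alternator_def)
qed

lemma dxs_frame_self:
  assumes "distinct I"
  shows "dxs I P (frame I) = 1"
proof -
  have "of_int (sign \<sigma>) * coords I (\<lambda>k. frame I (\<sigma> k)) = (if \<sigma> = id then 1 else 0)"
    if \<sigma>: "\<sigma> permutes {..<length I}" for \<sigma>
  proof (cases "\<sigma> = id")
    case True
    then show ?thesis by (simp add: coords_def frame_def sign_id axis_def)
  next
    case False
    then obtain k where k: "\<sigma> k \<noteq> k" by (auto simp: fun_eq_iff)
    then have kI: "k < length I" using permutes_not_in[OF \<sigma>, of k] by auto
    then have "\<sigma> k < length I" using permutes_in_image[OF \<sigma>, of k] by simp
    then have "I ! \<sigma> k \<noteq> I ! k" using kI k assms by (simp add: nth_eq_iff_index_eq)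
    then have "coords I (\<lambda>k. frame I (\<sigma> k)) = 0"
      using kI by (auto simp: coords_def frame_def axis_def intro!: bexI[of _ k])
    then show ?thesis using False by simp
  qed
  then have "dxs I P (frame I) = (\<Sum>\<sigma> | \<sigma> permutes {..<length I}. if \<sigma> = id then 1 else 0)"
    unfolding dxs_def alternator_def by (intro sum.cong) auto
  also have "\<dots> = 1" by (simp add: finite_permutations permutes_id)
  finally show ?thesis .
qed

abbreviation lists_of_length :: "nat \<Rightarrow> 'n list set" where
  "lists_of_length p \<equiv> {I. length I = p}"

lemma finite_lists_of_length: "finite (lists_of_length p :: 'n::finite list set)"
  using finite_lists_length_eq[of "UNIV :: 'n set" p] by simp

text \<open>
  Expansion in coordinates of one argument after the other, the last argument first.
\<close>

lemma multilin_expand: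
  fixes m :: "(nat \<Rightarrow> real ^ 'n::finite) \<Rightarrow> real"
  assumes "multilin p m"
  shows "m u = (\<Sum>I\<in>lists_of_length p. m (frame I) * coords I u)"
  using assms
proof (induction p arbitrary: m u)
  case 0
  have "m u = m (frame [])" by (rule multilin_cong[OF 0]) simp
  then show ?case by (simp add: coords_def)
next
  case (Suc p)
  have lin: "linear (\<lambda>w. m (u(p := w)))" by (rule multilin_linear[OF Suc.prems]) simp
  have "multilin p (\<lambda>u. m (u(p := a)))" for a
    unfolding multilin_def
  proof (intro conjI allI impI)
    fix u u' :: "nat \<Rightarrow> real ^ 'n" assume "\<forall>i<p. u i = u' i"
    then show "m (u(p := a)) = m (u'(p := a))" by (intro multilin_cong[OF Suc.prems]) auto
  next
    fix u :: "nat \<Rightarrow> real ^ 'n" and i assume i: "i < p"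
    have "u(i := w, p := a) = (u(p := a))(i := w)" for w
      by (rule fun_upd_twist) (use i in simp)
    then show "linear (\<lambda>w. m (u(i := w, p := a)))"
      using multilin_linear[OF Suc.prems, of i "u(p := a)"] i by (simp del: fun_upd_apply)
  qed
  note IH = Suc.IH[OF this]
  have fr: "m ((frame I)(p := axis i 1)) = m (frame (I @ [i]))" if "length I = p" for I i
    by (rule multilin_cong[OF Suc.prems]) (use that in \<open>auto simp: frame_def nth_append\<close>)
  have co: "coords I u * u p $ i = coords (I @ [i]) u" if "length I = p" for I i
    using that by (simp add: coords_append) (simp add: coords_def)
  have "m u = m (u(p := u p))" by simp
  also have "u p = (\<Sum>i\<in>UNIV. u p $ i *\<^sub>R axis i 1)"
    by (simp add: basis_expansion flip: scalar_mult_eq_scaleR)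
  also have "m (u(p := \<dots>)) = (\<Sum>i\<in>UNIV. u p $ i * m (u(p := axis i 1)))"
    by (simp add: linear_sum[OF lin] linear_cmul[OF lin])
  also have "\<dots> = (\<Sum>i\<in>UNIV. \<Sum>I\<in>lists_of_length p. m (frame (I @ [i])) * coords (I @ [i]) u)"
    by (intro sum.cong refl, subst IH) (simp add: sum_distrib_left fr co[symmetric] mult_ac)
  also have "\<dots> = (\<Sum>(i, I)\<in>UNIV \<times> lists_of_length p. m (frame (I @ [i])) * coords (I @ [i]) u)"
    by (simp add: sum.cartesian_product)
  also have "\<dots> = (\<Sum>I\<in>lists_of_length (Suc p). m (frame I) * coords I u)"
    by (rule sum.reindex_bij_witness[where i = "\<lambda>I. (last I, butlast I)" and j = "\<lambda>(i, I). I @ [i]"])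
       (auto simp: append_butlast_last_id[OF length_greater_0_conv[THEN iffD1]])
  finally show ?case .
qed

text \<open>
  Alternate the coordinate expansion.  All index lists are kept, including those with repetitions and all orderings of
  the same indices; this avoids choosing a basis and costs the factor \<open>p!\<close>.
\<close>

lemma alt_map_expand:
  fixes m :: "(nat \<Rightarrow> real ^ 'n::finite) \<Rightarrow> real"
  assumes m: "alt_map p m"
  shows "fact p * m u = (\<Sum>I\<in>lists_of_length p. m (frame I) * dxs I P u)"
proof -
  have "alternator p m u = (\<Sum>\<sigma> | \<sigma> permutes {..<p}. m u)"
    unfolding alternator_def
    by (intro sum.cong refl) (simp add: alt_map_permutes[OF m] mult.assoc[symmetric])
  then have "fact p * m u = alternator p m u" by (simp add: card_permutations)
  also have "\<dots> = alternator p (\<lambda>u. \<Sum>I\<in>lists_of_length p. m (frame I) * coords I u) u"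
    by (rule alternator_cong_fun) (rule multilin_expand[OF alt_map_multilin[OF m]])
  also have "\<dots> = (\<Sum>I\<in>lists_of_length p. m (frame I) * dxs I P u)"
    by (simp add: alternator_sum alternator_cmult dxs_def)
  finally show ?thesis .
qed

lemma parallel_biform_expand:
  fixes \<omega> :: "'n::finite biform"
  assumes \<omega>: "\<omega> \<in> biforms p q" "parallel_biform \<omega>"
  shows "\<omega> P u v = (\<Sum>(I, J)\<in>lists_of_length p \<times> lists_of_length q.
     \<omega> (abs_torus 0) (frame I) (frame J) / (fact p * fact q) * word_form (map Inl I @ map Inr J) P u v)"
proof -
  have P: "\<omega> P = \<omega> (abs_torus 0)" using \<omega>(2) unfolding parallel_biform_def by metis
  have "fact p * fact q * \<omega> P u v = fact q * (\<Sum>I\<in>lists_of_length p. \<omega> P (frame I) v * dxs I P u)"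
    by (simp add: alt_map_expand[OF biforms_alt1[OF \<omega>(1)], symmetric])
  also have "\<dots> = (\<Sum>I\<in>lists_of_length p. (fact q * \<omega> P (frame I) v) * dxs I P u)"
    by (simp add: sum_distrib_left mult.assoc)
  also have "\<dots> = (\<Sum>I\<in>lists_of_length p. \<Sum>J\<in>lists_of_length q. \<omega> P (frame I) (frame J) * dxs J P v * dxs I P u)"
    by (simp add: alt_map_expand[OF biforms_alt2[OF \<omega>(1)], of _ _ _ P] sum_distrib_right)
  also have "\<dots> = (\<Sum>(I, J)\<in>lists_of_length p \<times> lists_of_length q.
     \<omega> P (frame I) (frame J) * word_form (map Inl I @ map Inr J) P u v)"
    by (simp add: sum.cartesian_product word_form_def tensor_def lefts_append rights_append mult_ac)
  finally have "\<omega> P u v = (\<Sum>(I, J)\<in>lists_of_length p \<times> lists_of_length q.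
     \<omega> P (frame I) (frame J) * word_form (map Inl I @ map Inr J) P u v) / (fact p * fact q)"
    by (simp add: field_simps)
  then show ?thesis by (simp add: sum_divide_distrib P case_prod_unfold)
qed

section \<open>Quotients of the free algebra with square-zero generators\<close>

abbreviation word :: "'g list \<Rightarrow> 'g list \<Rightarrow> real" where
  "word \<equiv> word_mon 1"

lemma carrier_free_alg: "f \<in> carrier free_alg \<longleftrightarrow> finite {w. f w \<noteq> 0}"
  by (simp add: free_alg_def)

lemma mult_free_alg: "f \<otimes>\<^bsub>free_alg\<^esub> g = (\<lambda>w. \<Sum>k\<le>length w. f (take k w) * g (drop k w))"
  by (simp add: free_alg_def)

lemma add_free_alg: "f \<oplus>\<^bsub>free_alg\<^esub> g = (\<lambda>w. f w + g w)"
  by (simp add: free_alg_def)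

lemma zero_free_alg: "\<zero>\<^bsub>free_alg\<^esub> = (\<lambda>w. 0)"
  by (simp add: free_alg_def)

lemma one_free_alg: "\<one>\<^bsub>free_alg\<^esub> = word []"
  by (auto simp: free_alg_def word_mon_def)

lemma free_alg_add_closed:
  "f \<in> carrier free_alg \<Longrightarrow> g \<in> carrier free_alg \<Longrightarrow> (\<lambda>w. f w + g w) \<in> carrier free_alg"
  unfolding carrier_free_alg
  by (rule finite_subset[of _ "{w. f w \<noteq> 0} \<union> {w. g w \<noteq> 0}"]) auto

lemma free_alg_cmult_closed: "f \<in> carrier free_alg \<Longrightarrow> (\<lambda>w. c * f w) \<in> carrier free_alg"
  unfolding carrier_free_alg by (rule finite_subset[of _ "{w. f w \<noteq> 0}"]) auto

lemma word_mon_closed: "word_mon c w \<in> carrier free_alg"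
  unfolding carrier_free_alg by (rule finite_subset[of _ "{w}"]) (auto simp: word_mon_def)

lemma free_alg_mult_closed:
  assumes "f \<in> carrier free_alg" "g \<in> carrier free_alg"
  shows "f \<otimes>\<^bsub>free_alg\<^esub> g \<in> carrier free_alg"
  unfolding carrier_free_alg mult_free_alg
proof (rule finite_subset)
  show "finite ((\<lambda>(u, v). u @ v) ` ({w. f w \<noteq> 0} \<times> {w. g w \<noteq> 0}))"
    using assms by (simp add: carrier_free_alg)
  show "{w. (\<Sum>k\<le>length w. f (take k w) * g (drop k w)) \<noteq> 0} \<subseteq> (\<lambda>(u, v). u @ v) ` ({w. f w \<noteq> 0} \<times> {w. g w \<noteq> 0})"
  proof
    fix w assume "w \<in> {w. (\<Sum>k\<le>length w. f (take k w) * g (drop k w)) \<noteq> 0}"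
    then obtain k where "f (take k w) * g (drop k w) \<noteq> 0"
      by (auto elim: sum.not_neutral_contains_not_neutral)
    then show "w \<in> (\<lambda>(u, v). u @ v) ` ({w. f w \<noteq> 0} \<times> {w. g w \<noteq> 0})"
      by (intro image_eqI[of _ _ "(take k w, drop k w)"]) auto
  qed
qed

lemma free_alg_assoc:
  "(f \<otimes>\<^bsub>free_alg\<^esub> g) \<otimes>\<^bsub>free_alg\<^esub> h = f \<otimes>\<^bsub>free_alg\<^esub> (g \<otimes>\<^bsub>free_alg\<^esub> h)"
proof
  fix w :: "'a list"
  let ?n = "length w"
  have "((f \<otimes>\<^bsub>free_alg\<^esub> g) \<otimes>\<^bsub>free_alg\<^esub> h) w =
    (\<Sum>k\<le>?n. \<Sum>i\<le>k. f (take i w) * g (drop i (take k w)) * h (drop k w))"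
    unfolding mult_free_alg sum_distrib_right by (intro sum.cong) (auto simp: min_def)
  also have "\<dots> = (\<Sum>(k, i)\<in>Sigma {..?n} (\<lambda>k. {..k}). f (take i w) * g (drop i (take k w)) * h (drop k w))"
    by (simp add: sum.Sigma)
  also have "\<dots> = (\<Sum>(i, j)\<in>Sigma {..?n} (\<lambda>i. {..?n - i}). f (take i w) * (g (take j (drop i w)) * h (drop j (drop i w))))"
    by (rule sum.reindex_bij_witness[where i = "\<lambda>(i, j). (i + j, i)" and j = "\<lambda>(k, i). (i, k - i)"])
       (auto simp: drop_take mult.assoc)
  also have "\<dots> = (f \<otimes>\<^bsub>free_alg\<^esub> (g \<otimes>\<^bsub>free_alg\<^esub> h)) w"
    by (simp add: mult_free_alg sum_distrib_left sum.Sigma)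
  finally show "((f \<otimes>\<^bsub>free_alg\<^esub> g) \<otimes>\<^bsub>free_alg\<^esub> h) w = (f \<otimes>\<^bsub>free_alg\<^esub> (g \<otimes>\<^bsub>free_alg\<^esub> h)) w" .
qed

lemma word_mon_mult_left:
  "word_mon c [] \<otimes>\<^bsub>free_alg\<^esub> f = (\<lambda>w. c * f w)"
proof
  fix w
  have "(word_mon c [] \<otimes>\<^bsub>free_alg\<^esub> f) w = (\<Sum>k\<in>{0}. word_mon c [] (take k w) * f (drop k w))"
    unfolding mult_free_alg by (rule sum.mono_neutral_right) (auto simp: word_mon_def)
  then show "(word_mon c [] \<otimes>\<^bsub>free_alg\<^esub> f) w = c * f w" by (simp add: word_mon_def)
qed

lemma one_mult_right: "f \<otimes>\<^bsub>free_alg\<^esub> word [] = f"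
proof
  fix w
  have "(f \<otimes>\<^bsub>free_alg\<^esub> word []) w = (\<Sum>k\<in>{length w}. f (take k w) * word [] (drop k w))"
    unfolding mult_free_alg by (rule sum.mono_neutral_right) (auto simp: word_mon_def)
  then show "(f \<otimes>\<^bsub>free_alg\<^esub> word []) w = f w" by (simp add: word_mon_def)
qed

lemma word_mon_mult:
  "word_mon c u \<otimes>\<^bsub>free_alg\<^esub> word_mon d v = word_mon (c * d) (u @ v)"
proof
  fix w
  have "(word_mon c u \<otimes>\<^bsub>free_alg\<^esub> word_mon d v) w
    = (\<Sum>k\<le>length w. if k = length u \<and> w = u @ v then c * d else 0)"
    unfolding mult_free_alg
  proof (rule sum.cong[OF refl])
    fix k assume k: "k \<in> {..length w}"
    have "take k w = u \<and> drop k w = v \<longleftrightarrow> k = length u \<and> w = u @ v"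
      using k by (metis append_eq_conv_conj append_take_drop_id atMost_iff length_take min.absorb2)
    then show "word_mon c u (take k w) * word_mon d v (drop k w) = (if k = length u \<and> w = u @ v then c * d else 0)"
      by (auto simp: word_mon_def)
  qed
  also have "\<dots> = word_mon (c * d) (u @ v) w"
    by (auto simp: word_mon_def)
  finally show "(word_mon c u \<otimes>\<^bsub>free_alg\<^esub> word_mon d v) w = word_mon (c * d) (u @ v) w" .
qed

lemma free_alg_ring: "Ring.ring (free_alg :: ('a list \<Rightarrow> real) ring)"
proof (rule ringI)
  show "abelian_group (free_alg :: ('a list \<Rightarrow> real) ring)"
  proof (rule abelian_groupI)
    fix f :: "'a list \<Rightarrow> real" assume "f \<in> carrier free_alg"
    then show "\<exists>g\<in>carrier free_alg. g \<oplus>\<^bsub>free_alg\<^esub> f = \<zero>\<^bsub>free_alg\<^esub>"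
      using free_alg_cmult_closed[of f "-1"]
      by (intro bexI[of _ "\<lambda>w. -1 * f w"]) (auto simp: add_free_alg zero_free_alg)
  qed (auto simp: add_free_alg zero_free_alg free_alg_add_closed[unfolded carrier_free_alg] carrier_free_alg add_ac)
  show "Group.monoid (free_alg :: ('a list \<Rightarrow> real) ring)"
    by (rule monoidI)
       (auto simp: free_alg_mult_closed one_free_alg word_mon_closed free_alg_assoc one_mult_right word_mon_mult_left)
qed (auto simp: mult_free_alg add_free_alg distrib_left distrib_right sum.distrib)

lemma minus_free_alg:
  assumes "f \<in> carrier free_alg" "g \<in> carrier free_alg"
  shows "f \<ominus>\<^bsub>free_alg\<^esub> g = (\<lambda>w. f w - g w)"
proof -
  interpret ring "free_alg :: ('a list \<Rightarrow> real) ring" by (rule free_alg_ring)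
  have "\<ominus>\<^bsub>free_alg\<^esub> g = (\<lambda>w. -1 * g w)"
    by (rule minus_equality) (use assms(2) free_alg_cmult_closed[of g "-1"] in \<open>auto simp: add_free_alg zero_free_alg\<close>)
  then show ?thesis by (simp add: a_minus_def add_free_alg)
qed

text \<open>
  Rewriting of words works modulo any ideal with these relations; in the application the scalars \<open>s\<close> are the
  signs \<open>gen_sign\<close>.
\<close>

locale square_zero_ideal = ideal J free_alg for J :: "('g::finite list \<Rightarrow> real) set" +
  fixes s :: "'g::finite \<Rightarrow> 'g::finite \<Rightarrow> real"
  assumes commutator_mem: "g \<noteq> h \<Longrightarrow> (\<lambda>w. word [g, h] w - s g h * word [h, g] w) \<in> J"
    and square_mem: "word [g, g] \<in> J"
begin

definition cong :: "('g list \<Rightarrow> real) \<Rightarrow> ('g list \<Rightarrow> real) \<Rightarrow> bool" where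
  "cong x y \<longleftrightarrow> (\<lambda>w. x w - y w) \<in> J"

lemma J_add: "f \<in> J \<Longrightarrow> g \<in> J \<Longrightarrow> (\<lambda>w. f w + g w) \<in> J"
  using additive_subgroup.a_closed[OF additive_subgroup_axioms, of f g] by (simp add: add_free_alg)

lemma J_cmult: "f \<in> J \<Longrightarrow> (\<lambda>w. c * f w) \<in> J"
  using I_l_closed[of f "word_mon c []"] by (simp add: word_mon_mult_left word_mon_closed)

lemma J_zero: "(\<lambda>w. 0) \<in> J"
  using additive_subgroup.zero_closed[OF additive_subgroup_axioms] by (simp add: zero_free_alg)

lemma cong_refl: "cong x x"
  using J_zero by (simp add: cong_def)

lemma cong_trans: "cong x y \<Longrightarrow> cong y z \<Longrightarrow> cong x z"
  unfolding cong_def using J_add[of "\<lambda>w. x w - y w" "\<lambda>w. y w - z w"] by simp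

lemma cong_add: "cong x y \<Longrightarrow> cong x' y' \<Longrightarrow> cong (\<lambda>w. x w + x' w) (\<lambda>w. y w + y' w)"
  unfolding cong_def using J_add[of "\<lambda>w. x w - y w" "\<lambda>w. x' w - y' w"] by (simp add: algebra_simps)

lemma cong_cmult: "cong x y \<Longrightarrow> cong (\<lambda>w. c * x w) (\<lambda>w. c * y w)"
  unfolding cong_def using J_cmult[of "\<lambda>w. x w - y w" c] by (simp add: algebra_simps)

lemma cong_context:
  assumes "cong (word u) (\<lambda>w. c * word v w)"
  shows "cong (word (a @ u @ b)) (\<lambda>w. c * word (a @ v @ b) w)"
proof -
  have "(\<lambda>w. word u w - c * word v w) \<in> J" using assms by (simp add: cong_def)
  from I_r_closed[OF I_l_closed[OF this, of "word a"], of "word b"]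
  have "(word a \<otimes>\<^bsub>free_alg\<^esub> (\<lambda>w. word u w - c * word v w)) \<otimes>\<^bsub>free_alg\<^esub> word b \<in> J"
    by (simp add: word_mon_closed)
  also have "(word a \<otimes>\<^bsub>free_alg\<^esub> (\<lambda>w. word u w - c * word v w)) \<otimes>\<^bsub>free_alg\<^esub> word b
     = (\<lambda>w. ((word a \<otimes>\<^bsub>free_alg\<^esub> word u) \<otimes>\<^bsub>free_alg\<^esub> word b) w
          - c * ((word a \<otimes>\<^bsub>free_alg\<^esub> word v) \<otimes>\<^bsub>free_alg\<^esub> word b) w)"
    by (simp add: mult_free_alg fun_eq_iff algebra_simps sum_subtractf sum_distrib_left sum_distrib_right)
  finally show ?thesis by (simp add: cong_def word_mon_mult)
qed

text \<open>
  The factor \<open>c\<close> may be zero, so that a word with a repeated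
  letter reduces to every word.
\<close>

definition reduces :: "'g list \<Rightarrow> 'g list \<Rightarrow> bool" where
  "reduces u v \<longleftrightarrow> (\<exists>c. cong (word u) (\<lambda>w. c * word v w))"

lemma reduces_refl: "reduces u u"
  unfolding reduces_def by (rule exI[of _ 1]) (simp add: cong_refl)

lemma reduces_trans:
  assumes "reduces u v" "reduces v x"
  shows "reduces u x"
proof -
  obtain c d where c: "cong (word u) (\<lambda>w. c * word v w)" and d: "cong (word v) (\<lambda>w. d * word x w)"
    using assms by (auto simp: reduces_def)
  from cong_trans[OF c cong_cmult[OF d, of c]] show ?thesis
    unfolding reduces_def by (intro exI[of _ "c * d"]) (simp add: mult.assoc)
qed

lemma reduces_context: "reduces u v \<Longrightarrow> reduces (a @ u @ b) (a @ v @ b)"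
  unfolding reduces_def using cong_context by blast

lemma reduces_swap: "reduces (a @ [g, h] @ b) (a @ [h, g] @ b)"
proof (cases "g = h")
  case False
  have "reduces [g, h] [h, g]"
    unfolding reduces_def cong_def using commutator_mem[OF False] by blast
  then show ?thesis by (rule reduces_context)
qed (simp add: reduces_refl)

lemma reduces_square: "reduces (g # g # b) v"
proof -
  have "cong (word [g, g]) (\<lambda>w. 0 * word [g, g] w)"
    unfolding cong_def using square_mem by simp
  from cong_context[OF this, of "[]" b] show ?thesis
    unfolding reduces_def by (intro exI[of _ 0]) simp
qed

lemma reduces_move_front: "reduces (a @ h # b) (h # a @ b)"
proof (induction a)
  case (Cons g a)
  have "reduces ([g] @ (a @ h # b) @ []) ([g] @ (h # a @ b) @ [])"
    by (rule reduces_context[OF Cons.IH])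
  moreover have "reduces ([] @ [g, h] @ (a @ b)) ([] @ [h, g] @ (a @ b))"
    by (rule reduces_swap)
  ultimately show ?case using reduces_trans by fastforce
qed (simp add: reduces_refl)

text \<open>
  Bring the first letter of \<open>v\<close> to the front of \<open>u\<close> and compare the remaining words.  If that letter occurs once more
  in \<open>u\<close>, it can be brought to the front as well, and the square makes the word zero.
\<close>

lemma reduces_same_set:
  "distinct v \<Longrightarrow> set u = set v \<Longrightarrow> reduces u v"
proof (induction v arbitrary: u)
  case Nil
  then show ?case by (simp add: reduces_refl)
next
  case (Cons h v)
  then have "h \<in> set u" by auto
  then obtain a b where u: "u = a @ h # b" by (meson split_list)
  have 1: "reduces u (h # a @ b)" unfolding u by (rule reduces_move_front)
  show ?case
  proof (cases "h \<in> set (a @ b)")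
    case True
    then obtain a' b' where ab: "a @ b = a' @ h # b'" by (meson split_list)
    have "reduces ([h] @ (a' @ h # b') @ []) ([h] @ (h # a' @ b') @ [])"
      by (intro reduces_context reduces_move_front)
    then have "reduces (h # a @ b) (h # h # a' @ b')" by (simp add: ab)
    then show ?thesis using 1 reduces_square reduces_trans by blast
  next
    case False
    then have "set (a @ b) = set v" using Cons.prems u by auto
    then have "reduces (a @ b) v" using Cons by auto
    from reduces_context[OF this, of "[h]" "[]"] show ?thesis using 1 reduces_trans by fastforce
  qed
qed

definition rep :: "'g set \<Rightarrow> 'g list" where
  "rep S = (SOME w. set w = S \<and> distinct w)"

lemma rep: "set (rep S) = S" "distinct (rep S)"
proof -
  have "\<exists>w. set w = S \<and> distinct w" by (rule finite_distinct_list) simp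
  from someI_ex[OF this] show "set (rep S) = S" "distinct (rep S)" by (simp_all add: rep_def)
qed

lemma cong_normal_form:
  assumes "f \<in> carrier free_alg"
  obtains c where "cong f (\<lambda>w. \<Sum>S\<in>UNIV. c S * word (rep S) w)"
proof -
  have "\<exists>c. cong (\<lambda>w. \<Sum>u\<in>U. f u * word u w) (\<lambda>w. \<Sum>S\<in>UNIV. c S * word (rep S) w)" if "finite U" for U
    using that
  proof (induction U rule: finite_induct)
    case empty
    show ?case by (rule exI[of _ "\<lambda>_. 0"]) (simp add: cong_refl)
  next
    case (insert u U)
    then obtain c where c: "cong (\<lambda>w. \<Sum>u\<in>U. f u * word u w) (\<lambda>w. \<Sum>S\<in>UNIV. c S * word (rep S) w)"
      by blast
    have "reduces u (rep (set u))" by (rule reduces_same_set) (simp_all add: rep)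
    then obtain d where d: "cong (word u) (\<lambda>w. d * word (rep (set u)) w)"
      by (auto simp: reduces_def)
    have "(\<Sum>S\<in>UNIV. (if S = set u then f u * d else 0) * word (rep S) w) = f u * (d * word (rep (set u)) w)" for w
      by (subst sum.remove[of _ "set u"]) auto
    then have "(\<Sum>S\<in>UNIV. ((if S = set u then f u * d else 0) + c S) * word (rep S) w)
       = f u * (d * word (rep (set u)) w) + (\<Sum>S\<in>UNIV. c S * word (rep S) w)" for w
      by (simp add: distrib_right sum.distrib)
    then show ?case
      using cong_add[OF cong_cmult[OF d, of "f u"] c] insert
      by (intro exI[of _ "\<lambda>S. (if S = set u then f u * d else 0) + c S"]) simp
  qed
  from this[of "{w. f w \<noteq> 0}"] assms
  obtain c where c: "cong (\<lambda>w. \<Sum>u\<in>{w. f w \<noteq> 0}. f u * word u w) (\<lambda>w. \<Sum>S\<in>UNIV. c S * word (rep S) w)"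
    by (auto simp: carrier_free_alg)
  have "(\<Sum>u\<in>{w. f w \<noteq> 0}. f u * word u w) = f w" for w
  proof -
    have "(\<Sum>u\<in>{w. f w \<noteq> 0}. f u * word u w) = (\<Sum>u\<in>{w. f w \<noteq> 0}. if u = w then f u else 0)"
      by (intro sum.cong) (auto simp: word_mon_def)
    also have "\<dots> = f w" using assms by (simp add: carrier_free_alg)
    finally show ?thesis .
  qed
  with c that show ?thesis by simp
qed

end

text \<open>
  Two surjective images of a ring are isomorphic over it as soon as the two maps identify the same elements:
  lift an element of the first image to the ring and map it to the second.
\<close>

lemma ring_iso_of_same_fibres:
  assumes R: "Ring.ring R" and \<pi>: "\<pi> \<in> ring_hom R Q" "\<pi> ` carrier R = carrier Q"
    and \<Phi>: "\<Phi> \<in> ring_hom R S" "\<Phi> ` carrier R = carrier S"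
    and fib: "\<And>x y. x \<in> carrier R \<Longrightarrow> y \<in> carrier R \<Longrightarrow> \<pi> x = \<pi> y \<longleftrightarrow> \<Phi> x = \<Phi> y"
  obtains h where "h \<in> ring_iso Q S" "\<And>x. x \<in> carrier R \<Longrightarrow> h (\<pi> x) = \<Phi> x"
proof -
  interpret ring R by (rule R)
  define h where "h q = \<Phi> (inv_into (carrier R) \<pi> q)" for q
  have h: "h (\<pi> x) = \<Phi> x" if "x \<in> carrier R" for x
    unfolding h_def using that fib by (metis f_inv_into_f imageI inv_into_into)
  have lift: "\<exists>x\<in>carrier R. q = \<pi> x" if "q \<in> carrier Q" for q
    using that \<pi>(2) by auto
  have "h \<in> ring_iso Q S"
  proof (rule ring_iso_memI)
    fix q assume "q \<in> carrier Q"
    then show "h q \<in> carrier S" using lift h \<Phi>(2) by (metis imageI)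
  next
    fix q r assume "q \<in> carrier Q" "r \<in> carrier Q"
    then obtain x y where xy: "x \<in> carrier R" "y \<in> carrier R" "q = \<pi> x" "r = \<pi> y" using lift by meson
    show "h (q \<otimes>\<^bsub>Q\<^esub> r) = h q \<otimes>\<^bsub>S\<^esub> h r"
      using xy h ring_hom_mult[OF \<pi>(1)] ring_hom_mult[OF \<Phi>(1)] by (metis m_closed)
    show "h (q \<oplus>\<^bsub>Q\<^esub> r) = h q \<oplus>\<^bsub>S\<^esub> h r"
      using xy h ring_hom_add[OF \<pi>(1)] ring_hom_add[OF \<Phi>(1)] by (metis a_closed)
  next
    show "h \<one>\<^bsub>Q\<^esub> = \<one>\<^bsub>S\<^esub>"
      using h ring_hom_one[OF \<pi>(1)] ring_hom_one[OF \<Phi>(1)] by (metis one_closed)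
  next
    show "bij_betw h (carrier Q) (carrier S)"
      unfolding bij_betw_def
    proof
      show "inj_on h (carrier Q)"
        by (rule inj_onI) (metis lift h fib)
      show "h ` carrier Q = carrier S"
        unfolding \<pi>(2)[symmetric] \<Phi>(2)[symmetric] image_image using h by (intro image_cong) auto
    qed
  qed
  then show ?thesis using that h by blast
qed

section \<open>Comparison of the two rings\<close>

definition words :: "nat \<Rightarrow> nat \<Rightarrow> ('n + 'n) list set" where
  "words r s = {w. length (lefts w) = r \<and> length (rights w) = s}"

lemma finite_words: "finite (words r s :: ('n::finite + 'n) list set)"
proof (rule finite_subset)
  show "words r s \<subseteq> {w :: ('n + 'n) list. length w = r + s}"
    by (auto simp: words_def length_lefts_rights[symmetric])
  show "finite {w :: ('n + 'n) list. length w = r + s}"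
    by (rule finite_lists_of_length)
qed

text \<open>
  The part of bidegree \<open>(r,s)\<close> of the value of \<open>f\<close>.  The sum ranges over all words of that bidegree, which are
  finitely many, rather than over the support of \<open>f\<close>; this makes the operation additive by inspection.
\<close>

definition form_of :: "(('n::finite + 'n) list \<Rightarrow> real) \<Rightarrow> nat \<Rightarrow> nat \<Rightarrow> 'n biform" where
  "form_of f r s = (\<lambda>P u v. \<Sum>w\<in>words r s. f w * word_form w P u v)"

lemma form_of_closed: "form_of f r s \<in> closed_biforms r s"
  unfolding form_of_def
proof (intro closed_sum closed_cmult)
  fix w :: "('a + 'a) list" assume "w \<in> words r s"
  then show "word_form w \<in> closed_biforms r s" using word_form_closed[of w] by (simp add: words_def)
qed

lemma form_of_parallel: "parallel_biform (form_of f r s)"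
  unfolding parallel_biform_def
proof (intro allI)
  fix P Q :: "'a torus"
  have "word_form w P = word_form w Q" for w
    using word_form_parallel[of w] unfolding parallel_biform_def by blast
  then show "form_of f r s P = form_of f r s Q" by (simp only: form_of_def)
qed

lemma form_of_add: "form_of (\<lambda>w. f w + g w) r s = (\<lambda>P u v. form_of f r s P u v + form_of g r s P u v)"
  by (simp add: form_of_def distrib_right sum.distrib)

lemma form_of_cmult: "form_of (\<lambda>w. c * f w) r s = (\<lambda>P u v. c * form_of f r s P u v)"
  by (simp add: form_of_def sum_distrib_left mult.assoc)

lemma form_of_zero: "form_of (\<lambda>w. 0) r s = (\<lambda>P u v. 0)"
  by (simp add: form_of_def)

lemma form_of_diff: "form_of (\<lambda>w. f w - g w) r s = (\<lambda>P u v. form_of f r s P u v - form_of g r s P u v)"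
  by (simp add: form_of_def left_diff_distrib sum_subtractf)

lemma form_of_minus: "form_of (\<lambda>w. - f w) r s = (\<lambda>P u v. - form_of f r s P u v)"
  using form_of_cmult[of "-1" f] by simp

lemma form_of_sum: "form_of (\<lambda>w. \<Sum>i\<in>I. f i w) r s = (\<lambda>P u v. \<Sum>i\<in>I. form_of (f i) r s P u v)"
  by (induction I rule: infinite_finite_induct) (simp_all add: form_of_zero form_of_add)

lemma form_of_word_mon:
  "form_of (word_mon c w) r s = (if w \<in> words r s then (\<lambda>P u v. c * word_form w P u v) else (\<lambda>P u v. 0))"
proof -
  have "word_mon c w x * word_form x P u v = (if x = w then c * word_form w P u v else 0)" for x P u v
    by (simp add: word_mon_def)
  then show ?thesis by (simp add: form_of_def finite_words fun_eq_iff)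
qed

lemma biwedge_form_of:
  "biwedge p q p' q' (form_of f p q) (form_of g p' q') P u v =
    (\<Sum>x\<in>words p q. \<Sum>y\<in>words p' q'. f x * g y * word_form (x @ y) P u v)"
proof -
  have "biwedge p q p' q' (form_of f p q) (form_of g p' q') P u v =
    (\<Sum>x\<in>words p q. \<Sum>y\<in>words p' q'. f x * (g y * biwedge p q p' q' (word_form x) (word_form y) P u v))"
    by (simp add: form_of_def biwedge_sum_left biwedge_sum_right biwedge_cmult_left biwedge_cmult_right sum_distrib_left)
  also have "\<dots> = (\<Sum>x\<in>words p q. \<Sum>y\<in>words p' q'. f x * g y * word_form (x @ y) P u v)"
    by (intro sum.cong refl) (auto simp: words_def word_form_append)
  finally show ?thesis .
qed

text \<open>
  A word of bidegree \<open>(r,s)\<close> together with a cutting position is the same as a bidegree \<open>(p,q) \<le> (r,s)\<close>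
  together with one word of bidegree \<open>(p,q)\<close> and one of the complementary bidegree.
\<close>

lemma form_of_mult:
  "form_of (f \<otimes>\<^bsub>free_alg\<^esub> g) r s = (\<lambda>P u v. \<Sum>(p, q)\<in>{..r} \<times> {..s}.
     biwedge p q (r - p) (s - q) (form_of f p q) (form_of g (r - p) (s - q)) P u v)"
proof (intro ext)
  fix P u v
  define t where "t x y = f x * g y * word_form (x @ y) P u v" for x y
  have l: "length (lefts (take k w)) + length (lefts (drop k w)) = length (lefts w)"
    "length (rights (take k w)) + length (rights (drop k w)) = length (rights w)" for k and w :: "('a + 'a) list"
    using arg_cong[OF lefts_append[of "take k w" "drop k w"], of length]
      arg_cong[OF rights_append[of "take k w" "drop k w"], of length] by simp_all
  have le: "length (lefts (take k w)) \<le> length (lefts w)" "length (rights (take k w)) \<le> length (rights w)"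
    and drop: "length (lefts (drop k w)) = length (lefts w) - length (lefts (take k w))"
      "length (rights (drop k w)) = length (rights w) - length (rights (take k w))" for k and w :: "('a + 'a) list"
    using l[of k w] by linarith+
  have "form_of (f \<otimes>\<^bsub>free_alg\<^esub> g) r s P u v = (\<Sum>w\<in>words r s. \<Sum>k\<le>length w. t (take k w) (drop k w))"
    by (simp add: form_of_def mult_free_alg sum_distrib_right t_def)
  also have "\<dots> = (\<Sum>(w, k)\<in>Sigma (words r s) (\<lambda>w. {..length w}). t (take k w) (drop k w))"
    by (simp add: sum.Sigma finite_words)
  also have "\<dots> = (\<Sum>((p, q), x, y)\<in>Sigma ({..r} \<times> {..s}) (\<lambda>(p, q). words p q \<times> words (r - p) (s - q)). t x y)"
    by (rule sum.reindex_bij_witness[where i = "\<lambda>((p, q), x, y). (x @ y, length x)"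
          and j = "\<lambda>(w, k). ((length (lefts (take k w)), length (rights (take k w))), take k w, drop k w)"])
       (auto simp: words_def lefts_append rights_append le drop)
  also have "\<dots> = (\<Sum>(p, q)\<in>{..r} \<times> {..s}. \<Sum>(x, y)\<in>words p q \<times> words (r - p) (s - q). t x y)"
    by (subst sum.Sigma[symmetric]) (auto simp: finite_words case_prod_unfold)
  also have "\<dots> = (\<Sum>(p, q)\<in>{..r} \<times> {..s}.
     biwedge p q (r - p) (s - q) (form_of f p q) (form_of g (r - p) (s - q)) P u v)"
    by (simp add: biwedge_form_of t_def sum.cartesian_product)
  finally show "form_of (f \<otimes>\<^bsub>free_alg\<^esub> g) r s P u v = (\<Sum>(p, q)\<in>{..r} \<times> {..s}.
     biwedge p q (r - p) (s - q) (form_of f p q) (form_of g (r - p) (s - q)) P u v)" .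
qed

definition realize :: "(('n::finite + 'n) list \<Rightarrow> real) \<Rightarrow> nat \<times> nat \<Rightarrow> 'n biform set" where
  "realize f = (\<lambda>(r, s). dk_class r s (form_of f r s))"

text \<open>
  Both sides are made of classes of constant forms, and cohomologous constant forms are equal.
\<close>

lemma realize_eq_iff: "realize f = realize g \<longleftrightarrow> (\<forall>r s. form_of f r s = form_of g r s)"
proof
  assume eq: "realize f = realize g"
  show "\<forall>r s. form_of f r s = form_of g r s"
  proof (intro allI)
    fix r s
    have "dk_class r s (form_of f r s) = dk_class r s (form_of g r s)"
      using fun_cong[OF eq, of "(r, s)"] by (simp add: realize_def)
    then have "(\<lambda>P u v. form_of f r s P u v + -1 * form_of g r s P u v) \<in> exact_biforms r s"
      by (simp only: dk_class_eq_iff)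
    moreover have "parallel_biform (\<lambda>P u v. form_of f r s P u v + -1 * form_of g r s P u v)"
      using form_of_parallel[of "\<lambda>w. f w - g w" r s] by (simp add: form_of_diff)
    ultimately have "(\<lambda>P u v. form_of f r s P u v + -1 * form_of g r s P u v) = (\<lambda>P u v. 0)"
      by (rule parallel_exact_zero[rotated])
    then show "form_of f r s = form_of g r s" by (simp add: fun_eq_iff)
  qed
qed (simp add: realize_def)

lemma realize_word_mon:
  "realize (word_mon c w) = dk_incl (length (lefts w)) (length (rights w))
     (dk_class (length (lefts w)) (length (rights w)) (\<lambda>P u v. c * word_form w P u v))"
  by (auto simp: realize_def dk_incl_def one_dk_sum fun_eq_iff form_of_word_mon words_def)

lemma realize_carrier:
  fixes f :: "('n::finite + 'n) list \<Rightarrow> real"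
  assumes "f \<in> carrier free_alg"
  shows "realize f \<in> carrier dk_sum"
proof -
  have "{(r, s). realize f (r, s) \<noteq> \<one>\<^bsub>DK r s\<^esub>} \<subseteq> (\<lambda>w. (length (lefts w), length (rights w))) ` {w. f w \<noteq> 0}"
  proof clarify
    fix r s assume ne: "realize f (r, s) \<noteq> \<one>\<^bsub>DK r s\<^esub>"
    have "\<exists>w\<in>words r s. f w \<noteq> 0"
    proof (rule ccontr)
      assume "\<not> (\<exists>w\<in>words r s. f w \<noteq> 0)"
      then have "form_of f r s = (\<lambda>P u v. 0)" by (simp add: form_of_def)
      with ne show False by (simp add: realize_def DK_one_class)
    qed
    then obtain w where "w \<in> words r s" "f w \<noteq> 0" by blast
    then show "(r, s) \<in> (\<lambda>w. (length (lefts w), length (rights w))) ` {w. f w \<noteq> 0}"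
      by (auto simp: words_def)
  qed
  moreover have "finite {w. f w \<noteq> 0}" using assms by (simp add: carrier_free_alg)
  ultimately have "finite {(r, s). realize f (r, s) \<noteq> \<one>\<^bsub>DK r s\<^esub>}"
    using finite_surj by blast
  then show ?thesis
    unfolding carrier_dk_sum by (simp add: realize_def dk_class_in_carrier form_of_closed)
qed

lemma realize_hom: "realize \<in> ring_hom free_alg (DK_ring :: (nat \<times> nat \<Rightarrow> 'n::finite biform set) ring)"
proof (rule ring_hom_memI)
  fix f g :: "('n + 'n) list \<Rightarrow> real"
  assume "f \<in> carrier free_alg"
  then show "realize f \<in> carrier DK_ring" by (simp add: DK_ring_def realize_carrier)
  show "realize (f \<oplus>\<^bsub>free_alg\<^esub> g) = realize f \<oplus>\<^bsub>DK_ring\<^esub> realize g"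
    by (simp add: DK_ring_def mult_dk_sum realize_def add_free_alg form_of_add DK_mult_class form_of_closed fun_eq_iff)
  have "realize (f \<otimes>\<^bsub>free_alg\<^esub> g) (r, s) = (realize f \<otimes>\<^bsub>DK_ring\<^esub> realize g) (r, s)" for r s
  proof -
    define b where "b = (\<lambda>(p, q). biwedge p q (r - p) (s - q) (form_of f p q) (form_of g (r - p) (s - q)))"
    have b: "b (p, q) \<in> closed_biforms r s" if "p \<le> r" "q \<le> s" for p q
      using biwedge_closed[OF form_of_closed[of f p q] form_of_closed[of g "r - p" "s - q"]] that
      by (simp add: b_def)
    interpret comm_group "DK r s :: 'n biform set monoid" by (rule DK_comm_group)
    have "(realize f \<otimes>\<^bsub>DK_ring\<^esub> realize g) (r, s) =
      finprod (DK r s) (\<lambda>(p, q). dk_cup p q (r - p) (s - q) (realize f (p, q)) (realize g (r - p, s - q))) ({..r} \<times> {..s})"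
      by (simp add: DK_ring_def)
    also have "\<dots> = finprod (DK r s) (\<lambda>pq. dk_class r s (b pq)) ({..r} \<times> {..s})"
      by (rule finprod_cong')
         (auto simp: realize_def dk_cup_class[OF form_of_closed form_of_closed] b_def
            intro!: dk_class_in_carrier b[unfolded b_def, simplified])
    also have "\<dots> = dk_class r s (\<lambda>P u v. \<Sum>pq\<in>{..r} \<times> {..s}. b pq P u v)"
      by (rule DK_finprod_class) (auto intro: b)
    also have "\<dots> = realize (f \<otimes>\<^bsub>free_alg\<^esub> g) (r, s)"
      by (simp add: realize_def form_of_mult b_def case_prod_unfold)
    finally show ?thesis by simp
  qed
  then show "realize (f \<otimes>\<^bsub>free_alg\<^esub> g) = realize f \<otimes>\<^bsub>DK_ring\<^esub> realize g" by auto
next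
  show "realize \<one>\<^bsub>free_alg\<^esub> = \<one>\<^bsub>DK_ring\<^esub>"
    by (simp add: one_free_alg realize_word_mon word_form_Nil[of 1, simplified] DK_ring_def)
qed

text \<open>
  Replace a representative by the constant one and expand the latter in coordinate forms.
\<close>

lemma dk_class_representable:
  fixes A :: "'n::finite biform set"
  assumes "A \<in> carrier (DK r s)"
  obtains f where "A = dk_class r s (form_of f r s)"
proof -
  obtain \<omega> where \<omega>: "\<omega> \<in> closed_biforms r s" "A = dk_class r s \<omega>"
    using assms by (auto simp: carrier_DK)
  obtain \<eta> where \<eta>: "\<eta> \<in> biforms r s" "parallel_biform \<eta>"
    "(\<lambda>P u v. \<omega> P u v + -1 * \<eta> P u v) \<in> exact_biforms r s"
    by (rule closed_cohomologous_parallel[OF \<omega>(1)])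
  define c where "c I J = \<eta> (abs_torus 0) (frame I) (frame J) / (fact r * fact s)" for I J
  define f where "f = (\<lambda>w. \<Sum>(I, J)\<in>lists_of_length r \<times> lists_of_length s. word_mon (c I J) (map Inl I @ map Inr J) w)"
  have "form_of f r s = \<eta>"
  proof (intro ext)
    fix P u v
    have "form_of f r s P u v = (\<Sum>(I, J)\<in>lists_of_length r \<times> lists_of_length s.
        form_of (word_mon (c I J) (map Inl I @ map Inr J)) r s P u v)"
      unfolding f_def case_prod_unfold form_of_sum ..
    also have "\<dots> = (\<Sum>(I, J)\<in>lists_of_length r \<times> lists_of_length s. c I J * word_form (map Inl I @ map Inr J) P u v)"
      by (intro sum.cong refl) (auto simp: form_of_word_mon words_def lefts_append rights_append)
    also have "\<dots> = \<eta> P u v"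
      unfolding c_def by (rule parallel_biform_expand[OF \<eta>(1,2), symmetric])
    finally show "form_of f r s P u v = \<eta> P u v" .
  qed
  moreover have "A = dk_class r s \<eta>" using \<omega>(2) \<eta>(3) by (simp only: dk_class_eq_iff)
  ultimately show ?thesis using that by metis
qed

lemma realize_surj: "realize ` carrier free_alg = carrier (DK_ring :: (nat \<times> nat \<Rightarrow> 'n::finite biform set) ring)"
proof
  show "realize ` carrier free_alg \<subseteq> carrier (DK_ring :: (nat \<times> nat \<Rightarrow> 'n biform set) ring)"
    using ring_hom_closed[OF realize_hom] by blast
  show "carrier (DK_ring :: (nat \<times> nat \<Rightarrow> 'n biform set) ring) \<subseteq> realize ` carrier free_alg"
  proof
    fix c :: "nat \<times> nat \<Rightarrow> 'n biform set" assume "c \<in> carrier DK_ring"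
    then have c: "\<And>r s. c (r, s) \<in> carrier (DK r s)" and fin: "finite {(r, s). c (r, s) \<noteq> \<one>\<^bsub>DK r s\<^esub>}"
      by (auto simp: DK_ring_def carrier_dk_sum)
    have "\<exists>f. c (r, s) = dk_class r s (form_of f r s)" for r s
      using dk_class_representable[OF c] by metis
    then obtain F where F: "\<And>r s. c (r, s) = dk_class r s (form_of (F r s) r s)" by metis
    \<comment> \<open>Where the given class is zero the representative is chosen to be \<open>0\<close>, which keeps the support finite.\<close>
    define f where "f w = (let r = length (lefts w); s = length (rights w) in
      if c (r, s) = \<one>\<^bsub>DK r s\<^esub> then 0 else F r s w)" for w
    have "form_of f r s = (if c (r, s) = \<one>\<^bsub>DK r s\<^esub> then (\<lambda>P u v. 0) else form_of (F r s) r s)" for r s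
      unfolding form_of_def by (auto simp: f_def words_def fun_eq_iff intro!: sum.cong)
    then have "dk_class r s (form_of f r s) = c (r, s)" for r s
      using F[of r s] by (simp add: DK_one_class)
    then have "realize f = c" by (auto simp: realize_def)
    moreover have "{w. f w \<noteq> 0} \<subseteq> (\<Union>(r, s)\<in>{(r, s). c (r, s) \<noteq> \<one>\<^bsub>DK r s\<^esub>}. words r s)"
      by (auto simp: f_def words_def Let_def split: if_splits)
    then have "f \<in> carrier free_alg"
      unfolding carrier_free_alg by (rule finite_subset) (use fin finite_words in auto)
    ultimately show "c \<in> realize ` carrier free_alg" by blast
  qed
qed

text \<open>
  The kernel of \<open>realize\<close>, described by forms instead of classes.
\<close>

definition vanishing :: "(('n::finite + 'n) list \<Rightarrow> real) set" where
  "vanishing = {f \<in> carrier free_alg. \<forall>r s. form_of f r s = (\<lambda>P u v. 0)}"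

lemma vanishing_ideal: "ideal (vanishing :: (('n::finite + 'n) list \<Rightarrow> real) set) free_alg"
proof (rule idealI)
  let ?R = "free_alg :: (('n + 'n) list \<Rightarrow> real) ring"
  interpret ring ?R by (rule free_alg_ring)
  show "Ring.ring ?R" by (rule free_alg_ring)
  show "subgroup vanishing (add_monoid ?R)"
  proof (rule group.subgroupI)
    show "Group.group (add_monoid ?R)" by (rule a_group)
    show "vanishing \<subseteq> carrier (add_monoid ?R)" by (auto simp: vanishing_def)
    show "(vanishing :: (('n + 'n) list \<Rightarrow> real) set) \<noteq> {}"
      using form_of_zero zero_closed by (auto simp: vanishing_def zero_free_alg intro!: exI[of _ "\<lambda>w. 0"])
    fix f :: "('n + 'n) list \<Rightarrow> real" assume f: "f \<in> vanishing"
    then have "\<ominus>\<^bsub>?R\<^esub> f = (\<lambda>w. 0 - f w)"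
      using minus_free_alg[of "\<zero>\<^bsub>?R\<^esub>" f] by (simp add: vanishing_def a_minus_def zero_free_alg[symmetric]) (simp add: zero_free_alg)
    then show "inv\<^bsub>add_monoid ?R\<^esub> f \<in> vanishing"
      using f a_inv_closed[of f] by (simp add: a_inv_def vanishing_def form_of_minus)
    fix g :: "('n + 'n) list \<Rightarrow> real" assume "g \<in> vanishing"
    then show "f \<otimes>\<^bsub>add_monoid ?R\<^esub> g \<in> vanishing"
      using f by (simp add: vanishing_def add_free_alg form_of_add free_alg_add_closed)
  qed
qed (auto simp: vanishing_def free_alg_mult_closed form_of_mult biwedge_zero_left biwedge_zero_right)

lemma vanishing_commutator: "(\<lambda>w. word_mon 1 [g, h] w - word_mon (gen_sign g h) [h, g] w) \<in> vanishing"
proof -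
  have "(\<lambda>w. word_mon 1 [g, h] w - word_mon (gen_sign g h) [h, g] w) \<in> carrier free_alg"
    using ring.ring_simprules(4)[OF free_alg_ring word_mon_closed word_mon_closed, of 1 "[g, h]" "gen_sign g h" "[h, g]"]
    by (simp add: minus_free_alg word_mon_closed)
  moreover have "[g, h] \<in> words r s \<longleftrightarrow> [h, g] \<in> words r s" for r s
    by (cases g; cases h) (auto simp: words_def)
  ultimately show ?thesis
    using word_form_commute[of g h] by (simp add: vanishing_def form_of_diff form_of_word_mon fun_eq_iff)
qed

lemma vanishing_square: "word_mon 1 [g, g] \<in> vanishing"
  using word_form_square[of g] by (simp add: vanishing_def form_of_word_mon word_mon_closed)

lemma word_form_frame_other:
  assumes "length (lefts x) = length (lefts w)" "length (rights x) = length (rights w)" "set x \<noteq> set w"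
  shows "word_form x P (frame (lefts w)) (frame (rights w)) = 0"
proof -
  have "set (lefts w) \<noteq> set (lefts x) \<or> set (rights w) \<noteq> set (rights x)"
    using assms(3) set_eq_lefts_rights by metis
  then have "dxs (lefts x) P (frame (lefts w)) = 0 \<or> dxs (rights x) P (frame (rights w)) = 0"
    using assms(1,2) dxs_frame_other by metis
  then show ?thesis by (auto simp: word_form_def tensor_def)
qed

lemma word_form_frame_self:
  "distinct w \<Longrightarrow> word_form w P (frame (lefts w)) (frame (rights w)) = 1"
  by (simp add: word_form_def tensor_def dxs_frame_self distinct_lefts distinct_rights)

text \<open>
  Evaluate on the coordinate frames given by the letters of \<open>rep T\<close>: among the chosen words of that bidegree
  only \<open>rep T\<close> itself has a nonzero value.
\<close>

lemma word_forms_independent: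
  fixes rep :: "('n::finite + 'n) set \<Rightarrow> ('n + 'n) list"
  assumes rep: "\<And>S. set (rep S) = S" "\<And>S. distinct (rep S)"
    and z: "\<And>r s. form_of (\<lambda>w. \<Sum>S\<in>UNIV. c S * word (rep S) w) r s = (\<lambda>P u v. 0)"
  shows "c T = 0"
proof -
  let ?w = "rep T"
  let ?r = "length (lefts ?w)" and ?s = "length (rights ?w)"
  let ?e = "\<lambda>\<omega> :: 'n biform. \<omega> (abs_torus 0) (frame (lefts ?w)) (frame (rights ?w))"
  have "?e (form_of (word (rep S)) ?r ?s) = (if S = T then 1 else 0)" for S
    using word_form_frame_other[of "rep S" ?w "abs_torus 0"] word_form_frame_self[of ?w "abs_torus 0"] rep
    by (auto simp: form_of_word_mon words_def)
  then have "(\<Sum>S\<in>UNIV. c S * ?e (form_of (word (rep S)) ?r ?s)) = c T"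
    by (simp add: if_distrib[of "(*) _"] cong: if_cong)
  moreover have "form_of (\<lambda>w. \<Sum>S\<in>UNIV. c S * word (rep S) w) ?r ?s
      = (\<lambda>P u v. \<Sum>S\<in>UNIV. c S * form_of (word (rep S)) ?r ?s P u v)"
    by (simp add: form_of_sum form_of_cmult)
  ultimately show ?thesis using z[of ?r ?s] by metis
qed

text \<open>
  The kernel of the two successive projections to the presented algebra.
\<close>

definition rel_ideal :: "(('n + 'n) list \<Rightarrow> real) set" where
  "rel_ideal = {f \<in> carrier free_alg. comm_ideal +>\<^bsub>free_alg\<^esub> f \<in> squares_ideal}"

definition quot_map :: "(('n + 'n) list \<Rightarrow> real) \<Rightarrow> (('n + 'n) list \<Rightarrow> real) set set" where
  "quot_map f = squares_ideal +>\<^bsub>gcpoly\<^esub> (comm_ideal +>\<^bsub>free_alg\<^esub> f)"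

lemma carrier_FactRing: "carrier (R Quot I) = (\<lambda>a. I +>\<^bsub>R\<^esub> a) ` carrier R"
  by (auto simp: FactRing_def A_RCOSETS_def')

lemma commutators_closed:
  "{word_mon 1 [g, h] \<ominus>\<^bsub>free_alg\<^esub> word_mon (gen_sign g h) [h, g] | g h. g \<noteq> h} \<subseteq> carrier free_alg"
  using ring.ring_simprules(4)[OF free_alg_ring word_mon_closed word_mon_closed] by blast

lemma comm_ideal: "ideal (comm_ideal :: (('n + 'n) list \<Rightarrow> real) set) free_alg"
  unfolding comm_ideal_def by (intro ring.genideal_ideal free_alg_ring commutators_closed)

lemma comm_ideal_vanishing: "comm_ideal \<subseteq> vanishing"
  unfolding comm_ideal_def
  by (intro ring.genideal_minimal free_alg_ring vanishing_ideal)
     (use vanishing_commutator in \<open>auto simp: minus_free_alg word_mon_closed\<close>)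

lemma gcpoly_ring: "Ring.ring (gcpoly :: (('n + 'n) list \<Rightarrow> real) set ring)"
  unfolding gcpoly_def by (rule ideal.quotient_is_ring[OF comm_ideal])

lemma coset_hom: "ring_hom_ring free_alg gcpoly ((+>\<^bsub>free_alg\<^esub>) (comm_ideal :: (('n + 'n) list \<Rightarrow> real) set))"
  unfolding gcpoly_def by (rule ideal.rcos_ring_hom_ring[OF comm_ideal])

lemma coset_closed: "f \<in> carrier free_alg \<Longrightarrow> comm_ideal +>\<^bsub>free_alg\<^esub> f \<in> carrier gcpoly"
  by (simp add: gcpoly_def carrier_FactRing)

lemma gen_square: "gcpoly_gen g \<otimes>\<^bsub>gcpoly\<^esub> gcpoly_gen g = comm_ideal +>\<^bsub>free_alg\<^esub> word_mon 1 [g, g]"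
proof -
  interpret ring_hom_ring free_alg gcpoly "(+>\<^bsub>free_alg\<^esub>) (comm_ideal :: (('a + 'a) list \<Rightarrow> real) set)"
    by (rule coset_hom)
  show ?thesis
    using hom_mult[OF word_mon_closed word_mon_closed, of 1 "[g]" 1 "[g]"]
    by (simp add: gcpoly_gen_def word_mon_mult)
qed

lemma squares_closed: "{gcpoly_gen g \<otimes>\<^bsub>gcpoly\<^esub> gcpoly_gen g | g. True} \<subseteq> carrier gcpoly"
  by (auto simp: gen_square coset_closed word_mon_closed)

lemma squares_ideal: "ideal (squares_ideal :: (('n + 'n) list \<Rightarrow> real) set set) gcpoly"
  unfolding squares_ideal_def by (intro ring.genideal_ideal gcpoly_ring squares_closed)

lemma rel_ideal: "ideal (rel_ideal :: (('n + 'n) list \<Rightarrow> real) set) free_alg"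
  unfolding rel_ideal_def by (rule ring_hom_ring.ideal_vimage[OF coset_hom squares_ideal])

text \<open>
  All relations hold for forms.  For the squares this has to be pulled back along the first quotient: the
  image of an ideal under a projection is an ideal, and it contains the squares of the generators.
\<close>

lemma rel_ideal_subset_vanishing: "rel_ideal \<subseteq> vanishing"
proof
  fix f :: "('a + 'a) list \<Rightarrow> real" assume f: "f \<in> rel_ideal"
  let ?C = "comm_ideal :: (('a + 'a) list \<Rightarrow> real) set"
  let ?R = "free_alg :: (('a + 'a) list \<Rightarrow> real) ring"
  interpret R: ring ?R by (rule free_alg_ring)
  interpret V: ideal vanishing ?R by (rule vanishing_ideal)
  have "ideal ((+>\<^bsub>?R\<^esub>) ?C ` vanishing) gcpoly"
    unfolding gcpoly_def by (rule R.ring_ideal_imp_quot_ideal[OF comm_ideal vanishing_ideal])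
  then have "squares_ideal \<subseteq> (+>\<^bsub>?R\<^esub>) ?C ` vanishing"
    unfolding squares_ideal_def
  proof (rule ring.genideal_minimal[OF gcpoly_ring])
    show "{gcpoly_gen g \<otimes>\<^bsub>gcpoly\<^esub> gcpoly_gen g | g. True} \<subseteq> (+>\<^bsub>?R\<^esub>) ?C ` vanishing"
      unfolding gen_square using vanishing_square by blast
  qed
  moreover have "?C +>\<^bsub>?R\<^esub> f \<in> squares_ideal"
    using f by (simp add: rel_ideal_def)
  ultimately have "?C +>\<^bsub>?R\<^esub> f \<in> (+>\<^bsub>?R\<^esub>) ?C ` vanishing" by (rule subsetD)
  then obtain k where k: "?C +>\<^bsub>?R\<^esub> f = ?C +>\<^bsub>?R\<^esub> k" "k \<in> vanishing" by (rule imageE)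
  have fc: "f \<in> carrier ?R" using f by (simp add: rel_ideal_def)
  have kc: "k \<in> carrier ?R" by (rule V.Icarr[OF k(2)])
  have "f \<ominus>\<^bsub>?R\<^esub> k \<in> ?C" unfolding R.quotient_eq_iff_same_a_r_cos[OF comm_ideal fc kc] by (rule k(1))
  then have "f \<ominus>\<^bsub>?R\<^esub> k \<in> vanishing" by (rule subsetD[OF comm_ideal_vanishing])
  then have "(f \<ominus>\<^bsub>?R\<^esub> k) \<oplus>\<^bsub>?R\<^esub> k \<in> vanishing" using k(2) by (rule V.a_closed)
  then show "f \<in> vanishing" by (simp add: minus_free_alg[OF fc kc] add_free_alg)
qed

lemma coset_comm_ideal_mem: "f \<in> comm_ideal \<Longrightarrow> f \<in> rel_ideal"
proof -
  assume f: "f \<in> (comm_ideal :: (('a + 'a) list \<Rightarrow> real) set)"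
  interpret C: ideal "comm_ideal :: (('a + 'a) list \<Rightarrow> real) set" free_alg by (rule comm_ideal)
  have "comm_ideal +>\<^bsub>free_alg\<^esub> f = \<zero>\<^bsub>gcpoly\<^esub>"
    using C.a_rcos_const[OF f] by (simp add: gcpoly_def FactRing_def)
  then show "f \<in> rel_ideal" using C.Icarr[OF f] additive_subgroup.zero_closed[OF ideal.axioms(1)[OF squares_ideal]] by (simp add: rel_ideal_def)
qed

lemma rel_ideal_square_zero: "square_zero_ideal (rel_ideal :: (('n::finite + 'n) list \<Rightarrow> real) set) gen_sign"
proof -
  interpret ideal "rel_ideal :: (('n + 'n) list \<Rightarrow> real) set" free_alg by (rule rel_ideal)
  show ?thesis
  proof
    fix g h :: "'n + 'n" assume "g \<noteq> h"
    then have "word_mon 1 [g, h] \<ominus>\<^bsub>free_alg\<^esub> word_mon (gen_sign g h) [h, g] \<in> comm_ideal"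
      unfolding comm_ideal_def using ring.genideal_self[OF free_alg_ring commutators_closed] by blast
    then have "(\<lambda>w. word [g, h] w - word_mon (gen_sign g h) [h, g] w) \<in> rel_ideal"
      by (intro coset_comm_ideal_mem) (simp add: minus_free_alg word_mon_closed)
    moreover have "word_mon c x = (\<lambda>w. c * word x w)" for c and x :: "('n + 'n) list"
      by (auto simp: word_mon_def)
    ultimately show "(\<lambda>w. word [g, h] w - gen_sign g h * word [h, g] w) \<in> rel_ideal" by metis
  next
    fix g :: "'n + 'n"
    have "gcpoly_gen g \<otimes>\<^bsub>gcpoly\<^esub> gcpoly_gen g \<in> squares_ideal"
      unfolding squares_ideal_def using ring.genideal_self[OF gcpoly_ring squares_closed] by blast
    then have "comm_ideal +>\<^bsub>free_alg\<^esub> word [g, g] \<in> squares_ideal" by (simp only: gen_square)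
    with word_mon_closed show "word [g, g] \<in> rel_ideal" unfolding rel_ideal_def mem_Collect_eq by (rule conjI)
  qed
qed

text \<open>
  Modulo the relations an element is a combination of the chosen repetition-free words.  If its form vanishes, so
  does the form of that combination, and by linear independence all coefficients are zero.
\<close>

lemma vanishing_eq_rel_ideal: "vanishing = rel_ideal"
proof
  show "vanishing \<subseteq> (rel_ideal :: (('a + 'a) list \<Rightarrow> real) set)"
  proof
    fix f :: "('a + 'a) list \<Rightarrow> real" assume f: "f \<in> vanishing"
    interpret square_zero_ideal "rel_ideal :: (('a + 'a) list \<Rightarrow> real) set" gen_sign by (rule rel_ideal_square_zero)
    obtain c where c: "cong f (\<lambda>w. \<Sum>S\<in>UNIV. c S * word (rep S) w)"
      by (rule cong_normal_form) (rule ideal.Icarr[OF vanishing_ideal f])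
    then have "(\<lambda>w. f w - (\<Sum>S\<in>UNIV. c S * word (rep S) w)) \<in> vanishing"
      unfolding cong_def by (rule subsetD[OF rel_ideal_subset_vanishing])
    then have "form_of (\<lambda>w. \<Sum>S\<in>UNIV. c S * word (rep S) w) r s = (\<lambda>P u v. 0)" for r s
      using f by (simp add: vanishing_def form_of_diff fun_eq_iff)
    then have "c T = 0" for T by (rule word_forms_independent[OF rep])
    then show "f \<in> rel_ideal" using c by (simp add: cong_def)
  qed
qed (rule rel_ideal_subset_vanishing)

lemma quot_map_hom: "quot_map \<in> ring_hom free_alg (gcpoly Quot squares_ideal)"
proof -
  have "(+>\<^bsub>gcpoly\<^esub>) squares_ideal \<in> ring_hom gcpoly (gcpoly Quot squares_ideal)"
    by (rule ideal.rcos_ring_hom[OF squares_ideal])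
  from ring_hom_trans[OF ring_hom_ring.homh[OF coset_hom] this]
  show ?thesis by (simp add: quot_map_def[abs_def] comp_def)
qed

lemma quot_map_surj:
  "quot_map ` carrier free_alg = carrier (gcpoly Quot (squares_ideal :: (('n + 'n) list \<Rightarrow> real) set set))"
proof -
  have "carrier gcpoly = (\<lambda>f :: ('n + 'n) list \<Rightarrow> real. comm_ideal +>\<^bsub>free_alg\<^esub> f) ` carrier free_alg"
    by (simp add: gcpoly_def carrier_FactRing)
  then show ?thesis by (simp add: carrier_FactRing[of gcpoly] image_image quot_map_def)
qed

lemma quot_map_eq_iff:
  fixes f g :: "('n::finite + 'n) list \<Rightarrow> real"
  assumes f: "f \<in> carrier free_alg" and g: "g \<in> carrier free_alg"
  shows "quot_map f = quot_map g \<longleftrightarrow> realize f = realize g"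
proof -
  let ?C = "comm_ideal :: (('n + 'n) list \<Rightarrow> real) set"
  interpret ring_hom_ring free_alg gcpoly "(+>\<^bsub>free_alg\<^esub>) ?C" by (rule coset_hom)
  have "quot_map f = quot_map g \<longleftrightarrow> (?C +>\<^bsub>free_alg\<^esub> f) \<ominus>\<^bsub>gcpoly\<^esub> (?C +>\<^bsub>free_alg\<^esub> g) \<in> squares_ideal"
    unfolding quot_map_def
    by (rule ring.quotient_eq_iff_same_a_r_cos[OF gcpoly_ring squares_ideal coset_closed[OF f] coset_closed[OF g], symmetric])
  also have "(?C +>\<^bsub>free_alg\<^esub> f) \<ominus>\<^bsub>gcpoly\<^esub> (?C +>\<^bsub>free_alg\<^esub> g) = ?C +>\<^bsub>free_alg\<^esub> (f \<ominus>\<^bsub>free_alg\<^esub> g)"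
    using f g by (simp add: a_minus_def)
  also have "\<dots> \<in> squares_ideal \<longleftrightarrow> f \<ominus>\<^bsub>free_alg\<^esub> g \<in> vanishing"
    using f g by (simp add: vanishing_eq_rel_ideal rel_ideal_def)
  also have "\<dots> \<longleftrightarrow> realize f = realize g"
    using f g R.minus_closed[OF f g]
    unfolding realize_eq_iff by (simp add: vanishing_def minus_free_alg form_of_diff fun_eq_iff)
  finally show ?thesis .
qed

theorem theorem1p4:
  fixes a b :: "'n::finite \<Rightarrow> 'n biform set"
  defines "a \<equiv> \<lambda>i. dk_class 1 0 (tensor (dx i) (const_form 1))"
    and "b \<equiv> \<lambda>i. dk_class 0 1 (tensor (const_form 1) (dx i))"
  shows "(\<forall>i. a i \<in> carrier (DK 1 0) \<and> b i \<in> carrier (DK 0 1)) \<and>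
    (\<exists>h \<in> ring_iso (gcpoly Quot squares_ideal) DK_ring.
      (\<forall>r. h (squares_ideal +>\<^bsub>gcpoly\<^esub> gcpoly_const r)
             = dk_incl 0 0 (dk_class 0 0 (tensor (const_form r) (const_form 1)))) \<and>
      (\<forall>i. h (squares_ideal +>\<^bsub>gcpoly\<^esub> gcpoly_gen (Inl i)) = dk_incl 1 0 (a i)) \<and>
      (\<forall>i. h (squares_ideal +>\<^bsub>gcpoly\<^esub> gcpoly_gen (Inr i)) = dk_incl 0 1 (b i)))"
proof -
  have "a i \<in> carrier (DK 1 0)" "b i \<in> carrier (DK 0 1)" for i
    using word_form_closed[of "[Inl i]"] word_form_closed[of "[Inr i]"]
    by (simp_all add: a_def b_def dk_class_in_carrier flip: word_form_Inl word_form_Inr)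
  moreover obtain h where h: "h \<in> ring_iso (gcpoly Quot squares_ideal) (DK_ring :: (nat \<times> nat \<Rightarrow> 'n biform set) ring)"
    and hp: "\<And>f. f \<in> carrier free_alg \<Longrightarrow> h (quot_map f) = realize f"
    using ring_iso_of_same_fibres[OF free_alg_ring quot_map_hom quot_map_surj realize_hom realize_surj quot_map_eq_iff] by blast
  have hw: "h (squares_ideal +>\<^bsub>gcpoly\<^esub> (comm_ideal +>\<^bsub>free_alg\<^esub> word_mon c w)) =
     dk_incl (length (lefts w)) (length (rights w)) (dk_class (length (lefts w)) (length (rights w)) (\<lambda>P u v. c * word_form w P u v))"
    for c w
    using hp[OF word_mon_closed, of c w] by (simp add: quot_map_def realize_word_mon)
  have "h (squares_ideal +>\<^bsub>gcpoly\<^esub> gcpoly_const r) = dk_incl 0 0 (dk_class 0 0 (tensor (const_form r) (const_form 1)))" for r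
    by (simp add: gcpoly_const_def hw word_form_Nil)
  moreover have "h (squares_ideal +>\<^bsub>gcpoly\<^esub> gcpoly_gen (Inl i)) = dk_incl 1 0 (a i)" for i
    by (simp add: gcpoly_gen_def hw word_form_Inl a_def)
  moreover have "h (squares_ideal +>\<^bsub>gcpoly\<^esub> gcpoly_gen (Inr i)) = dk_incl 0 1 (b i)" for i
    by (simp add: gcpoly_gen_def hw word_form_Inr b_def)
  ultimately show ?thesis using h by blast
qed

end
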